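(* Let $(\Lambda,d)$ be a topological $k$-graph. If either (i) $k=1$, or (ii) $(\Lambda,d)$ is a finitely aligned discrete $k$-graph, then the boundary-path groupoid $\mathcal{G}_\Lambda$ is amenable.
   Context: Conventions: $\mathbb{N}=\{0,1,2,\dots\}$; on $(\mathbb{N}\cup\{\infty\})^k$, $\le$ is the coordinatewise order and $\vee,\wedge$ are coordinatewise max and min. Topological $k$-graph ($k\in\mathbb{N}$): a pair $(\Lambda,d)$ of a small category $\Lambda$ (range = codomain map $r$, source = domain map $s$; $\lambda\mu$ is defined when $s(\lambda)=r(\mu)$) and a functor $d:\Lambda\to\mathbb{N}^k$ such that: (1) the object and morphism sets are second-countable locally compact Hausdorff spaces; (2) $r,s$ are continuous and $s$ is a local homeomorphism; (3) composition, from the set of composable pairs with the relative product topology, is continuous and open; (4) $d$ is continuous, $\mathbb{N}^k$ being discrete; (5) if $d(\lambda)=m+n$ there is a unique composable pair $(\xi,\eta)$ with $\lambda=\xi\eta$, $d(\xi)=m$, $d(\eta)=n$. $\Lambda$ also denotes the morphism set, objects are identified with identity morphisms, $\Lambda^m:=d^{-1}(\{m\})$ (so $\Lambda^0$ is the object set), and $UV:=\{\lambda\mu:\lambda\in U,\mu\in V,s(\lambda)=r(\mu)\}$ for $U,V\subset\Lambda$. $\Lambda^{\min}(\lambda,\mu):=\{(\alpha,\beta):\lambda\alpha=\mu\beta,\ d(\lambda\alpha)=d(\lambda)\vee d(\mu)\}$. A discrete $k$-graph is a topological $k$-graph whose object and morphism spaces are discrete; it is finitely aligned if $\Lambda^{\min}(\lambda,\mu)$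 is finite for all $\lambda,\mu\in\Lambda$. A topological $k$-graph is compactly aligned if for all $p,q\in\mathbb{N}^k$ and compact $U\subset\Lambda^p$, $V\subset\Lambda^q$, the set $U\Lambda^{(p\vee q)-p}\cap V\Lambda^{(p\vee q)-q}$ is compact; in both cases (i) and (ii) $\Lambda$ is compactly aligned, so $\mathcal{G}_\Lambda$ below is a locally compact topological groupoid. Path space: for $m\in(\mathbb{N}\cup\{\infty\})^k$ let $\Omega_{k,m}$ be the discrete topological $k$-graph with objects $\{p\in\mathbb{N}^k:p\le m\}$, morphisms $\{(p,q)\in\mathbb{N}^k\times\mathbb{N}^k:p\le q\le m\}$, $r(p,q)=p$, $s(p,q)=q$, $(n,p)(p,q)=(n,q)$, $d(p,q)=q-p$. $X_\Lambda$ is the set of all degree-preserving (continuous) functors $x:\Omega_{k,m}\to\Lambda$, $m\in(\mathbb{N}\cup\{\infty\})^k$; put $d(x)=m$, $r(x)=x(0)$. For $m\in\mathbb{N}^k$, $m\le d(x)$, $\sigma^mx\in X_\Lambda$ has degree $d(x)-m$ and $(\sigma^mx)(0,p)=x(m,m+p)$; for $\lambda\in\Lambda$ with $s(\lambda)=r(x)$, $\lambda x\in X_\Lambda$ has degree $d(\lambda)+d(x)$, $(\lambda x)(0,d(\lambda))=\lambda$ and $\sigma^{d(\lambda)}(\lambda x)=x$. Path groupoid $G_\Lambda$: let $\Lambda*_s\Lambda:=\{(\lambda,\mu)\in\Lambda\times\Lambda:s(\lambda)=s(\mu)\}$ and $U*_sV:=(U\times V)\cap(\Lambda*_s\Lambda)$.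 $G_\Lambda$ has object set $X_\Lambda$ and morphisms $(\lambda x,d(\lambda)-d(\mu),\mu x)\in X_\Lambda\times\mathbb{Z}^k\times X_\Lambda$ with $(\lambda,\mu)\in\Lambda*_s\Lambda$, $x\in X_\Lambda$, $r(x)=s(\lambda)$; $r(x,m,y)=x$, $s(x,m,y)=y$, $(x,m,y)(y,n,z)=(x,m+n,z)$, $(x,m,y)^{-1}=(y,-m,x)$; the unit $x$ is identified with $(x,0,x)$. For $F\subset\Lambda*_s\Lambda$, $m\in\mathbb{Z}^k$, let $Z(F,m):=\{(\lambda x,d(\lambda)-d(\mu),\mu x)\in G_\Lambda:(\lambda,\mu)\in F,\ d(\lambda)-d(\mu)=m\}$. The topology on $G_\Lambda$ has as basis the sets $Z(U*_sV,m)\cap Z(F,m)^c$ with $m\in\mathbb{Z}^k$, $U,V\subset\Lambda$ open, $F\subset\Lambda*_s\Lambda$ compact. Boundary paths: for $V\subset\Lambda^0$, a set $E\subset V\Lambda$ is exhaustive for $V$ if for every $\lambda\in V\Lambda$ there is $\mu\in E$ with $\Lambda^{\min}(\lambda,\mu)\neq\emptyset$. For $v\in\Lambda^0$, $v\mathcal{CE}(\Lambda)$ is the set of compact $E\subset\Lambda$ such that $r(E)$ is a neighbourhood of $v$ and $E$ is exhaustive for $r(E)$. $x\in X_\Lambda$ is a boundary path if for all $m\in\mathbb{N}^k$ with $m\le d(x)$ and all $E\in x(m)\mathcal{CE}(\Lambda)$ there is $\lambda\in E$ with $x(m,m+d(\lambda))=\lambda$. $\partial\Lambda$ is the set of boundary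 paths (a closed invariant subset of $G_\Lambda^{(0)}=X_\Lambda$), and $\mathcal{G}_\Lambda:=G_\Lambda|_{\partial\Lambda}$ is the reduction, with the relative topology and Haar system of counting measures. Amenability is in the sense of Anantharaman-Delaroche and Renault (topological amenability): a locally compact groupoid $\Gamma$ is amenable if there is a net $(m_i)$, where each $m_i=(m_i^x)_{x\in\Gamma^{(0)}}$ is a family of probability measures with $m_i^x$ carried by $r^{-1}(x)$ and $x\mapsto\int f\,dm_i^x$ continuous for all $f\in C_c(\Gamma)$, such that $\|\gamma m_i^{s(\gamma)}-m_i^{r(\gamma)}\|_1\to0$ uniformly on compact subsets of $\Gamma$. *)

theory Defs
  imports "HOL-Probability.Probability_Measure" "HOL-Library.Function_Algebras"
begin

text \<open>\<^term>\<open>cmp C f g\<close> is the composite \<open>f g\<close>, meaningful when the source of \<open>f\<close> is the range of \<open>g\<close>.\<close>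

record ('o, 'a) top_cat =
  obj_top :: "'o topology"
  mor_top :: "'a topology"
  rng :: "'a \<Rightarrow> 'o"
  src :: "'a \<Rightarrow> 'o"
  idt :: "'o \<Rightarrow> 'a"
  cmp :: "'a \<Rightarrow> 'a \<Rightarrow> 'a"

abbreviation objs :: "('o, 'a, 'z) top_cat_scheme \<Rightarrow> 'o set" where
  "objs C \<equiv> topspace (obj_top C)"

abbreviation mors :: "('o, 'a, 'z) top_cat_scheme \<Rightarrow> 'a set" where
  "mors C \<equiv> topspace (mor_top C)"

definition composable :: "('o, 'a, 'z) top_cat_scheme \<Rightarrow> ('a \<times> 'a) set" where
  "composable C = {(f, g). f \<in> mors C \<and> g \<in> mors C \<and> src C f = rng C g}"

definition small_category :: "('o, 'a, 'z) top_cat_scheme \<Rightarrow> bool" where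
  "small_category C \<longleftrightarrow>
     (\<forall>f\<in>mors C. rng C f \<in> objs C \<and> src C f \<in> objs C) \<and>
     (\<forall>v\<in>objs C. idt C v \<in> mors C \<and> rng C (idt C v) = v \<and> src C (idt C v) = v) \<and>
     (\<forall>(f, g)\<in>composable C.
        cmp C f g \<in> mors C \<and> rng C (cmp C f g) = rng C f \<and> src C (cmp C f g) = src C g) \<and>
     (\<forall>f\<in>mors C. cmp C (idt C (rng C f)) f = f \<and> cmp C f (idt C (src C f)) = f) \<and>
     (\<forall>f g h. (f, g) \<in> composable C \<longrightarrow> (g, h) \<in> composable C \<longrightarrow>
        cmp C (cmp C f g) h = cmp C f (cmp C g h))"

text \<open>
  \<open>k\<close>-tuples are functions on all of \<^typ>\<open>nat\<close> that vanish from index \<open>k\<close> on, so that \<open>k = 0\<close>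
  is allowed and sums, differences, \<open>\<le>\<close> and \<open>sup\<close> of tuples are the pointwise ones.  The
  entries are of type \<^typ>\<open>nat\<close>, \<^typ>\<open>enat\<close> or \<^typ>\<open>int\<close>.
\<close>

definition tuples :: "nat \<Rightarrow> (nat \<Rightarrow> 'n::zero) set" where
  "tuples k = {m. \<forall>i\<ge>k. m i = 0}"

record ('o, 'a) kgraph = "('o, 'a) top_cat" +
  deg :: "'a \<Rightarrow> nat \<Rightarrow> nat"

definition local_homeomorphism :: "'a topology \<Rightarrow> 'b topology \<Rightarrow> ('a \<Rightarrow> 'b) \<Rightarrow> bool" where
  "local_homeomorphism X Y f \<longleftrightarrow>
     (\<forall>x\<in>topspace X. \<exists>U. openin X U \<and> x \<in> U \<and> openin Y (f ` U) \<and>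
        homeomorphic_map (subtopology X U) (subtopology Y (f ` U)) f)"

definition degree_functor :: "nat \<Rightarrow> ('o, 'a, 'z) kgraph_scheme \<Rightarrow> bool" where
  "degree_functor k \<Lambda> \<longleftrightarrow>
     (\<forall>f\<in>mors \<Lambda>. deg \<Lambda> f \<in> tuples k) \<and>
     (\<forall>v\<in>objs \<Lambda>. deg \<Lambda> (idt \<Lambda> v) = 0) \<and>
     (\<forall>(f, g)\<in>composable \<Lambda>. deg \<Lambda> (cmp \<Lambda> f g) = deg \<Lambda> f + deg \<Lambda> g)"

definition unique_factorisation :: "nat \<Rightarrow> ('o, 'a, 'z) kgraph_scheme \<Rightarrow> bool" where
  "unique_factorisation k \<Lambda> \<longleftrightarrow>
     (\<forall>f\<in>mors \<Lambda>. \<forall>m\<in>tuples k. \<forall>n\<in>tuples k. deg \<Lambda> f = m + n \<longrightarrow>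
        (\<exists>!p. p \<in> composable \<Lambda> \<and> f = cmp \<Lambda> (fst p) (snd p) \<and>
              deg \<Lambda> (fst p) = m \<and> deg \<Lambda> (snd p) = n))"

definition topological_k_graph :: "nat \<Rightarrow> ('o, 'a, 'z) kgraph_scheme \<Rightarrow> bool" where
  "topological_k_graph k \<Lambda> \<longleftrightarrow>
     small_category \<Lambda> \<and> degree_functor k \<Lambda> \<and>
     second_countable (obj_top \<Lambda>) \<and> locally_compact_space (obj_top \<Lambda>) \<and> Hausdorff_space (obj_top \<Lambda>) \<and>
     second_countable (mor_top \<Lambda>) \<and> locally_compact_space (mor_top \<Lambda>) \<and> Hausdorff_space (mor_top \<Lambda>) \<and>
     continuous_map (mor_top \<Lambda>) (obj_top \<Lambda>) (rng \<Lambda>) \<and>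
     continuous_map (mor_top \<Lambda>) (obj_top \<Lambda>) (src \<Lambda>) \<and>
     local_homeomorphism (mor_top \<Lambda>) (obj_top \<Lambda>) (src \<Lambda>) \<and>
     continuous_map (subtopology (prod_topology (mor_top \<Lambda>) (mor_top \<Lambda>)) (composable \<Lambda>)) (mor_top \<Lambda>)
       (\<lambda>(f, g). cmp \<Lambda> f g) \<and>
     open_map (subtopology (prod_topology (mor_top \<Lambda>) (mor_top \<Lambda>)) (composable \<Lambda>)) (mor_top \<Lambda>)
       (\<lambda>(f, g). cmp \<Lambda> f g) \<and>
     continuous_map (mor_top \<Lambda>) (discrete_topology (tuples k)) (deg \<Lambda>) \<and>
     unique_factorisation k \<Lambda>"

text \<open>This is \<open>\<Lambda>\<^sup>m\<^sup>i\<^sup>n(l, \<mu>)\<close>.\<close>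

definition min_ext :: "('o, 'a, 'z) kgraph_scheme \<Rightarrow> 'a \<Rightarrow> 'a \<Rightarrow> ('a \<times> 'a) set" where
  "min_ext \<Lambda> l \<mu> = {(\<alpha>, \<beta>). (l, \<alpha>) \<in> composable \<Lambda> \<and> (\<mu>, \<beta>) \<in> composable \<Lambda> \<and>
     cmp \<Lambda> l \<alpha> = cmp \<Lambda> \<mu> \<beta> \<and> deg \<Lambda> (cmp \<Lambda> l \<alpha>) = sup (deg \<Lambda> l) (deg \<Lambda> \<mu>)}"

definition discrete_k_graph :: "nat \<Rightarrow> ('o, 'a, 'z) kgraph_scheme \<Rightarrow> bool" where
  "discrete_k_graph k \<Lambda> \<longleftrightarrow> topological_k_graph k \<Lambda> \<and>
     obj_top \<Lambda> = discrete_topology (objs \<Lambda>) \<and> mor_top \<Lambda> = discrete_topology (mors \<Lambda>)"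

definition finitely_aligned :: "('o, 'a, 'z) kgraph_scheme \<Rightarrow> bool" where
  "finitely_aligned \<Lambda> \<longleftrightarrow> (\<forall>l\<in>mors \<Lambda>. \<forall>\<mu>\<in>mors \<Lambda>. finite (min_ext \<Lambda> l \<mu>))"

definition Omega :: "nat \<Rightarrow> (nat \<Rightarrow> enat) \<Rightarrow> (nat \<Rightarrow> nat, (nat \<Rightarrow> nat) \<times> (nat \<Rightarrow> nat)) kgraph" where
  "Omega k m = \<lparr>
     obj_top = discrete_topology {p \<in> tuples k. enat \<circ> p \<le> m},
     mor_top = discrete_topology {(p, q). p \<in> tuples k \<and> q \<in> tuples k \<and> p \<le> q \<and> enat \<circ> q \<le> m},
     rng = fst,
     src = snd,
     idt = (\<lambda>p. (p, p)),
     cmp = (\<lambda>f g. (fst f, snd g)),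
     deg = (\<lambda>(p, q). q - p)\<rparr>"

definition kgraph_morphism ::
  "('o, 'a, 'z) kgraph_scheme \<Rightarrow> ('p, 'b, 'y) kgraph_scheme \<Rightarrow> ('o \<Rightarrow> 'p) \<Rightarrow> ('a \<Rightarrow> 'b) \<Rightarrow> bool" where
  "kgraph_morphism \<Gamma> \<Lambda> F0 F1 \<longleftrightarrow>
     continuous_map (obj_top \<Gamma>) (obj_top \<Lambda>) F0 \<and>
     continuous_map (mor_top \<Gamma>) (mor_top \<Lambda>) F1 \<and>
     (\<forall>f\<in>mors \<Gamma>. rng \<Lambda> (F1 f) = F0 (rng \<Gamma> f) \<and> src \<Lambda> (F1 f) = F0 (src \<Gamma> f)) \<and>
     (\<forall>v\<in>objs \<Gamma>. F1 (idt \<Gamma> v) = idt \<Lambda> (F0 v)) \<and>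
     (\<forall>(f, g)\<in>composable \<Gamma>. F1 (cmp \<Gamma> f g) = cmp \<Lambda> (F1 f) (F1 g)) \<and>
     (\<forall>f\<in>mors \<Gamma>. deg \<Lambda> (F1 f) = deg \<Gamma> f)"

text \<open>
  A functor on \<^term>\<open>Omega k (pdeg x)\<close>, as its object map and its morphism map; both are
  \<^const>\<open>extensional\<close>, so that equal functors are equal as records.
\<close>

record ('o, 'a) kpath =
  pdeg :: "nat \<Rightarrow> enat"
  pobj :: "(nat \<Rightarrow> nat) \<Rightarrow> 'o"
  pmor :: "(nat \<Rightarrow> nat) \<times> (nat \<Rightarrow> nat) \<Rightarrow> 'a"

definition path_space :: "nat \<Rightarrow> ('o, 'a, 'z) kgraph_scheme \<Rightarrow> ('o, 'a) kpath set" where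
  "path_space k \<Lambda> = {x. pdeg x \<in> tuples k \<and>
     kgraph_morphism (Omega k (pdeg x)) \<Lambda> (pobj x) (pmor x) \<and>
     pobj x \<in> extensional (objs (Omega k (pdeg x))) \<and>
     pmor x \<in> extensional (mors (Omega k (pdeg x)))}"

definition shift :: "nat \<Rightarrow> (nat \<Rightarrow> nat) \<Rightarrow> ('o, 'a) kpath \<Rightarrow> ('o, 'a) kpath" where
  "shift k m x = (let n = pdeg x - (enat \<circ> m) in \<lparr>
     pdeg = n,
     pobj = restrict (\<lambda>p. pobj x (m + p)) (objs (Omega k n)),
     pmor = restrict (\<lambda>(p, q). pmor x (m + p, m + q)) (mors (Omega k n))\<rparr>)"

definition prepend ::
  "nat \<Rightarrow> ('o, 'a, 'z) kgraph_scheme \<Rightarrow> 'a \<Rightarrow> ('o, 'a) kpath \<Rightarrow> ('o, 'a) kpath" where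
  "prepend k \<Lambda> l x = (THE y. y \<in> path_space k \<Lambda> \<and> pdeg y = (enat \<circ> deg \<Lambda> l) + pdeg x \<and>
     pmor y (0, deg \<Lambda> l) = l \<and> shift k (deg \<Lambda> l) y = x)"

record ('x, 'g) top_groupoid = "('x, 'g) top_cat" +
  ginv :: "'g \<Rightarrow> 'g"

type_synonym ('o, 'a) path_arrow = "('o, 'a) kpath \<times> (nat \<Rightarrow> int) \<times> ('o, 'a) kpath"

definition same_src :: "('o, 'a, 'z) kgraph_scheme \<Rightarrow> ('a \<times> 'a) set" where
  "same_src \<Lambda> = {(l, \<mu>). l \<in> mors \<Lambda> \<and> \<mu> \<in> mors \<Lambda> \<and> src \<Lambda> l = src \<Lambda> \<mu>}"

text \<open>This is \<open>Z(F, m)\<close>, for \<open>F\<close> a set of pairs with a common source.\<close>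

definition cyl ::
  "nat \<Rightarrow> ('o, 'a, 'z) kgraph_scheme \<Rightarrow> ('a \<times> 'a) set \<Rightarrow> (nat \<Rightarrow> int) \<Rightarrow> ('o, 'a) path_arrow set" where
  "cyl k \<Lambda> F m = {(prepend k \<Lambda> l x, m, prepend k \<Lambda> \<mu> x) | l \<mu> x.
     (l, \<mu>) \<in> F \<inter> same_src \<Lambda> \<and> x \<in> path_space k \<Lambda> \<and> pobj x 0 = src \<Lambda> l \<and>
     (int \<circ> deg \<Lambda> l) - (int \<circ> deg \<Lambda> \<mu>) = m}"

definition path_arrows :: "nat \<Rightarrow> ('o, 'a, 'z) kgraph_scheme \<Rightarrow> ('o, 'a) path_arrow set" where
  "path_arrows k \<Lambda> = (\<Union>m\<in>tuples k. cyl k \<Lambda> (same_src \<Lambda>) m)"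

definition path_arrow_basis :: "nat \<Rightarrow> ('o, 'a, 'z) kgraph_scheme \<Rightarrow> ('o, 'a) path_arrow set set" where
  "path_arrow_basis k \<Lambda> = {cyl k \<Lambda> ((U \<times> V) \<inter> same_src \<Lambda>) m \<inter> (path_arrows k \<Lambda> - cyl k \<Lambda> F m) | m U V F.
     m \<in> tuples k \<and> openin (mor_top \<Lambda>) U \<and> openin (mor_top \<Lambda>) V \<and>
     F \<subseteq> same_src \<Lambda> \<and> compactin (prod_topology (mor_top \<Lambda>) (mor_top \<Lambda>)) F}"

text \<open>
  For compactly aligned \<open>\<Lambda>\<close> (in particular for \<open>k = 1\<close>, and for finitely aligned discrete \<open>\<Lambda>\<close>)
  these sets are a basis, so the generated topology consists of their unions.
\<close>

definition path_arrow_topology :: "nat \<Rightarrow> ('o, 'a, 'z) kgraph_scheme \<Rightarrow> ('o, 'a) path_arrow topology" where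
  "path_arrow_topology k \<Lambda> = topology_generated_by (path_arrow_basis k \<Lambda>)"

text \<open>A path \<open>x\<close> is identified with \<open>(x, 0, x)\<close>; this determines the topology on the path space.\<close>

definition path_groupoid ::
  "nat \<Rightarrow> ('o, 'a, 'z) kgraph_scheme \<Rightarrow> (('o, 'a) kpath, ('o, 'a) path_arrow) top_groupoid" where
  "path_groupoid k \<Lambda> = \<lparr>
     obj_top = pullback_topology (path_space k \<Lambda>) (\<lambda>x. (x, 0, x)) (path_arrow_topology k \<Lambda>),
     mor_top = path_arrow_topology k \<Lambda>,
     rng = (\<lambda>(x, m, y). x),
     src = (\<lambda>(x, m, y). y),
     idt = (\<lambda>x. (x, 0, x)),
     cmp = (\<lambda>(x, m, y) (y', n, z). (x, m + n, z)),
     ginv = (\<lambda>(x, m, y). (y, - m, x))\<rparr>"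

definition exhaustive :: "('o, 'a, 'z) kgraph_scheme \<Rightarrow> 'o set \<Rightarrow> 'a set \<Rightarrow> bool" where
  "exhaustive \<Lambda> V E \<longleftrightarrow> E \<subseteq> {l \<in> mors \<Lambda>. rng \<Lambda> l \<in> V} \<and>
     (\<forall>l\<in>mors \<Lambda>. rng \<Lambda> l \<in> V \<longrightarrow> (\<exists>\<mu>\<in>E. min_ext \<Lambda> l \<mu> \<noteq> {}))"

definition compact_exhaustive :: "('o, 'a, 'z) kgraph_scheme \<Rightarrow> 'o \<Rightarrow> 'a set set" where
  "compact_exhaustive \<Lambda> v = {E. compactin (mor_top \<Lambda>) E \<and>
     (\<exists>W. openin (obj_top \<Lambda>) W \<and> v \<in> W \<and> W \<subseteq> rng \<Lambda> ` E) \<and> exhaustive \<Lambda> (rng \<Lambda> ` E) E}"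

definition boundary_paths :: "nat \<Rightarrow> ('o, 'a, 'z) kgraph_scheme \<Rightarrow> ('o, 'a) kpath set" where
  "boundary_paths k \<Lambda> = {x \<in> path_space k \<Lambda>.
     \<forall>m\<in>tuples k. enat \<circ> m \<le> pdeg x \<longrightarrow> (\<forall>E\<in>compact_exhaustive \<Lambda> (pobj x m).
       \<exists>l\<in>E. enat \<circ> (m + deg \<Lambda> l) \<le> pdeg x \<and> pmor x (m, m + deg \<Lambda> l) = l)}"

definition reduction :: "('x, 'g) top_groupoid \<Rightarrow> 'x set \<Rightarrow> ('x, 'g) top_groupoid" where
  "reduction \<Gamma> Y = \<Gamma>\<lparr>
     obj_top := subtopology (obj_top \<Gamma>) Y,
     mor_top := subtopology (mor_top \<Gamma>) {\<gamma>. rng \<Gamma> \<gamma> \<in> Y \<and> src \<Gamma> \<gamma> \<in> Y}\<rparr>"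

definition boundary_path_groupoid ::
  "nat \<Rightarrow> ('o, 'a, 'z) kgraph_scheme \<Rightarrow> (('o, 'a) kpath, ('o, 'a) path_arrow) top_groupoid" where
  "boundary_path_groupoid k \<Lambda> = reduction (path_groupoid k \<Lambda>) (boundary_paths k \<Lambda>)"

definition borel_on :: "'g topology \<Rightarrow> 'g measure" where
  "borel_on T = sigma (topspace T) {U. openin T U}"

definition Cc :: "'g topology \<Rightarrow> ('g \<Rightarrow> complex) set" where
  "Cc T = {f. continuous_map T euclidean f \<and> compactin T (T closure_of {\<gamma> \<in> topspace T. f \<gamma> \<noteq> 0})}"

text \<open>The total variation norm of the signed measure \<open>\<mu> - \<nu>\<close>, for finite measures \<open>\<mu>\<close>, \<open>\<nu>\<close> on one space.\<close>

definition tv_dist :: "'g measure \<Rightarrow> 'g measure \<Rightarrow> real" where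
  "tv_dist \<mu> \<nu> = (SUP P\<in>{P. finite P \<and> disjoint P \<and> P \<subseteq> sets \<mu> \<and> \<Union>P = space \<mu>}.
     \<Sum>A\<in>P. \<bar>measure \<mu> A - measure \<nu> A\<bar>)"

text \<open>
  \<open>\<mu>\<close> is carried by the range fibre over the source of \<open>\<gamma>\<close>; it is restricted to that fibre first
  because the product is meaningless elsewhere.
\<close>

definition translate :: "('x, 'g) top_groupoid \<Rightarrow> 'g \<Rightarrow> 'g measure \<Rightarrow> 'g measure" where
  "translate \<Gamma> \<gamma> \<mu> =
     distr (restrict_space \<mu> {\<eta> \<in> mors \<Gamma>. rng \<Gamma> \<eta> = src \<Gamma> \<gamma>}) (borel_on (mor_top \<Gamma>)) (cmp \<Gamma> \<gamma>)"

definition continuous_mean :: "('x, 'g) top_groupoid \<Rightarrow> ('x \<Rightarrow> 'g measure) \<Rightarrow> bool" where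
  "continuous_mean \<Gamma> m \<longleftrightarrow>
     (\<forall>x\<in>objs \<Gamma>. prob_space (m x) \<and> space (m x) = mors \<Gamma> \<and>
        sets (m x) = sets (borel_on (mor_top \<Gamma>)) \<and> (AE \<gamma> in m x. rng \<Gamma> \<gamma> = x)) \<and>
     (\<forall>f\<in>Cc (mor_top \<Gamma>). continuous_map (obj_top \<Gamma>) euclidean (\<lambda>x. \<integral>\<gamma>. f \<gamma> \<partial>m x))"

definition directed_set :: "'i set \<Rightarrow> ('i \<times> 'i) set \<Rightarrow> bool" where
  "directed_set I R \<longleftrightarrow> I \<noteq> {} \<and> preorder_on I R \<and> (\<forall>i\<in>I. \<forall>j\<in>I. \<exists>l\<in>I. (i, l) \<in> R \<and> (j, l) \<in> R)"

text \<open>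
  Only meaningful for locally compact groupoids, which is not part of the predicate; no Haar
  system enters.

  Index types cannot be quantified over.  The type \<^typ>\<open>'g set \<times> real\<close> of the indices is no
  restriction: from a net with any index set one obtains a net indexed by the pairs \<open>(K, \<epsilon>)\<close>
  of a compact set and a positive number, by choosing for each pair a member of the net
  which is \<open>\<epsilon>\<close>-invariant on \<open>K\<close>.
\<close>

definition amenable :: "('x, 'g) top_groupoid \<Rightarrow> bool" where
  "amenable \<Gamma> \<longleftrightarrow>
     (\<exists>(I :: ('g set \<times> real) set) R m. directed_set I R \<and>
        (\<forall>i\<in>I. continuous_mean \<Gamma> (m i)) \<and>
        (\<forall>K. compactin (mor_top \<Gamma>) K \<longrightarrow> (\<forall>\<epsilon>>0. \<exists>i0\<in>I. \<forall>i\<in>I. (i0, i) \<in> R \<longrightarrow>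
           (\<forall>\<gamma>\<in>K. tv_dist (translate \<Gamma> \<gamma> (m i (src \<Gamma> \<gamma>))) (m i (rng \<Gamma> \<gamma>)) < \<epsilon>))))"

end

theory Submission
  imports Defs "HOL-Probability.Product_PMF"
begin

text \<open>
  Both cases are compactly aligned: for compact \<open>C, D \<subseteq> \<Lambda>\<close>, the paths \<open>\<alpha>\<close> with
  \<open>(\<alpha>, \<beta>) \<in> \<Lambda>\<^sup>m\<^sup>i\<^sup>n(l, \<mu>)\<close>, \<open>l \<in> C\<close>, \<open>\<mu> \<in> D\<close>, lie in a compact set.  The averages
  over \<open>i \<in> {0..N}\<^sup>k\<close> of the point masses at \<open>(x, j, \<sigma>\<^sup>j x)\<close>, where \<open>j = i \<and> d(x)\<close>, are almost
  invariant, but they do not depend continuously on \<open>x\<close>, because \<open>d\<close> is not continuous.  Hence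
  \<open>i \<and> d(x)\<close> is replaced by the supremum \<open>q\<^sub>n(x, i)\<close> of the \<open>m \<le> i \<and> d(x)\<close> with \<open>x(0, m) \<in> C\<^sub>n\<close>, where
  \<open>C\<^sub>0 \<subseteq> C\<^sub>1 \<subseteq> \<dots>\<close> are compact, \<open>C\<^sub>0\<close> contains all paths needed to describe the given compact set
  of arrows, and \<open>C\<^sub>n\<^sub>+\<^sub>1\<close> contains \<open>C\<^sub>0 C\<^sub>n\<close> and all \<open>\<alpha>\<close> as above for \<open>l \<in> C\<^sub>0\<close>, \<open>\<mu> \<in> C\<^sub>n\<close>.  If
  \<open>x = l z\<close> with \<open>l \<in> C\<^sub>0\<close>, then
  \<open>d(l) + q\<^sub>n(z, i) \<le> q\<^sub>n\<^sub>+\<^sub>1(x, d(l) + i)\<close> and \<open>q\<^sub>n(x, d(l) + i) \<le> d(l) + q\<^sub>n\<^sub>+\<^sub>1(z, i)\<close>.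
  As \<open>q\<^sub>n(z, i)\<close> increases with \<open>n\<close> and is bounded by \<open>i\<close>, it can change for at most \<open>k N\<close> of the \<open>n\<close>, and
  wherever it is constant for a few consecutive \<open>n\<close> the inequalities are equalities.  So averaging also over \<open>n < L\<close> with \<open>L\<close> much
  larger than \<open>k N\<close> yields almost invariant measures.  To make them continuous in \<open>x\<close>, the
  indicator function of \<open>C\<^sub>n\<close> is replaced by a continuous function between those of \<open>C\<^sub>n\<close> and \<open>C\<^sub>n\<^sub>+\<^sub>1\<close>,
  and \<open>q\<^sub>n\<close> by the supremum of a random set of degrees.
\<close>

section \<open>Factorisation\<close>

lemma zero_tuples [simp]: "0 \<in> tuples k"
  by (simp add: tuples_def)

lemma add_tuples [simp]: "m \<in> tuples k \<Longrightarrow> n \<in> tuples k \<Longrightarrow> m + n \<in> tuples k"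
  for m n :: "nat \<Rightarrow> 'n::monoid_add"
  by (simp add: tuples_def)

lemma diff_tuples [simp]: "m \<in> tuples k \<Longrightarrow> m - n \<in> tuples k" for m n :: "nat \<Rightarrow> nat"
  by (simp add: tuples_def)

lemma int_diff_tuples [simp]:
  "m \<in> tuples k \<Longrightarrow> n \<in> tuples k \<Longrightarrow> (int \<circ> m) - (int \<circ> n) \<in> tuples k"
  by (simp add: tuples_def)

lemma sup_tuples [simp]: "m \<in> tuples k \<Longrightarrow> n \<in> tuples k \<Longrightarrow> sup m n \<in> tuples k"
  for m n :: "nat \<Rightarrow> nat"
  by (simp add: tuples_def)

lemma tuple_le_add [simp]: "m \<le> m + n" "m \<le> n + m" for m n :: "nat \<Rightarrow> nat"
  by (auto simp: le_fun_def)

lemma tuple_zero_le [simp]: "0 \<le> m" for m :: "nat \<Rightarrow> nat"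
  by (auto simp: le_fun_def)

lemma tuple_add_diff: "m \<le> n \<Longrightarrow> m + (n - m) = n" for m n :: "nat \<Rightarrow> nat"
  by (auto simp: le_fun_def)

lemma tuple_add_diff_left [simp]: "m + n - m = n" for m n :: "nat \<Rightarrow> nat"
  by auto

lemma tuple_add_left_cancel [simp]: "m + n = m + n' \<longleftrightarrow> n = n'" for m n :: "nat \<Rightarrow> nat"
  by (auto simp: fun_eq_iff)

lemma tuple_add_le_cancel [simp]: "m + n \<le> m + n' \<longleftrightarrow> n \<le> n'" for m n :: "nat \<Rightarrow> nat"
  by (auto simp: le_fun_def)

locale topological_kgraph =
  fixes k :: nat and \<Lambda> :: "('o, 'a, 'z) kgraph_scheme"
  assumes topological_k_graph: "topological_k_graph k \<Lambda>"
begin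

abbreviation cmp_graph (infixl "\<cdot>" 70) where "f \<cdot> g \<equiv> cmp \<Lambda> f g"

lemma
  shows cat: "small_category \<Lambda>" and degf: "degree_functor k \<Lambda>"
    and Hausdorff_obj: "Hausdorff_space (obj_top \<Lambda>)"
    and second_countable_mor: "second_countable (mor_top \<Lambda>)"
    and locally_compact_mor: "locally_compact_space (mor_top \<Lambda>)"
    and Hausdorff_mor: "Hausdorff_space (mor_top \<Lambda>)"
    and continuous_rng: "continuous_map (mor_top \<Lambda>) (obj_top \<Lambda>) (rng \<Lambda>)"
    and continuous_src: "continuous_map (mor_top \<Lambda>) (obj_top \<Lambda>) (src \<Lambda>)"
    and local_homeomorphism_src: "local_homeomorphism (mor_top \<Lambda>) (obj_top \<Lambda>) (src \<Lambda>)"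
    and continuous_cmp: "continuous_map (subtopology (prod_topology (mor_top \<Lambda>) (mor_top \<Lambda>))
           (composable \<Lambda>)) (mor_top \<Lambda>) (\<lambda>(f, g). cmp \<Lambda> f g)"
    and open_cmp: "open_map (subtopology (prod_topology (mor_top \<Lambda>) (mor_top \<Lambda>))
           (composable \<Lambda>)) (mor_top \<Lambda>) (\<lambda>(f, g). cmp \<Lambda> f g)"
    and continuous_deg: "continuous_map (mor_top \<Lambda>) (discrete_topology (tuples k)) (deg \<Lambda>)"
    and unique_factorisation: "unique_factorisation k \<Lambda>"
  using topological_k_graph by (simp_all add: topological_k_graph_def)

lemma composable_iff:
  "(f, g) \<in> composable \<Lambda> \<longleftrightarrow> f \<in> mors \<Lambda> \<and> g \<in> mors \<Lambda> \<and> src \<Lambda> f = rng \<Lambda> g"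
  by (simp add: composable_def)

lemma rng_obj [simp]: "f \<in> mors \<Lambda> \<Longrightarrow> rng \<Lambda> f \<in> objs \<Lambda>"
  and src_obj [simp]: "f \<in> mors \<Lambda> \<Longrightarrow> src \<Lambda> f \<in> objs \<Lambda>"
  and idt_mor [simp]: "v \<in> objs \<Lambda> \<Longrightarrow> idt \<Lambda> v \<in> mors \<Lambda>"
  and rng_idt [simp]: "v \<in> objs \<Lambda> \<Longrightarrow> rng \<Lambda> (idt \<Lambda> v) = v"
  and src_idt [simp]: "v \<in> objs \<Lambda> \<Longrightarrow> src \<Lambda> (idt \<Lambda> v) = v"
  and idt_cmp [simp]: "f \<in> mors \<Lambda> \<Longrightarrow> idt \<Lambda> (rng \<Lambda> f) \<cdot> f = f"
  and cmp_idt [simp]: "f \<in> mors \<Lambda> \<Longrightarrow> f \<cdot> idt \<Lambda> (src \<Lambda> f) = f"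
  using cat by (auto simp: small_category_def)

lemma cmp_mor [simp]: "(f, g) \<in> composable \<Lambda> \<Longrightarrow> f \<cdot> g \<in> mors \<Lambda>"
  and rng_cmp [simp]: "(f, g) \<in> composable \<Lambda> \<Longrightarrow> rng \<Lambda> (f \<cdot> g) = rng \<Lambda> f"
  and src_cmp [simp]: "(f, g) \<in> composable \<Lambda> \<Longrightarrow> src \<Lambda> (f \<cdot> g) = src \<Lambda> g"
  using cat by (auto simp: small_category_def)

lemma cmp_assoc:
  "(f, g) \<in> composable \<Lambda> \<Longrightarrow> (g, h) \<in> composable \<Lambda> \<Longrightarrow> f \<cdot> g \<cdot> h = f \<cdot> (g \<cdot> h)"
  using cat unfolding small_category_def by blast

lemma deg_tuples [simp]: "f \<in> mors \<Lambda> \<Longrightarrow> deg \<Lambda> f \<in> tuples k"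
  and deg_idt [simp]: "v \<in> objs \<Lambda> \<Longrightarrow> deg \<Lambda> (idt \<Lambda> v) = 0"
  and deg_cmp [simp]: "(f, g) \<in> composable \<Lambda> \<Longrightarrow> deg \<Lambda> (f \<cdot> g) = deg \<Lambda> f + deg \<Lambda> g"
  using degf by (auto simp: degree_functor_def)

text \<open>For \<open>m \<le> d(f)\<close> these are the factors in \<open>f = head f m \<cdot> tail f m\<close>, where \<open>head f m\<close> has degree \<open>m\<close>.\<close>

definition split :: "'a \<Rightarrow> (nat \<Rightarrow> nat) \<Rightarrow> 'a \<times> 'a" where
  "split f m = (THE p. p \<in> composable \<Lambda> \<and> f = fst p \<cdot> snd p \<and> deg \<Lambda> (fst p) = m)"

definition "head f m = fst (split f m)"
definition "tail f m = snd (split f m)"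

text \<open>Only the degrees of the first factors have to be compared: cancellation determines the
  degree of the second factor, and then \<open>unique_factorisation\<close> applies.\<close>

lemma split_unique:
  assumes "p \<in> composable \<Lambda>" "q \<in> composable \<Lambda>" "fst p \<cdot> snd p = fst q \<cdot> snd q"
    "deg \<Lambda> (fst p) = deg \<Lambda> (fst q)"
  shows "p = q"
proof -
  obtain f g where p: "p = (f, g)" "(f, g) \<in> composable \<Lambda>" using assms(1) by (cases p) auto
  obtain f' g' where q: "q = (f', g')" "(f', g') \<in> composable \<Lambda>" using assms(2) by (cases q) auto
  have eq: "f \<cdot> g = f' \<cdot> g'" "deg \<Lambda> f = deg \<Lambda> f'" using assms p q by auto
  have "deg \<Lambda> f + deg \<Lambda> g = deg \<Lambda> f' + deg \<Lambda> g'"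
    using deg_cmp[OF p(2)] deg_cmp[OF q(2)] eq by simp
  then have "deg \<Lambda> g = deg \<Lambda> g'" using eq by simp
  moreover have "\<exists>!p. p \<in> composable \<Lambda> \<and> f \<cdot> g = fst p \<cdot> snd p \<and> deg \<Lambda> (fst p) = deg \<Lambda> f
      \<and> deg \<Lambda> (snd p) = deg \<Lambda> g"
    using unique_factorisation[unfolded unique_factorisation_def, rule_format, of "f \<cdot> g" "deg \<Lambda> f" "deg \<Lambda> g"]
      p(2) by (simp add: composable_iff[of f g])
  ultimately have "(f, g) = (f', g')"
    using p(2) q(2) eq unfolding fst_conv snd_conv by (elim ex1E) (metis fst_conv snd_conv)
  then show ?thesis using p q by simp
qed

lemma split_cmp:
  assumes "(f, g) \<in> composable \<Lambda>"
  shows "split (f \<cdot> g) (deg \<Lambda> f) = (f, g)"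
  unfolding split_def by (rule the_equality) (use assms split_unique in auto)

lemma head_cmp [simp]: "(f, g) \<in> composable \<Lambda> \<Longrightarrow> head (f \<cdot> g) (deg \<Lambda> f) = f"
  and tail_cmp [simp]: "(f, g) \<in> composable \<Lambda> \<Longrightarrow> tail (f \<cdot> g) (deg \<Lambda> f) = g"
  by (simp_all add: head_def tail_def split_cmp)

lemma factors:
  assumes "f \<in> mors \<Lambda>" "m \<in> tuples k" "m \<le> deg \<Lambda> f"
  obtains g h where "(g, h) \<in> composable \<Lambda>" "f = g \<cdot> h" "deg \<Lambda> g = m"
proof -
  have "deg \<Lambda> f = m + (deg \<Lambda> f - m)" using assms by (simp add: tuple_add_diff)
  then have "\<exists>p. p \<in> composable \<Lambda> \<and> f = fst p \<cdot> snd p \<and> deg \<Lambda> (fst p) = m"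
    using unique_factorisation assms unfolding unique_factorisation_def
    by (metis deg_tuples diff_tuples)
  then show ?thesis using that by auto
qed

lemma
  assumes "f \<in> mors \<Lambda>" "m \<in> tuples k" "m \<le> deg \<Lambda> f"
  shows head_tail_composable: "(head f m, tail f m) \<in> composable \<Lambda>"
    and head_cmp_tail: "head f m \<cdot> tail f m = f"
    and deg_head: "deg \<Lambda> (head f m) = m"
  by (rule factors[OF assms]; auto)+

lemma
  assumes "f \<in> mors \<Lambda>" "m \<in> tuples k" "m \<le> deg \<Lambda> f"
  shows head_mor: "head f m \<in> mors \<Lambda>" and tail_mor: "tail f m \<in> mors \<Lambda>"
    and src_head: "src \<Lambda> (head f m) = rng \<Lambda> (tail f m)"
    and src_tail: "src \<Lambda> (tail f m) = src \<Lambda> f"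
    and deg_tail: "deg \<Lambda> (tail f m) = deg \<Lambda> f - m"
  by (rule factors[OF assms]; auto simp: composable_iff)+

text \<open>Write \<open>f = g \<cdot> h\<close> with \<open>g\<close> of degree \<open>m\<close>,
  and \<open>g = a \<cdot> b\<close> with \<open>a\<close> of degree \<open>n\<close>. By
  associativity \<open>f = a \<cdot> (b \<cdot> h)\<close>, which by uniqueness is the factorisation
  of \<open>f\<close> at \<open>n\<close>.\<close>

lemma
  assumes "f \<in> mors \<Lambda>" "m \<in> tuples k" "m \<le> deg \<Lambda> f" "n \<in> tuples k" "n \<le> m"
  shows head_head: "head (head f m) n = head f n"
    and tail_head_cmp_tail: "tail (head f m) n \<cdot> tail f m = tail f n"
proof -
  obtain g h where gh: "(g, h) \<in> composable \<Lambda>" "f = g \<cdot> h" "deg \<Lambda> g = m"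
    using factors assms by metis
  then have g: "g \<in> mors \<Lambda>" by (simp add: composable_iff)
  then obtain a b where ab: "(a, b) \<in> composable \<Lambda>" "g = a \<cdot> b" "deg \<Lambda> a = n"
    using factors[of g n] assms gh by metis
  have [simp]: "(b, h) \<in> composable \<Lambda>" using gh ab by (auto simp: composable_iff)
  then have [simp]: "(a, b \<cdot> h) \<in> composable \<Lambda>" using ab by (auto simp: composable_iff)
  have f: "f = a \<cdot> (b \<cdot> h)" using gh ab cmp_assoc by simp
  have *: "head f m = g" "tail f m = h" "head g n = a" "tail g n = b" "head f n = a" "tail f n = b \<cdot> h"
    using head_cmp[OF gh(1)] tail_cmp[OF gh(1)] head_cmp[OF ab(1)] tail_cmp[OF ab(1)]
      head_cmp[OF \<open>(a, b \<cdot> h) \<in> composable \<Lambda>\<close>] tail_cmp[OF \<open>(a, b \<cdot> h) \<in> composable \<Lambda>\<close>]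
    unfolding gh(2)[symmetric] ab(2)[symmetric] f[symmetric] unfolding gh(3) ab(3) by simp_all
  show "head (head f m) n = head f n" "tail (head f m) n \<cdot> tail f m = tail f n"
    by (simp_all add: *)
qed

text \<open>Multiplying \<open>f\<close> by an identity on the left or on the right gives two
  factorisations whose first factor has degree \<open>0\<close>, so they coincide.\<close>

lemma deg_zero_idt:
  assumes "f \<in> mors \<Lambda>" "deg \<Lambda> f = 0" shows "f = idt \<Lambda> (src \<Lambda> f)"
proof -
  have "(idt \<Lambda> (rng \<Lambda> f), f) = (f, idt \<Lambda> (src \<Lambda> f))"
    by (rule split_unique) (use assms in \<open>auto simp: composable_iff\<close>)
  then show ?thesis by (rule prod.inject[THEN iffD1, THEN conjunct2])
qed

lemma composable_deg_zero:
  assumes "(f, g) \<in> composable \<Lambda>" "deg \<Lambda> g = 0" shows "g = idt \<Lambda> (src \<Lambda> f)"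
proof -
  have g: "g \<in> mors \<Lambda>" "src \<Lambda> f = rng \<Lambda> g" using assms(1) by (auto simp: composable_iff)
  have "rng \<Lambda> g = rng \<Lambda> (idt \<Lambda> (src \<Lambda> g))" using deg_zero_idt[OF g(1) assms(2)] by (rule arg_cong)
  then have "src \<Lambda> f = src \<Lambda> g" using g by simp
  then show ?thesis using deg_zero_idt[OF g(1) assms(2)] by (simp only:)
qed

lemma tail_deg:
  assumes "f \<in> mors \<Lambda>" shows "tail f (deg \<Lambda> f) = idt \<Lambda> (src \<Lambda> f)"
  using tail_cmp[of f "idt \<Lambda> (src \<Lambda> f)"] assms by (simp add: composable_iff)

lemma head_deg:
  assumes "f \<in> mors \<Lambda>" shows "head f (deg \<Lambda> f) = f"
  using head_cmp[of f "idt \<Lambda> (src \<Lambda> f)"] assms by (simp add: composable_iff)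

lemma head_zero:
  assumes "f \<in> mors \<Lambda>" shows "head f 0 = idt \<Lambda> (rng \<Lambda> f)"
  using head_cmp[of "idt \<Lambda> (rng \<Lambda> f)" f] assms by (simp add: composable_iff)

end

section \<open>Paths\<close>

context topological_kgraph
begin

abbreviation X :: "('o, 'a) kpath set" where "X \<equiv> path_space k \<Lambda>"

text \<open>These \<open>m\<close> are the objects of \<open>Omega k M\<close>; for
  \<open>M = pdeg x\<close> they are the degrees of the initial segments of
  \<open>x\<close>.\<close>

definition below :: "(nat \<Rightarrow> nat) \<Rightarrow> (nat \<Rightarrow> enat) \<Rightarrow> bool" where
  "below m M \<longleftrightarrow> m \<in> tuples k \<and> enat \<circ> m \<le> M"

text \<open>Unique factorisation recovers a path from its initial segments, as
  \<open>path_eqI\<close> shows, so most later arguments are phrased in terms of them.\<close>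

definition init :: "('o, 'a) kpath \<Rightarrow> (nat \<Rightarrow> nat) \<Rightarrow> 'a" where
  "init x m = pmor x (0, m)"

lemma below_tuples [simp]: "below m M \<Longrightarrow> m \<in> tuples k"
  by (simp add: below_def)

lemma below_zero [simp]: "below 0 M"
  by (simp add: below_def le_fun_def zero_enat_def[symmetric])

lemma below_mono: "below m M \<Longrightarrow> n \<in> tuples k \<Longrightarrow> n \<le> m \<Longrightarrow> below n M"
  unfolding below_def le_fun_def by (metis comp_apply enat_ord_simps(1) order_trans)

lemma below_sup: "below m M \<Longrightarrow> below n M \<Longrightarrow> below (sup m n) M"
  by (auto simp: below_def le_fun_def sup_max max_def)

text \<open>In a coordinate where \<open>M\<close> is infinite both sides hold; where it is finite,
  \<open>below m M\<close> prevents the subtraction from being truncated.\<close>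

lemma below_diff_iff:
  assumes "below m M" "n \<in> tuples k"
  shows "below n (M - (enat \<circ> m)) \<longleftrightarrow> below (m + n) M"
proof -
  have "enat (n i) \<le> M i - enat (m i) \<longleftrightarrow> enat (m i + n i) \<le> M i" for i
    using assms(1) by (cases "M i") (auto simp: below_def le_fun_def elim!: allE[of _ i])
  then show ?thesis using assms by (auto simp: below_def le_fun_def)
qed

lemma below_add_iff:
  assumes "m \<in> tuples k" "n \<in> tuples k"
  shows "below (m + n) ((enat \<circ> m) + M) \<longleftrightarrow> below n M"
proof -
  have "enat (m i + n i) \<le> enat (m i) + M i \<longleftrightarrow> enat (n i) \<le> M i" for i
    by (cases "M i") auto
  then show ?thesis using assms by (auto simp: below_def le_fun_def)
qed

lemma objs_Omega: "objs (Omega k M) = {m. below m M}"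
  by (simp add: Omega_def below_def)

lemma mors_Omega: "mors (Omega k M) = {(p, q). p \<in> tuples k \<and> below q M \<and> p \<le> q}"
  by (auto simp: Omega_def below_def)

text \<open>The spaces of \<open>Omega k M\<close> are discrete, so continuity only says that the
  values are objects or morphisms of \<Lambda>. A composable pair in \<open>Omega k M\<close> is a
  chain \<open>p \<le> q \<le> s\<close>.\<close>

lemma kgraph_morphism_Omega_iff:
  "kgraph_morphism (Omega k M) \<Lambda> F0 F1 \<longleftrightarrow>
     (\<forall>p. below p M \<longrightarrow> F0 p \<in> objs \<Lambda> \<and> F1 (p, p) = idt \<Lambda> (F0 p)) \<and>
     (\<forall>p q. p \<in> tuples k \<longrightarrow> below q M \<longrightarrow> p \<le> q \<longrightarrow> F1 (p, q) \<in> mors \<Lambda> \<and>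
        rng \<Lambda> (F1 (p, q)) = F0 p \<and> src \<Lambda> (F1 (p, q)) = F0 q \<and> deg \<Lambda> (F1 (p, q)) = q - p) \<and>
     (\<forall>p q s. p \<in> tuples k \<longrightarrow> q \<in> tuples k \<longrightarrow> below s M \<longrightarrow> p \<le> q \<longrightarrow> q \<le> s \<longrightarrow>
        F1 (p, s) = F1 (p, q) \<cdot> F1 (q, s))" (is "?L \<longleftrightarrow> ?R")
proof -
  have O: "obj_top (Omega k M) = discrete_topology {p. below p M}"
    "mor_top (Omega k M) = discrete_topology {(p, q). p \<in> tuples k \<and> below q M \<and> p \<le> q}"
    "rng (Omega k M) = fst" "src (Omega k M) = snd" "idt (Omega k M) = (\<lambda>p. (p, p))"
    "cmp (Omega k M) = (\<lambda>f g. (fst f, snd g))" "deg (Omega k M) = (\<lambda>(p, q). q - p)"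
    by (auto simp: Omega_def below_def intro!: arg_cong[where f = discrete_topology])
  have w: "below q M" if "below s M" "q \<le> s" "q \<in> tuples k" for q s
    using that below_mono by blast
  show ?thesis
  proof
    assume L: ?L
    then have "F0 p \<in> objs \<Lambda> \<and> F1 (p, p) = idt \<Lambda> (F0 p)" if "below p M" for p
      using that unfolding kgraph_morphism_def O by auto
    moreover have "F1 (p, q) \<in> mors \<Lambda> \<and> rng \<Lambda> (F1 (p, q)) = F0 p \<and> src \<Lambda> (F1 (p, q)) = F0 q
        \<and> deg \<Lambda> (F1 (p, q)) = q - p" if "p \<in> tuples k" "below q M" "p \<le> q" for p q
    proof -
      have "(p, q) \<in> topspace (discrete_topology {(p, q). p \<in> tuples k \<and> below q M \<and> p \<le> q})"
        using that by simp
      then show ?thesis using L unfolding kgraph_morphism_def O continuous_map_def by fastforce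
    qed
    moreover have "F1 (p, s) = F1 (p, q) \<cdot> F1 (q, s)"
      if "p \<in> tuples k" "q \<in> tuples k" "below s M" "p \<le> q" "q \<le> s" for p q s
    proof -
      have "((p, q), (q, s)) \<in> composable (Omega k M)"
        using that w[OF that(3,5,2)] by (simp add: composable_def O)
      then show ?thesis using L unfolding kgraph_morphism_def O by fastforce
    qed
    ultimately show ?R by blast
  next
    assume R: ?R
    show ?L
      unfolding kgraph_morphism_def O
    proof (intro conjI ballI)
      show "case x of (f, g) \<Rightarrow> F1 (fst f, snd g) = F1 f \<cdot> F1 g" if "x \<in> composable (Omega k M)" for x
      proof -
        obtain p q s where "x = ((p, q), (q, s))" "p \<in> tuples k" "p \<le> q" "q \<in> tuples k" "below s M" "q \<le> s"
          using \<open>x \<in> _\<close> by (cases x) (auto simp: composable_def O)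
        then show ?thesis using R[THEN conjunct2, THEN conjunct2, rule_format, of p q s] by simp
      qed
    qed (use R[THEN conjunct1] R[THEN conjunct2, THEN conjunct1] w in \<open>auto 0 3\<close>)
  qed
qed

lemma path_iff:
  "x \<in> X \<longleftrightarrow> pdeg x \<in> tuples k \<and> kgraph_morphism (Omega k (pdeg x)) \<Lambda> (pobj x) (pmor x) \<and>
     pobj x \<in> extensional {m. below m (pdeg x)} \<and>
     pmor x \<in> extensional {(p, q). p \<in> tuples k \<and> below q (pdeg x) \<and> p \<le> q}"
  by (simp add: path_space_def objs_Omega mors_Omega)

lemma
  assumes "x \<in> X"
  shows pdeg_tuples: "pdeg x \<in> tuples k"
    and pobj_obj: "below p (pdeg x) \<Longrightarrow> pobj x p \<in> objs \<Lambda>"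
    and pmor_idt: "below p (pdeg x) \<Longrightarrow> pmor x (p, p) = idt \<Lambda> (pobj x p)"
    and pmor_mor: "p \<in> tuples k \<Longrightarrow> below q (pdeg x) \<Longrightarrow> p \<le> q \<Longrightarrow> pmor x (p, q) \<in> mors \<Lambda>"
    and rng_pmor: "p \<in> tuples k \<Longrightarrow> below q (pdeg x) \<Longrightarrow> p \<le> q \<Longrightarrow> rng \<Lambda> (pmor x (p, q)) = pobj x p"
    and src_pmor: "p \<in> tuples k \<Longrightarrow> below q (pdeg x) \<Longrightarrow> p \<le> q \<Longrightarrow> src \<Lambda> (pmor x (p, q)) = pobj x q"
    and deg_pmor: "p \<in> tuples k \<Longrightarrow> below q (pdeg x) \<Longrightarrow> p \<le> q \<Longrightarrow> deg \<Lambda> (pmor x (p, q)) = q - p"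
    and pmor_cmp: "p \<in> tuples k \<Longrightarrow> q \<in> tuples k \<Longrightarrow> below s (pdeg x) \<Longrightarrow> p \<le> q \<Longrightarrow> q \<le> s \<Longrightarrow>
       pmor x (p, q) \<cdot> pmor x (q, s) = pmor x (p, s)"
proof -
  have "kgraph_morphism (Omega k (pdeg x)) \<Lambda> (pobj x) (pmor x)" "pdeg x \<in> tuples k"
    using assms by (auto simp: path_iff)
  note M = this(1)[unfolded kgraph_morphism_Omega_iff] and this(2)
  show "pdeg x \<in> tuples k" by fact
  show "below p (pdeg x) \<Longrightarrow> pobj x p \<in> objs \<Lambda>"
    and "below p (pdeg x) \<Longrightarrow> pmor x (p, p) = idt \<Lambda> (pobj x p)"
    using M[THEN conjunct1] by blast+
  show "pmor x (p, q) \<in> mors \<Lambda>" "rng \<Lambda> (pmor x (p, q)) = pobj x p"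
    "src \<Lambda> (pmor x (p, q)) = pobj x q" "deg \<Lambda> (pmor x (p, q)) = q - p"
    if "p \<in> tuples k" "below q (pdeg x)" "p \<le> q"
    using M[THEN conjunct2, THEN conjunct1] that by blast+
  show "pmor x (p, q) \<cdot> pmor x (q, s) = pmor x (p, s)"
    if "p \<in> tuples k" "q \<in> tuples k" "below s (pdeg x)" "p \<le> q" "q \<le> s"
    using M[THEN conjunct2, THEN conjunct2, rule_format, OF that] by (rule sym)
qed

lemma
  assumes "x \<in> X" "below m (pdeg x)"
  shows init_mor: "init x m \<in> mors \<Lambda>" and rng_init: "rng \<Lambda> (init x m) = pobj x 0"
    and src_init: "src \<Lambda> (init x m) = pobj x m" and deg_init: "deg \<Lambda> (init x m) = m"
  unfolding init_def using assms
  by (auto simp: pmor_mor rng_pmor src_pmor deg_pmor fun_eq_iff)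

lemma
  assumes "x \<in> X" "below m (pdeg x)" "n \<in> tuples k" "n \<le> m"
  shows head_init: "head (init x m) n = init x n" and tail_init: "tail (init x m) n = pmor x (n, m)"
proof -
  have n: "below n (pdeg x)" using assms below_mono by blast
  have c: "(init x n, pmor x (n, m)) \<in> composable \<Lambda>"
    using assms n by (simp add: composable_iff init_mor src_init pmor_mor rng_pmor)
  have "init x m = init x n \<cdot> pmor x (n, m)"
    using assms n by (simp add: init_def pmor_cmp)
  then show "head (init x m) n = init x n" "tail (init x m) n = pmor x (n, m)"
    using head_cmp[OF c] tail_cmp[OF c] deg_init[OF assms(1) n] by simp_all
qed

text \<open>By \<open>tail_init\<close> the morphism at \<open>(p, q)\<close> is a tail of the
  initial segment of degree \<open>q\<close>, and objects are sources of initial segments. Outside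
  their domains both maps are fixed by extensionality.\<close>

lemma path_eqI:
  assumes "x \<in> X" "y \<in> X" "pdeg x = pdeg y" "\<And>m. below m (pdeg x) \<Longrightarrow> init x m = init y m"
  shows "x = y"
proof -
  have "pobj x = pobj y"
  proof (rule extensionalityI[of _ "{m. below m (pdeg x)}"])
    show "pobj x p = pobj y p" if "p \<in> {m. below m (pdeg x)}" for p
      using that assms src_init by (metis mem_Collect_eq)
  qed (use assms in \<open>auto simp: path_iff\<close>)
  moreover have "pmor x = pmor y"
  proof (rule extensionalityI[of _ "{(p, q). p \<in> tuples k \<and> below q (pdeg x) \<and> p \<le> q}"])
    fix f assume "f \<in> {(p, q). p \<in> tuples k \<and> below q (pdeg x) \<and> p \<le> q}"
    then obtain p q where "f = (p, q)" "p \<in> tuples k" "below q (pdeg x)" "p \<le> q" by auto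
    then show "pmor x f = pmor y f" using assms tail_init by metis
  qed (use assms in \<open>auto simp: path_iff\<close>)
  ultimately show ?thesis using assms(3) by simp
qed

text \<open>The morphism at \<open>(p, q)\<close> has to be \<open>tail (h q) p\<close>; coherence
  makes its range the source of \<open>h p\<close>, and functoriality is then
  \<open>tail_head_cmp_tail\<close>.\<close>

lemma path_of_initial_segments:
  assumes M: "M \<in> tuples k"
    and h: "\<And>m. below m M \<Longrightarrow> h m \<in> mors \<Lambda> \<and> deg \<Lambda> (h m) = m"
    and coh: "\<And>m n. below m M \<Longrightarrow> n \<in> tuples k \<Longrightarrow> n \<le> m \<Longrightarrow> head (h m) n = h n"
  shows "\<exists>x\<in>X. pdeg x = M \<and> (\<forall>m. below m M \<longrightarrow> init x m = h m)"
proof -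
  define x where "x = \<lparr>pdeg = M, pobj = restrict (\<lambda>p. src \<Lambda> (h p)) {m. below m M},
    pmor = restrict (\<lambda>(p, q). tail (h q) p) {(p, q). p \<in> tuples k \<and> below q M \<and> p \<le> q}\<rparr>"
  have t: "tail (h q) p \<in> mors \<Lambda>" "rng \<Lambda> (tail (h q) p) = src \<Lambda> (h p)"
      "src \<Lambda> (tail (h q) p) = src \<Lambda> (h q)" "deg \<Lambda> (tail (h q) p) = q - p"
    if "p \<in> tuples k" "below q M" "p \<le> q" for p q
    using that h[OF that(2)] coh[OF that(2,1,3)] tail_mor[of "h q" p] src_head[of "h q" p]
      src_tail[of "h q" p] deg_tail[of "h q" p] by auto
  have c: "tail (h s) p = tail (h q) p \<cdot> tail (h s) q"
    if "p \<in> tuples k" "q \<in> tuples k" "below s M" "p \<le> q" "q \<le> s" for p q s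
    using tail_head_cmp_tail[of "h s" q p] that coh[OF that(3,2,5)] h[OF that(3)] by simp
  have i: "tail (h p) p = idt \<Lambda> (src \<Lambda> (h p))" if "below p M" for p
    using tail_deg[of "h p"] h[OF that] by simp
  have w: "below q M" if "below s M" "q \<le> s" "q \<in> tuples k" for q s
    using that below_mono by blast
  have "kgraph_morphism (Omega k M) \<Lambda> (pobj x) (pmor x)"
    unfolding kgraph_morphism_Omega_iff
  proof (intro conjI allI impI)
    show "pmor x (p, s) = pmor x (p, q) \<cdot> pmor x (q, s)"
      if "p \<in> tuples k" "q \<in> tuples k" "below s M" "p \<le> q" "q \<le> s" for p q s
      using that w[OF that(3,5,2)] c[OF that] by (simp add: x_def order_trans[OF that(4,5)])
  qed (use t h i w in \<open>auto simp: x_def\<close>)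
  then have "x \<in> X" using M unfolding path_iff by (simp add: x_def)
  moreover have "init x m = h m" if m: "below m M" for m
  proof -
    have "head (h m) 0 = idt \<Lambda> (rng \<Lambda> (h m))" using head_zero h[OF m] by blast
    then have "tail (h m) 0 = h m"
      using head_cmp_tail[of "h m" 0] h[OF m] src_head[of "h m" 0] tail_mor[of "h m" 0]
      by (metis idt_cmp rng_obj src_idt tuple_zero_le zero_tuples)
    then show ?thesis using m by (simp add: init_def x_def)
  qed
  ultimately show ?thesis by (intro bexI[of _ x]) (auto simp: x_def)
qed

section \<open>Shifts of paths\<close>

lemma
  assumes "x \<in> X" "below m (pdeg x)"
  shows pdeg_shift: "pdeg (shift k m x) = pdeg x - (enat \<circ> m)"
    and shift_path: "shift k m x \<in> X"
    and init_shift: "below (m + n) (pdeg x) \<Longrightarrow> n \<in> tuples k \<Longrightarrow> init (shift k m x) n = pmor x (m, m + n)"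
    and pobj_shift: "below (m + n) (pdeg x) \<Longrightarrow> n \<in> tuples k \<Longrightarrow> pobj (shift k m x) n = pobj x (m + n)"
    and below_shift: "n \<in> tuples k \<Longrightarrow> below n (pdeg (shift k m x)) \<longleftrightarrow> below (m + n) (pdeg x)"
    and pmor_shift: "below (m + n) (pdeg x) \<Longrightarrow> n \<in> tuples k \<Longrightarrow> p \<in> tuples k \<Longrightarrow> p \<le> n \<Longrightarrow>
      pmor (shift k m x) (p, n) = pmor x (m + p, m + n)"
proof -
  let ?M = "pdeg x - (enat \<circ> m)"
  have m: "m \<in> tuples k" using assms by simp
  have s: "shift k m x = \<lparr>pdeg = ?M, pobj = restrict (\<lambda>p. pobj x (m + p)) {p. below p ?M},
     pmor = restrict (\<lambda>(p, q). pmor x (m + p, m + q)) {(p, q). p \<in> tuples k \<and> below q ?M \<and> p \<le> q}\<rparr>"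
    by (simp add: shift_def Let_def objs_Omega mors_Omega)
  show "pdeg (shift k m x) = ?M" by (simp add: s)
  show w: "below n (pdeg (shift k m x)) \<longleftrightarrow> below (m + n) (pdeg x)" if "n \<in> tuples k" for n
    using below_diff_iff assms that by (simp add: s)
  have w': "below (m + n) (pdeg x)" if "below n ?M" for n
    using below_diff_iff[OF assms(2) below_tuples[OF that]] that by simp
  have w2: "below q ?M" if "below s ?M" "q \<le> s" "q \<in> tuples k" for q s
    using that below_mono by blast
  have "kgraph_morphism (Omega k ?M) \<Lambda> (pobj (shift k m x)) (pmor (shift k m x))"
    unfolding kgraph_morphism_Omega_iff
  proof (intro conjI allI impI)
    show "pmor (shift k m x) (p, q') = pmor (shift k m x) (p, q) \<cdot> pmor (shift k m x) (q, q')"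
      if "p \<in> tuples k" "q \<in> tuples k" "below q' ?M" "p \<le> q" "q \<le> q'" for p q q'
      using that w2[OF that(3,5,2)] w'[OF that(3)] m assms(1)
      by (simp add: s order_trans[OF that(4,5)] pmor_cmp)
    show "deg \<Lambda> (pmor (shift k m x) (p, q)) = q - p" if "p \<in> tuples k" "below q ?M" "p \<le> q" for p q
      using that w'[OF that(2)] m assms(1) by (simp add: s deg_pmor)
  qed (use assms m w' w2 in \<open>auto simp: s pobj_obj pmor_idt pmor_mor rng_pmor src_pmor\<close>)
  moreover have "?M \<in> tuples k" using pdeg_tuples[OF assms(1)] by (simp add: tuples_def)
  ultimately show "shift k m x \<in> X"
    unfolding path_iff by (simp add: s)
  show "init (shift k m x) n = pmor x (m, m + n)" if "below (m + n) (pdeg x)" "n \<in> tuples k"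
    using w that by (simp add: s init_def)
  show "pobj (shift k m x) n = pobj x (m + n)" if "below (m + n) (pdeg x)" "n \<in> tuples k"
    using w that by (simp add: s)
  show "pmor (shift k m x) (p, n) = pmor x (m + p, m + n)"
    if "below (m + n) (pdeg x)" "n \<in> tuples k" "p \<in> tuples k" "p \<le> n"
    using w that by (simp add: s)
qed

lemma init_shift_tail:
  assumes "x \<in> X" "below (m + n) (pdeg x)" "m \<in> tuples k" "n \<in> tuples k"
  shows "init (shift k m x) n = tail (init x (m + n)) m"
proof -
  have "below m (pdeg x)" using below_mono[OF assms(2,3)] by simp
  then show ?thesis using assms by (simp add: init_shift tail_init)
qed

lemma shift_shift:
  assumes "x \<in> X" "below (m + n) (pdeg x)" "m \<in> tuples k" "n \<in> tuples k"
  shows "shift k n (shift k m x) = shift k (m + n) x"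
proof (rule path_eqI)
  have m: "below m (pdeg x)" using below_mono[OF assms(2,3)] by simp
  have sm: "shift k m x \<in> X" and n: "below n (pdeg (shift k m x))"
    using assms m by (auto simp: shift_path below_shift)
  show "shift k n (shift k m x) \<in> X" "shift k (m + n) x \<in> X"
    using assms sm n shift_path by auto
  have "a - enat (i) - enat j = a - (enat (i + j))" for a i j
    by (cases a) auto
  then show "pdeg (shift k n (shift k m x)) = pdeg (shift k (m + n) x)"
    using assms m sm n by (auto simp: pdeg_shift fun_eq_iff)
  fix p assume "below p (pdeg (shift k n (shift k m x)))"
  then have p: "p \<in> tuples k" "below (n + p) (pdeg (shift k m x))"
    using below_shift[OF sm n] below_tuples by blast+
  then have p': "below (m + (n + p)) (pdeg x)" using below_shift[OF assms(1) m] assms by auto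
  then show "init (shift k n (shift k m x)) p = init (shift k (m + n) x) p"
    using assms p m sm n by (simp add: init_shift pmor_shift add.assoc)
qed

section \<open>Prepending a morphism to a path\<close>

lemma prepend_unique:
  assumes "y \<in> X" "y' \<in> X" "l \<in> mors \<Lambda>" "pdeg y = pdeg y'" "below (deg \<Lambda> l) (pdeg y)"
    "init y (deg \<Lambda> l) = l" "init y' (deg \<Lambda> l) = l" "shift k (deg \<Lambda> l) y = shift k (deg \<Lambda> l) y'"
  shows "y = y'"
proof (rule path_eqI)
  fix m assume m: "below m (pdeg y)"
  \<comment> \<open>As \<open>m\<close> need not dominate \<open>?d\<close>, the paths are compared
    at the supremum of the two, where the segment is \<open>l\<close> times a segment of the shift,
    and the result is cut back to \<open>m\<close>.\<close>
  let ?d = "deg \<Lambda> l" let ?n = "sup m ?d - ?d"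
  have n: "below (?d + ?n) (pdeg y)" "?d + ?n = sup m ?d"
    using below_sup[OF m assms(5)] by (auto simp: tuple_add_diff)
  have t: "?n \<in> tuples k" using m assms by simp
  have "init z (sup m ?d) = l \<cdot> init (shift k ?d z) ?n"
    if "z \<in> X" "pdeg z = pdeg y" "init z ?d = l" for z
  proof -
    have "init z ?d \<cdot> tail (init z (sup m ?d)) ?d = init z (sup m ?d)"
      using head_cmp_tail[of "init z (sup m ?d)" ?d] head_init[of z "sup m ?d" ?d]
        that assms m below_sup[OF m assms(5)] init_mor[of z] deg_init[of z] by simp
    then show ?thesis
      using init_shift_tail[of z ?d ?n] that n t assms by simp
  qed
  then have "init y (sup m ?d) = init y' (sup m ?d)" using assms by simp
  then show "init y m = init y' m"
    using head_init[of y "sup m ?d" m] head_init[of y' "sup m ?d" m] n assms m by simp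
qed (use assms in auto)

lemma prepend_ex:
  assumes x: "x \<in> X" and l: "l \<in> mors \<Lambda>" and sr: "src \<Lambda> l = pobj x 0"
  shows "\<exists>y\<in>X. pdeg y = (enat \<circ> deg \<Lambda> l) + pdeg x \<and> init y (deg \<Lambda> l) = l \<and> shift k (deg \<Lambda> l) y = x"
proof -
  let ?d = "deg \<Lambda> l" and ?M = "(enat \<circ> deg \<Lambda> l) + pdeg x"
  have d: "?d \<in> tuples k" using l by simp
  have comp: "(l, init x n) \<in> composable \<Lambda>" if "below n (pdeg x)" for n
    using that x l sr by (simp add: composable_iff init_mor rng_init)
  \<comment> \<open>A segment whose degree does not dominate \<open>?d\<close> is not a product with
    first factor \<open>l\<close>. Hence the product is formed at degree \<open>sup m ?d\<close> and
    then cut down to \<open>m\<close>.\<close>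
  define h where "h m = head (l \<cdot> init x (sup m ?d - ?d)) m" for m
  have wM: "below (sup m ?d - ?d) (pdeg x)" if "below m ?M" for m
  proof -
    have "below (sup m ?d) ?M"
      using that below_sup below_add_iff[of ?d 0 "pdeg x"] d by simp
    moreover have "sup m ?d = ?d + (sup m ?d - ?d)" by (simp add: tuple_add_diff)
    ultimately show ?thesis using below_add_iff[of ?d "sup m ?d - ?d" "pdeg x"] d that
      by (metis diff_tuples sup_tuples below_tuples)
  qed
  have dl: "deg \<Lambda> (l \<cdot> init x (sup m ?d - ?d)) = sup m ?d" if "below m ?M" for m
    using comp[OF wM[OF that]] wM[OF that] x by (simp add: deg_init tuple_add_diff)
  have ml: "l \<cdot> init x (sup m ?d - ?d) \<in> mors \<Lambda>" if "below m ?M" for m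
    using comp[OF wM[OF that]] by simp
  \<comment> \<open>Coherence of the products before they are cut down; the rest of coherence is
    \<open>head_head\<close>.\<close>
  have hh: "head (l \<cdot> init x (sup m ?d - ?d)) (sup n ?d) = l \<cdot> init x (sup n ?d - ?d)"
    if m: "below m ?M" and n: "n \<in> tuples k" "n \<le> m" for m n
  proof -
    have n': "below n ?M" using below_mono m n by blast
    let ?a = "sup m ?d - ?d" and ?b = "sup n ?d - ?d"
    have wa: "below ?a (pdeg x)" "below ?b (pdeg x)" using wM m n' by auto
    have ab: "?b \<le> ?a" using n by (auto simp: le_fun_def sup_max intro!: diff_le_mono max.mono)
    have ia: "init x ?a = init x ?b \<cdot> tail (init x ?a) ?b" "(init x ?b, tail (init x ?a) ?b) \<in> composable \<Lambda>"
      using head_cmp_tail[of "init x ?a" ?b] head_tail_composable[of "init x ?a" ?b]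
        head_init[OF x wa(1) _ ab] init_mor[OF x wa(1)] deg_init[OF x wa(1)] wa(2) ab by auto
    have c2: "(l \<cdot> init x ?b, tail (init x ?a) ?b) \<in> composable \<Lambda>"
      using comp[OF wa(2)] ia(2) by (simp add: composable_iff)
    have "l \<cdot> init x ?a = (l \<cdot> init x ?b) \<cdot> tail (init x ?a) ?b"
      using ia cmp_assoc[OF comp[OF wa(2)] ia(2)] by simp
    then show ?thesis using head_cmp[OF c2] dl[OF n'] by simp
  qed
  have "\<exists>y\<in>X. pdeg y = ?M \<and> (\<forall>m. below m ?M \<longrightarrow> init y m = h m)"
  proof (rule path_of_initial_segments)
    show "?M \<in> tuples k" using d pdeg_tuples[OF x] by (simp add: tuples_def zero_enat_def)
    show "h m \<in> mors \<Lambda> \<and> deg \<Lambda> (h m) = m" if "below m ?M" for m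
      unfolding h_def using that ml dl deg_head head_mor by simp
    show "head (h m) n = h n" if m: "below m ?M" and n: "n \<in> tuples k" "n \<le> m" for m n
    proof -
      have n': "below n ?M" using below_mono m n by blast
      let ?f = "l \<cdot> init x (sup m ?d - ?d)"
      have "head (h m) n = head ?f n"
        unfolding h_def using head_head[OF ml[OF m], of m n] dl[OF m] m n by simp
      also have "\<dots> = head (head ?f (sup n ?d)) n"
        using head_head[OF ml[OF m], of "sup n ?d" n] dl[OF m] m n d
        by (simp add: le_supI1 sup.mono)
      also have "\<dots> = h n" unfolding h_def using hh[OF m n] by simp
      finally show ?thesis .
    qed
  qed
  then obtain y where y: "y \<in> X" "pdeg y = ?M" "\<And>m. below m ?M \<Longrightarrow> init y m = h m" by blast
  have dM: "below ?d ?M" using below_add_iff[of ?d 0 "pdeg x"] d by simp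
  have h_add: "h (?d + n) = l \<cdot> init x n" if n: "below n (pdeg x)" for n
  proof -
    have s: "sup (?d + n) ?d = ?d + n" by (simp add: sup_absorb1)
    show ?thesis
      unfolding h_def s using head_deg[OF cmp_mor[OF comp[OF n]]] comp[OF n] n x by (simp add: deg_init)
  qed
  have "init x 0 = idt \<Lambda> (src \<Lambda> l)" using pmor_idt[OF x below_zero] sr by (simp add: init_def)
  then have "init y ?d = l" using h_add[OF below_zero] y(3)[OF dM] l by simp
  moreover have "shift k ?d y = x"
  proof (rule path_eqI)
    have wy: "below ?d (pdeg y)" using dM y by simp
    show "shift k ?d y \<in> X" using shift_path y(1) wy by blast
    have "enat a + b - enat a = b" for a b by (cases b) auto
    then show pd: "pdeg (shift k ?d y) = pdeg x"
      unfolding pdeg_shift[OF y(1) wy] y(2) by (auto simp: fun_eq_iff)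
    fix m assume "below m (pdeg (shift k ?d y))"
    then have m: "below m (pdeg x)" using pd by simp
    then have w: "below (?d + m) (pdeg y)" using below_add_iff[of ?d m] d y(2) by simp
    have "init (shift k ?d y) m = tail (l \<cdot> init x m) ?d"
      using init_shift_tail[OF y(1) w] y(2,3) w m d h_add by simp
    then show "init (shift k ?d y) m = init x m" using comp[OF m] by simp
  qed (rule x)
  ultimately show ?thesis using y by auto
qed

text \<open>\<open>prepend_unique\<close> evaluates the definite description in
  \<open>prepend\<close>. Since \<open>below\<close> excludes truncation, adding the degree of
  \<open>l\<close> to that of the shift gives back \<open>pdeg y\<close>.\<close>

lemma prepend_eqI:
  assumes "y \<in> X" "l \<in> mors \<Lambda>" "below (deg \<Lambda> l) (pdeg y)" "init y (deg \<Lambda> l) = l"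
  shows "prepend k \<Lambda> l (shift k (deg \<Lambda> l) y) = y"
  unfolding prepend_def
proof (rule the_equality)
  have "enat a + (b - enat a) = b" if "enat a \<le> b" for a b using that by (cases b) auto
  then have eq: "(enat \<circ> deg \<Lambda> l) + pdeg (shift k (deg \<Lambda> l) y) = pdeg y"
    using assms pdeg_shift[OF assms(1,3)] by (auto simp: fun_eq_iff below_def le_fun_def)
  then show "y \<in> X \<and> pdeg y = (enat \<circ> deg \<Lambda> l) + pdeg (shift k (deg \<Lambda> l) y) \<and>
      pmor y (0, deg \<Lambda> l) = l \<and> shift k (deg \<Lambda> l) y = shift k (deg \<Lambda> l) y"
    using assms by (simp add: init_def)
  fix y' assume "y' \<in> X \<and> pdeg y' = (enat \<circ> deg \<Lambda> l) + pdeg (shift k (deg \<Lambda> l) y) \<and>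
      pmor y' (0, deg \<Lambda> l) = l \<and> shift k (deg \<Lambda> l) y' = shift k (deg \<Lambda> l) y"
  then show "y' = y" using prepend_unique[of y' y l] assms eq by (simp add: init_def)
qed

lemma
  assumes x: "x \<in> X" and l: "l \<in> mors \<Lambda>" and sr: "src \<Lambda> l = pobj x 0"
  shows prepend_path: "prepend k \<Lambda> l x \<in> X"
    and init_prepend: "init (prepend k \<Lambda> l x) (deg \<Lambda> l) = l"
    and shift_prepend: "shift k (deg \<Lambda> l) (prepend k \<Lambda> l x) = x"
    and below_prepend: "below (deg \<Lambda> l) (pdeg (prepend k \<Lambda> l x))"
proof -
  obtain y where y: "y \<in> X" "pdeg y = (enat \<circ> deg \<Lambda> l) + pdeg x" "init y (deg \<Lambda> l) = l"
    "shift k (deg \<Lambda> l) y = x" using prepend_ex[OF assms] by blast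
  have w: "below (deg \<Lambda> l) (pdeg y)" using below_add_iff[of "deg \<Lambda> l" 0 "pdeg x"] l y by simp
  have "prepend k \<Lambda> l x = y" using prepend_eqI[OF y(1) l w y(3)] y(4) by simp
  then show "prepend k \<Lambda> l x \<in> X"
    "init (prepend k \<Lambda> l x) (deg \<Lambda> l) = l" "shift k (deg \<Lambda> l) (prepend k \<Lambda> l x) = x"
    "below (deg \<Lambda> l) (pdeg (prepend k \<Lambda> l x))"
    using y w by simp_all
qed

lemma prepend_init_shift:
  assumes "x \<in> X" "below m (pdeg x)"
  shows "prepend k \<Lambda> (init x m) (shift k m x) = x"
  using prepend_eqI[of x "init x m"] assms by (simp add: init_mor deg_init)

end

section \<open>The topology of \<open>\<Lambda>\<close>\<close>

context topological_kgraph
begin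

lemma openin_deg: "openin (mor_top \<Lambda>) {f \<in> mors \<Lambda>. P (deg \<Lambda> f)}"
proof -
  have "openin (mor_top \<Lambda>) {f \<in> mors \<Lambda>. deg \<Lambda> f \<in> {m \<in> tuples k. P m}}"
    by (rule openin_continuous_map_preimage[OF continuous_deg]) simp
  moreover have "{f \<in> mors \<Lambda>. deg \<Lambda> f \<in> {m \<in> tuples k. P m}} = {f \<in> mors \<Lambda>. P (deg \<Lambda> f)}"
    by auto
  ultimately show ?thesis by simp
qed

lemma closedin_deg: "closedin (mor_top \<Lambda>) {f \<in> mors \<Lambda>. P (deg \<Lambda> f)}"
proof -
  have "mors \<Lambda> - {f \<in> mors \<Lambda>. P (deg \<Lambda> f)} = {f \<in> mors \<Lambda>. \<not> P (deg \<Lambda> f)}" by auto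
  then show ?thesis using openin_deg[of "\<lambda>m. \<not> P m"] by (auto simp: closedin_def)
qed

lemma finite_deg_image: "compactin (mor_top \<Lambda>) C \<Longrightarrow> finite (deg \<Lambda> ` C)"
  using image_compactin[OF _ continuous_deg] by (auto simp: compactin_discrete_topology)

text \<open>The set is the image under composition of the composable pairs in
  \<open>U \<times> V\<close> whose first member has degree \<open>m\<close>. Composition is an open
  map and the degree is locally constant.\<close>

lemma openin_factors:
  assumes m: "m \<in> tuples k" and U: "openin (mor_top \<Lambda>) U" and V: "openin (mor_top \<Lambda>) V"
  shows "openin (mor_top \<Lambda>) {f \<in> mors \<Lambda>. m \<le> deg \<Lambda> f \<and> head f m \<in> U \<and> tail f m \<in> V}"
proof -
  let ?U = "U \<inter> {f \<in> mors \<Lambda>. deg \<Lambda> f = m}"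
  let ?W = "(?U \<times> V) \<inter> composable \<Lambda>"
  have "openin (mor_top \<Lambda>) ?U" using U openin_deg[of "\<lambda>n. n = m"] by blast
  then have "openin (subtopology (prod_topology (mor_top \<Lambda>) (mor_top \<Lambda>)) (composable \<Lambda>)) ?W"
    using V by (intro openin_subtopology_Int) (simp add: openin_prod_Times_iff)
  then have "openin (mor_top \<Lambda>) ((\<lambda>(f, g). f \<cdot> g) ` ?W)"
    using open_cmp by (simp add: open_map_def)
  moreover have "(\<lambda>(f, g). f \<cdot> g) ` ?W = {f \<in> mors \<Lambda>. m \<le> deg \<Lambda> f \<and> head f m \<in> U \<and> tail f m \<in> V}"
  proof (intro equalityI subsetI)
    fix f assume "f \<in> (\<lambda>(f, g). f \<cdot> g) ` ?W"
    then obtain g h where "(g, h) \<in> composable \<Lambda>" "g \<in> U" "h \<in> V" "deg \<Lambda> g = m" "f = g \<cdot> h" by auto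
    then show "f \<in> {f \<in> mors \<Lambda>. m \<le> deg \<Lambda> f \<and> head f m \<in> U \<and> tail f m \<in> V}" by auto
  next
    fix f assume "f \<in> {f \<in> mors \<Lambda>. m \<le> deg \<Lambda> f \<and> head f m \<in> U \<and> tail f m \<in> V}"
    then have f: "f \<in> mors \<Lambda>" "m \<le> deg \<Lambda> f" "head f m \<in> U" "tail f m \<in> V" by auto
    have "(head f m, tail f m) \<in> ?W"
      using f m head_tail_composable deg_head head_mor by auto
    then show "f \<in> (\<lambda>(f, g). f \<cdot> g) ` ?W"
      using head_cmp_tail[OF f(1) m f(2)] by (intro image_eqI[of _ _ "(head f m, tail f m)"]) auto
  qed
  ultimately show ?thesis by simp
qed

text \<open>Preimages of open sets are open by \<open>openin_factors\<close>; thus continuity of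
  factorisation comes from openness of composition.\<close>

lemma continuous_tail:
  assumes m: "m \<in> tuples k"
  shows "continuous_map (subtopology (mor_top \<Lambda>) {f \<in> mors \<Lambda>. m \<le> deg \<Lambda> f})
    (mor_top \<Lambda>) (\<lambda>f. tail f m)" (is "continuous_map ?D _ _")
proof -
  have t: "topspace ?D = {f \<in> mors \<Lambda>. m \<le> deg \<Lambda> f}" by auto
  show "continuous_map ?D (mor_top \<Lambda>) (\<lambda>f. tail f m)"
    unfolding continuous_map_def t
  proof (intro conjI allI impI)
    fix U assume "openin (mor_top \<Lambda>) U"
    from openin_factors[OF m openin_topspace this]
    have "openin ?D ({f \<in> mors \<Lambda>. m \<le> deg \<Lambda> f} \<inter>
        {f \<in> mors \<Lambda>. m \<le> deg \<Lambda> f \<and> head f m \<in> mors \<Lambda> \<and> tail f m \<in> U})"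
      by (simp add: openin_subtopology_Int2)
    moreover have "{f \<in> mors \<Lambda>. m \<le> deg \<Lambda> f} \<inter>
        {f \<in> mors \<Lambda>. m \<le> deg \<Lambda> f \<and> head f m \<in> mors \<Lambda> \<and> tail f m \<in> U} =
        {f \<in> {f \<in> mors \<Lambda>. m \<le> deg \<Lambda> f}. tail f m \<in> U}"
      using m by (auto simp: head_mor)
    ultimately show "openin ?D {f \<in> {f \<in> mors \<Lambda>. m \<le> deg \<Lambda> f}. tail f m \<in> U}" by simp
  qed (use m in \<open>auto simp: tail_mor\<close>)
qed

lemma compactin_tail:
  assumes m: "m \<in> tuples k" and C: "compactin (mor_top \<Lambda>) C"
  shows "compactin (mor_top \<Lambda>) ((\<lambda>f. tail f m) ` {f \<in> C. m \<le> deg \<Lambda> f})"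
proof -
  have "C \<subseteq> mors \<Lambda>" using C compactin_subset_topspace by blast
  then have "{f \<in> mors \<Lambda>. m \<le> deg \<Lambda> f} \<inter> C = {f \<in> C. m \<le> deg \<Lambda> f}" by auto
  then have "compactin (mor_top \<Lambda>) {f \<in> C. m \<le> deg \<Lambda> f}"
    using closed_Int_compactin[OF closedin_deg C, of "\<lambda>n. m \<le> n"] by simp
  then have "compactin (subtopology (mor_top \<Lambda>) {f \<in> mors \<Lambda>. m \<le> deg \<Lambda> f}) {f \<in> C. m \<le> deg \<Lambda> f}"
    using \<open>C \<subseteq> mors \<Lambda>\<close> by (auto simp: compactin_subtopology)
  from image_compactin[OF this continuous_tail[OF m]] show ?thesis .
qed

lemma closedin_composable: "closedin (prod_topology (mor_top \<Lambda>) (mor_top \<Lambda>)) (composable \<Lambda>)"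
proof -
  have "closedin (prod_topology (mor_top \<Lambda>) (mor_top \<Lambda>))
     {p \<in> topspace (prod_topology (mor_top \<Lambda>) (mor_top \<Lambda>)). (src \<Lambda> \<circ> fst) p = (rng \<Lambda> \<circ> snd) p}"
    by (intro closedin_continuous_maps_eq[OF Hausdorff_obj] continuous_map_compose[OF continuous_map_fst continuous_src]
      continuous_map_compose[OF continuous_map_snd continuous_rng])
  moreover have "{p \<in> topspace (prod_topology (mor_top \<Lambda>) (mor_top \<Lambda>)).
      (src \<Lambda> \<circ> fst) p = (rng \<Lambda> \<circ> snd) p} = composable \<Lambda>"
    by (auto simp: composable_iff)
  ultimately show ?thesis by simp
qed

text \<open>Composable pairs form a closed set because the object space is Hausdorff, so those in
  \<open>C \<times> D\<close> form a compact set, and composition is continuous.\<close>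

lemma compactin_cmp:
  assumes C: "compactin (mor_top \<Lambda>) C" and D: "compactin (mor_top \<Lambda>) D"
  shows "compactin (mor_top \<Lambda>) ((\<lambda>(f, g). f \<cdot> g) ` (composable \<Lambda> \<inter> C \<times> D))"
proof -
  have "compactin (prod_topology (mor_top \<Lambda>) (mor_top \<Lambda>)) (composable \<Lambda> \<inter> C \<times> D)"
    using C D closedin_composable by (intro closed_Int_compactin) (auto simp: compactin_Times)
  then have "compactin (subtopology (prod_topology (mor_top \<Lambda>) (mor_top \<Lambda>)) (composable \<Lambda>))
      (composable \<Lambda> \<inter> C \<times> D)"
    by (simp add: compactin_subtopology)
  from image_compactin[OF this continuous_cmp] show ?thesis .
qed

text \<open>The graph of \<open>tail\<close> at \<open>m\<close> is closed, because its domain is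
  closed and the morphism space is Hausdorff. Its intersection with \<open>F\<close> is compact and
  projects onto the given set. In \<open>continuous_arrow\<close> this handles the compact sets
  removed from basic open sets.\<close>

lemma compactin_tail_graph:
  assumes m: "m \<in> tuples k" and F: "compactin (prod_topology (mor_top \<Lambda>) (mor_top \<Lambda>)) F"
  shows "compactin (mor_top \<Lambda>) {l \<in> mors \<Lambda>. m \<le> deg \<Lambda> l \<and> (l, tail l m) \<in> F}"
proof -
  let ?T = "mor_top \<Lambda>" and ?D = "{f \<in> mors \<Lambda>. m \<le> deg \<Lambda> f}"
  let ?P = "prod_topology ?T ?T"
  have F': "F \<subseteq> mors \<Lambda> \<times> mors \<Lambda>" using compactin_subset_topspace[OF F] by simp
  have cD: "closedin ?P (?D \<times> mors \<Lambda>)"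
    using closedin_deg[of "\<lambda>n. m \<le> n"] by (simp add: closedin_prod_Times_iff)
  have s: "subtopology ?P (?D \<times> mors \<Lambda>) = prod_topology (subtopology ?T ?D) ?T"
    by (simp add: prod_topology_subtopology(1))
  have "closedin (prod_topology (subtopology ?T ?D) ?T)
     {p \<in> topspace (prod_topology (subtopology ?T ?D) ?T). ((\<lambda>f. tail f m) \<circ> fst) p = snd p}"
    by (intro closedin_continuous_maps_eq[OF Hausdorff_mor] continuous_map_snd
      continuous_map_compose[OF continuous_map_fst continuous_tail[OF m]])
  moreover have eq: "{p \<in> topspace (subtopology ?P (?D \<times> mors \<Lambda>)). ((\<lambda>f. tail f m) \<circ> fst) p = snd p} =
      {p \<in> ?D \<times> mors \<Lambda>. tail (fst p) m = snd p}" by auto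
  ultimately have "closedin ?P {p \<in> ?D \<times> mors \<Lambda>. tail (fst p) m = snd p}"
    unfolding s[symmetric] using closedin_trans_full[OF _ cD] eq by simp
  then have "compactin ?P ({p \<in> ?D \<times> mors \<Lambda>. tail (fst p) m = snd p} \<inter> F)"
    using F by (rule closed_Int_compactin)
  from image_compactin[OF this continuous_map_fst]
  have "compactin ?T (fst ` ({p \<in> ?D \<times> mors \<Lambda>. tail (fst p) m = snd p} \<inter> F))" .
  moreover have "fst ` ({p \<in> ?D \<times> mors \<Lambda>. tail (fst p) m = snd p} \<inter> F) =
      {l \<in> mors \<Lambda>. m \<le> deg \<Lambda> l \<and> (l, tail l m) \<in> F}"
  proof (intro equalityI subsetI)
    fix l assume "l \<in> {l \<in> mors \<Lambda>. m \<le> deg \<Lambda> l \<and> (l, tail l m) \<in> F}"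
    then show "l \<in> fst ` ({p \<in> ?D \<times> mors \<Lambda>. tail (fst p) m = snd p} \<inter> F)"
      using F' by (intro image_eqI[of _ _ "(l, tail l m)"]) auto
  qed auto
  ultimately show ?thesis by simp
qed

text \<open>The source map is injective on some basic open neighbourhood of each morphism. Elements
  of one fibre with the same chosen neighbourhood therefore coincide, and only countably many
  neighbourhoods are available.\<close>

lemma countable_src_fibre: "countable {f \<in> mors \<Lambda>. src \<Lambda> f = v}"
proof -
  obtain \<B> where B': "countable \<B> \<and> (\<forall>V \<in> \<B>. openin (mor_top \<Lambda>) V) \<and>
      (\<forall>U f. openin (mor_top \<Lambda>) U \<and> f \<in> U \<longrightarrow> (\<exists>V \<in> \<B>. f \<in> V \<and> V \<subseteq> U))"
    using second_countable_mor unfolding second_countable_def by (elim exE)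
  then have B: "countable \<B>" "\<And>U f. openin (mor_top \<Lambda>) U \<Longrightarrow> f \<in> U \<Longrightarrow> \<exists>V\<in>\<B>. f \<in> V \<and> V \<subseteq> U"
    by blast+
  have "\<exists>V\<in>\<B>. f \<in> V \<and> inj_on (src \<Lambda>) V" if "f \<in> mors \<Lambda>" for f
  proof -
    from local_homeomorphism_src[unfolded local_homeomorphism_def, rule_format, OF that]
    obtain U where U: "openin (mor_top \<Lambda>) U" "f \<in> U"
      "homeomorphic_map (subtopology (mor_top \<Lambda>) U) (subtopology (obj_top \<Lambda>) (src \<Lambda> ` U)) (src \<Lambda>)"
      by (elim exE conjE)
    have "inj_on (src \<Lambda>) U"
      using homeomorphic_imp_injective_map[OF U(3)] openin_subset[OF U(1)] by (simp add: Int_absorb1)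
    then show ?thesis using B(2)[OF U(1,2)] inj_on_subset by blast
  qed
  then have "\<forall>f\<in>mors \<Lambda>. \<exists>V. V \<in> \<B> \<and> f \<in> V \<and> inj_on (src \<Lambda>) V" by blast
  from bchoice[OF this] obtain V
    where V: "\<And>f. f \<in> mors \<Lambda> \<Longrightarrow> V f \<in> \<B> \<and> f \<in> V f \<and> inj_on (src \<Lambda>) (V f)" by blast
  have "inj_on V {f \<in> mors \<Lambda>. src \<Lambda> f = v}"
  proof (rule inj_onI)
    fix f g assume "f \<in> {f \<in> mors \<Lambda>. src \<Lambda> f = v}" "g \<in> {f \<in> mors \<Lambda>. src \<Lambda> f = v}" "V f = V g"
    then show "f = g" using V[of f] V[of g] by (auto dest: inj_onD)
  qed
  moreover have "V ` {f \<in> mors \<Lambda>. src \<Lambda> f = v} \<subseteq> \<B>" using V by auto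
  ultimately show ?thesis
    using countable_image_inj_on[OF countable_subset[OF _ B(1)]] by blast
qed

lemma completely_regular_mor: "completely_regular_space (mor_top \<Lambda>)"
  using locally_compact_regular_imp_completely_regular_space locally_compact_mor Hausdorff_mor by blast

text \<open>Urysohn's lemma separates \<open>K\<close> from the complement of an open set between
  \<open>K\<close> and a compact \<open>L\<close>. The function it gives vanishes on
  \<open>K\<close>, so it is subtracted from \<open>1\<close>.\<close>

lemma compactin_bump:
  assumes K: "compactin (mor_top \<Lambda>) K"
  obtains \<phi> L where "continuous_map (mor_top \<Lambda>) euclideanreal \<phi>" "\<And>f. f \<in> mors \<Lambda> \<Longrightarrow> 0 \<le> \<phi> f \<and> \<phi> f \<le> 1"
    "\<And>f. f \<in> K \<Longrightarrow> \<phi> f = 1" "compactin (mor_top \<Lambda>) L" "K \<subseteq> L" "\<And>f. f \<in> mors \<Lambda> \<Longrightarrow> f \<notin> L \<Longrightarrow> \<phi> f = 0"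
proof -
  obtain U L where U: "openin (mor_top \<Lambda>) U" "compactin (mor_top \<Lambda>) L" "K \<subseteq> U" "U \<subseteq> L"
    using locally_compact_mor Hausdorff_mor K
    by (auto simp: locally_compact_space_compact_closed_compact)
  have "closedin (mor_top \<Lambda>) (mors \<Lambda> - U)" "disjnt (mors \<Lambda> - U) K"
    using U by (auto simp: disjnt_def)
  from Urysohn_completely_regular_closed_compact[OF _ completely_regular_mor this(1) K this(2), of 0 1]
  obtain \<psi> where \<psi>: "continuous_map (mor_top \<Lambda>) (subtopology euclidean {0..1::real}) \<psi>"
    "\<psi> ` K \<subseteq> {0}" "\<psi> ` (mors \<Lambda> - U) \<subseteq> {1}" by auto
  then have c: "continuous_map (mor_top \<Lambda>) euclideanreal \<psi>" "\<And>f. f \<in> mors \<Lambda> \<Longrightarrow> \<psi> f \<in> {0..1}"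
    by (auto simp: continuous_map_in_subtopology)
  show ?thesis
  proof
    show "continuous_map (mor_top \<Lambda>) euclideanreal (\<lambda>f. 1 - \<psi> f)"
      by (intro continuous_map_diff c) auto
    show "0 \<le> 1 - \<psi> f \<and> 1 - \<psi> f \<le> 1" if "f \<in> mors \<Lambda>" for f using c(2)[OF that] by simp
    show "1 - \<psi> f = 1" if "f \<in> K" for f using \<psi>(2) that by auto
    show "1 - \<psi> f = 0" if "f \<in> mors \<Lambda>" "f \<notin> L" for f
    proof -
      have "\<psi> f \<in> \<psi> ` (mors \<Lambda> - U)" using that U by blast
      then show ?thesis using \<psi>(3) by auto
    qed
  qed (use U in auto)
qed

end

text \<open>Compact alignment, expressed through the complements \<alpha> in minimal common
  extensions \<open>l \<cdot> \<alpha>\<close> instead of the extensions themselves, because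
  \<open>reach_le_add\<close> needs a compact set containing these complements. \<open>C\<close> and
  \<open>D\<close> may meet several degrees.\<close>

locale compactly_aligned_kgraph = topological_kgraph k \<Lambda>
  for k and \<Lambda> :: "('o, 'a, 'z) kgraph_scheme" +
  assumes aligned: "\<And>C D. compactin (mor_top \<Lambda>) C \<Longrightarrow> compactin (mor_top \<Lambda>) D \<Longrightarrow>
    \<exists>E. compactin (mor_top \<Lambda>) E \<and> (\<forall>l\<in>C. \<forall>\<mu>\<in>D. fst ` min_ext \<Lambda> l \<mu> \<subseteq> E)"

context topological_kgraph
begin

lemma min_ext_deg:
  assumes "(\<alpha>, \<beta>) \<in> min_ext \<Lambda> l \<mu>"
  shows "(l, \<alpha>) \<in> composable \<Lambda>" "(\<mu>, \<beta>) \<in> composable \<Lambda>" "l \<cdot> \<alpha> = \<mu> \<cdot> \<beta>"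
    "deg \<Lambda> l + deg \<Lambda> \<alpha> = sup (deg \<Lambda> l) (deg \<Lambda> \<mu>)" "deg \<Lambda> \<mu> + deg \<Lambda> \<beta> = sup (deg \<Lambda> l) (deg \<Lambda> \<mu>)"
  using assms deg_cmp[of l \<alpha>] deg_cmp[of \<mu> \<beta>] by (auto simp: min_ext_def)

text \<open>For \<open>k = 1\<close> the degrees of \<open>l\<close> and \<open>\<mu>\<close> are comparable, so a minimal common extension is \<open>l\<close> or \<open>\<mu>\<close>.\<close>

lemma compactly_aligned_one:
  assumes k: "k = 1" shows "compactly_aligned_kgraph k \<Lambda>"
proof
  fix C D assume C: "compactin (mor_top \<Lambda>) C" and D: "compactin (mor_top \<Lambda>) D"
  let ?n = "deg \<Lambda> ` (C \<union> D)"
  have CD: "compactin (mor_top \<Lambda>) (C \<union> D)" using C D by (rule compactin_Un)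
  have sub: "C \<subseteq> mors \<Lambda>" "D \<subseteq> mors \<Lambda>" using C D compactin_subset_topspace by blast+
  \<comment> \<open>By comparability \<alpha> is the tail at \<open>deg \<Lambda> l\<close> of
    either \<open>l\<close> or \<mu>. A compact set has only finitely many degrees, so this union of
    compact sets is finite.\<close>
  define E where "E = (\<Union>m\<in>?n. (\<lambda>f. tail f m) ` {f \<in> C \<union> D. m \<le> deg \<Lambda> f})"
  have "compactin (mor_top \<Lambda>) E"
    unfolding E_def using finite_deg_image[OF CD] compactin_tail[OF _ CD] sub
    by (intro compactin_Union) auto
  moreover have "fst p \<in> E" if l: "l \<in> C" and \<mu>: "\<mu> \<in> D" and p: "p \<in> min_ext \<Lambda> l \<mu>" for l \<mu> p
  proof -
    obtain \<alpha> \<beta> where p': "p = (\<alpha>, \<beta>)" "(\<alpha>, \<beta>) \<in> min_ext \<Lambda> l \<mu>" using p by (cases p) auto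
    note e = min_ext_deg[OF p'(2)]
    have mem: "l \<in> mors \<Lambda>" "\<mu> \<in> mors \<Lambda>" "\<alpha> \<in> mors \<Lambda>" "\<beta> \<in> mors \<Lambda>" using e by (auto simp: composable_iff)
    have "deg \<Lambda> \<mu> \<le> deg \<Lambda> l \<or> deg \<Lambda> l \<le> deg \<Lambda> \<mu>"
    proof -
      have "deg \<Lambda> \<mu> i = 0" "deg \<Lambda> l i = 0" if "i \<noteq> 0" for i
        using deg_tuples[OF mem(1)] deg_tuples[OF mem(2)] k that by (auto simp: tuples_def)
      then show ?thesis unfolding le_fun_def by (metis le_refl nat_le_linear)
    qed
    then have "\<alpha> = tail l (deg \<Lambda> l) \<or> \<alpha> = tail \<mu> (deg \<Lambda> l) \<and> deg \<Lambda> l \<le> deg \<Lambda> \<mu>"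
    proof
      assume "deg \<Lambda> \<mu> \<le> deg \<Lambda> l"
      then have "deg \<Lambda> l + deg \<Lambda> \<alpha> = deg \<Lambda> l + 0" using e(4) by (simp add: sup_absorb1)
      then have "deg \<Lambda> \<alpha> = 0" unfolding tuple_add_left_cancel .
      then have "\<alpha> = idt \<Lambda> (src \<Lambda> l)" using composable_deg_zero e(1) by blast
      then show ?thesis using tail_deg mem by simp
    next
      assume le: "deg \<Lambda> l \<le> deg \<Lambda> \<mu>"
      then have "deg \<Lambda> \<mu> + deg \<Lambda> \<beta> = deg \<Lambda> \<mu> + 0" using e(5) by (simp add: sup_absorb2)
      then have "deg \<Lambda> \<beta> = 0" unfolding tuple_add_left_cancel .
      then have "\<beta> = idt \<Lambda> (src \<Lambda> \<mu>)" using composable_deg_zero e(2) by blast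
      then have "l \<cdot> \<alpha> = \<mu>" using e(3) mem by simp
      then show ?thesis using tail_cmp[OF e(1)] le by simp
    qed
    then show ?thesis unfolding E_def using l \<mu> p' by auto
  qed
  ultimately show "\<exists>E. compactin (mor_top \<Lambda>) E \<and> (\<forall>l\<in>C. \<forall>\<mu>\<in>D. fst ` min_ext \<Lambda> l \<mu> \<subseteq> E)" by blast
qed

text \<open>In a discrete space compact means finite, so finite alignment yields a finite union of
  finite sets.\<close>

lemma compactly_aligned_discrete:
  assumes "discrete_k_graph k \<Lambda>" "finitely_aligned \<Lambda>" shows "compactly_aligned_kgraph k \<Lambda>"
proof
  have T: "compactin (mor_top \<Lambda>) C \<longleftrightarrow> C \<subseteq> mors \<Lambda> \<and> finite C" for C
    using assms(1) unfolding discrete_k_graph_def by (metis compactin_discrete_topology)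
  fix C D assume "compactin (mor_top \<Lambda>) C" "compactin (mor_top \<Lambda>) D"
  then have CD: "C \<subseteq> mors \<Lambda>" "finite C" "D \<subseteq> mors \<Lambda>" "finite D" by (simp_all add: T)
  let ?E = "\<Union>l\<in>C. \<Union>\<mu>\<in>D. fst ` min_ext \<Lambda> l \<mu>"
  have "finite (min_ext \<Lambda> l \<mu>)" if "l \<in> C" "\<mu> \<in> D" for l \<mu>
    using that CD assms(2) unfolding finitely_aligned_def by blast
  then have "finite ?E" using CD by (intro finite_UN_I finite_imageI) auto
  moreover have "?E \<subseteq> mors \<Lambda>"
    using min_ext_deg(1) by (fastforce simp: composable_iff)
  ultimately have "compactin (mor_top \<Lambda>) ?E" by (simp add: T)
  then show "\<exists>E. compactin (mor_top \<Lambda>) E \<and> (\<forall>l\<in>C. \<forall>\<mu>\<in>D. fst ` min_ext \<Lambda> l \<mu> \<subseteq> E)" by blast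
qed

end

section \<open>The topology of the path groupoid\<close>

context topological_kgraph
begin

text \<open>The prefixes \<open>l\<close> and \<mu> are initial segments of \<open>x\<close> and
  \<open>y\<close>, and the path they are prepended to is the common shift, so
  \<open>prepend\<close> disappears. That the prefixes have a common source follows from the
  equality of the shifts.\<close>

lemma cyl_iff:
  "(x, m, y) \<in> cyl k \<Lambda> F n \<longleftrightarrow> m = n \<and> x \<in> X \<and> y \<in> X \<and> (\<exists>p q. below p (pdeg x) \<and> below q (pdeg y) \<and>
     (init x p, init y q) \<in> F \<and> shift k p x = shift k q y \<and> (int \<circ> p) - (int \<circ> q) = n)"
  (is "?L \<longleftrightarrow> ?R")
proof
  assume ?L
  then obtain l \<mu> z where z: "x = prepend k \<Lambda> l z" "m = n" "y = prepend k \<Lambda> \<mu> z" "(l, \<mu>) \<in> F"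
    "l \<in> mors \<Lambda>" "\<mu> \<in> mors \<Lambda>" "src \<Lambda> l = src \<Lambda> \<mu>" "z \<in> X" "pobj z 0 = src \<Lambda> l"
    "(int \<circ> deg \<Lambda> l) - (int \<circ> deg \<Lambda> \<mu>) = n"
    by (auto simp: cyl_def same_src_def)
  have l: "src \<Lambda> l = pobj z 0" and \<mu>: "src \<Lambda> \<mu> = pobj z 0" using z(7,9) by (simp_all only:)
  have "below (deg \<Lambda> l) (pdeg x)" "x \<in> X" "init x (deg \<Lambda> l) = l" "shift k (deg \<Lambda> l) x = z"
    unfolding z(1) using prepend_path[OF z(8,5) l] init_prepend[OF z(8,5) l]
      shift_prepend[OF z(8,5) l] below_prepend[OF z(8,5) l] by (simp_all only:)
  moreover have "below (deg \<Lambda> \<mu>) (pdeg y)" "y \<in> X" "init y (deg \<Lambda> \<mu>) = \<mu>" "shift k (deg \<Lambda> \<mu>) y = z"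
    unfolding z(3) using prepend_path[OF z(8,6) \<mu>] init_prepend[OF z(8,6) \<mu>]
      shift_prepend[OF z(8,6) \<mu>] below_prepend[OF z(8,6) \<mu>] by (simp_all only:)
  ultimately show ?R using z(2,4,10) by (intro conjI exI[of _ "deg \<Lambda> l"] exI[of _ "deg \<Lambda> \<mu>"]) simp_all
next
  assume R: ?R
  then obtain p q where pq: "m = n" "x \<in> X" "y \<in> X" "below p (pdeg x)" "below q (pdeg y)"
    "(init x p, init y q) \<in> F" "shift k p x = shift k q y" "(int \<circ> p) - (int \<circ> q) = n" by blast
  have x: "prepend k \<Lambda> (init x p) (shift k p x) = x" and y: "prepend k \<Lambda> (init y q) (shift k p x) = y"
    using prepend_init_shift[OF pq(2,4)] prepend_init_shift[OF pq(3,5)] unfolding pq(7) by simp_all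
  have "pobj (shift k p x) 0 = src \<Lambda> (init x p)"
    using pobj_shift[OF pq(2,4), of 0] src_init[OF pq(2,4)] pq(4) by simp
  moreover have "pobj (shift k p x) 0 = src \<Lambda> (init y q)"
    unfolding pq(7) using pobj_shift[OF pq(3,5), of 0] src_init[OF pq(3,5)] pq(5) by simp
  ultimately have "(x, m, y) = (prepend k \<Lambda> (init x p) (shift k p x), n, prepend k \<Lambda> (init y q) (shift k p x)) \<and>
      (init x p, init y q) \<in> F \<inter> same_src \<Lambda> \<and> shift k p x \<in> X \<and> pobj (shift k p x) 0 = src \<Lambda> (init x p) \<and>
      (int \<circ> deg \<Lambda> (init x p)) - (int \<circ> deg \<Lambda> (init y q)) = n"
    using x y pq by (simp add: same_src_def init_mor deg_init shift_path)
  then show ?L unfolding cyl_def by blast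
qed

lemma init_pair_same_src:
  assumes "x \<in> X" "y \<in> X" "below p (pdeg x)" "below q (pdeg y)" "shift k p x = shift k q y"
  shows "(init x p, init y q) \<in> same_src \<Lambda>"
  using assms pobj_shift[of x p 0] pobj_shift[of y q 0]
  by (simp add: same_src_def init_mor src_init)

lemma path_arrows_iff:
  "(x, m, y) \<in> path_arrows k \<Lambda> \<longleftrightarrow> x \<in> X \<and> y \<in> X \<and> (\<exists>p q. below p (pdeg x) \<and> below q (pdeg y) \<and>
     shift k p x = shift k q y \<and> m = (int \<circ> p) - (int \<circ> q))"
  (is "?L \<longleftrightarrow> ?R")
proof
  show "?L \<Longrightarrow> ?R" unfolding path_arrows_def UN_iff cyl_iff by blast
  assume ?R
  then obtain p q where pq: "x \<in> X" "y \<in> X" "below p (pdeg x)" "below q (pdeg y)"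
    "shift k p x = shift k q y" "m = (int \<circ> p) - (int \<circ> q)" by (elim exE conjE)
  then have "m \<in> tuples k" "(x, m, y) \<in> cyl k \<Lambda> (same_src \<Lambda>) m"
    using init_pair_same_src[OF pq(1-5)] by (auto simp: cyl_iff)
  then show ?L unfolding path_arrows_def by blast
qed

lemma same_src_subset: "same_src \<Lambda> \<subseteq> mors \<Lambda> \<times> mors \<Lambda>"
  by (auto simp: same_src_def)

lemma cyl_subset_arrows: "m \<in> tuples k \<Longrightarrow> cyl k \<Lambda> F m \<subseteq> path_arrows k \<Lambda>"
proof
  fix g assume g: "g \<in> cyl k \<Lambda> F m"
  obtain x n y where "g = (x, n, y)" by (cases g)
  moreover have "(x, n, y) \<in> cyl k \<Lambda> F m \<Longrightarrow> (x, n, y) \<in> path_arrows k \<Lambda>"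
    unfolding path_arrows_iff cyl_iff by blast
  ultimately show "g \<in> path_arrows k \<Lambda>" using g by simp
qed

lemma cyl_degree: "g \<in> cyl k \<Lambda> F m \<Longrightarrow> fst (snd g) = m"
  by (auto simp: cyl_def)

lemma openin_basis:
  assumes "m \<in> tuples k" "openin (mor_top \<Lambda>) U" "openin (mor_top \<Lambda>) V" "F \<subseteq> same_src \<Lambda>"
    "compactin (prod_topology (mor_top \<Lambda>) (mor_top \<Lambda>)) F"
  shows "openin (path_arrow_topology k \<Lambda>)
    (cyl k \<Lambda> ((U \<times> V) \<inter> same_src \<Lambda>) m \<inter> (path_arrows k \<Lambda> - cyl k \<Lambda> F m))"
  unfolding path_arrow_topology_def
  by (rule topology_generated_by_Basis) (use assms in \<open>auto simp: path_arrow_basis_def\<close>)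

lemma cyl_empty: "cyl k \<Lambda> {} m = {}"
  by (auto simp: cyl_iff)

lemma openin_cyl:
  assumes "m \<in> tuples k" "openin (mor_top \<Lambda>) U" "openin (mor_top \<Lambda>) V"
  shows "openin (path_arrow_topology k \<Lambda>) (cyl k \<Lambda> ((U \<times> V) \<inter> same_src \<Lambda>) m)"
  using openin_basis[OF assms, of "{}"] cyl_subset_arrows[OF assms(1)]
  by (simp add: cyl_empty Int_absorb2)

lemma topspace_arrows: "topspace (path_arrow_topology k \<Lambda>) = path_arrows k \<Lambda>"
proof (intro equalityI)
  show "topspace (path_arrow_topology k \<Lambda>) \<subseteq> path_arrows k \<Lambda>"
    unfolding path_arrow_topology_def topology_generated_by_topspace by (auto simp: path_arrow_basis_def)
  have "(mors \<Lambda> \<times> mors \<Lambda>) \<inter> same_src \<Lambda> = same_src \<Lambda>" using same_src_subset by blast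
  then show "path_arrows k \<Lambda> \<subseteq> topspace (path_arrow_topology k \<Lambda>)"
    using openin_cyl[OF _ openin_topspace openin_topspace] openin_subset
    unfolding path_arrows_def by fastforce
qed

lemma Union_basis: "\<Union> (path_arrow_basis k \<Lambda>) = path_arrows k \<Lambda>"
  using topspace_arrows by (simp add: path_arrow_topology_def)

text \<open>The complement consists of the arrows whose middle coordinate is not \<open>m\<close>, a
  union of open cylinders, and of the basic open set obtained by removing \<open>F\<close> from all
  arrows with middle coordinate \<open>m\<close>.\<close>

lemma closedin_cyl:
  assumes m: "m \<in> tuples k" and F: "F \<subseteq> same_src \<Lambda>" "compactin (prod_topology (mor_top \<Lambda>) (mor_top \<Lambda>)) F"
  shows "closedin (path_arrow_topology k \<Lambda>) (cyl k \<Lambda> F m)"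
proof -
  let ?U = "\<Union>n\<in>tuples k - {m}. cyl k \<Lambda> ((mors \<Lambda> \<times> mors \<Lambda>) \<inter> same_src \<Lambda>) n"
  let ?V = "cyl k \<Lambda> ((mors \<Lambda> \<times> mors \<Lambda>) \<inter> same_src \<Lambda>) m \<inter> (path_arrows k \<Lambda> - cyl k \<Lambda> F m)"
  have s: "(mors \<Lambda> \<times> mors \<Lambda>) \<inter> same_src \<Lambda> = same_src \<Lambda>" using same_src_subset by blast
  have "openin (path_arrow_topology k \<Lambda>) (?U \<union> ?V)"
    using m F by (intro openin_Un openin_Union openin_basis) (auto intro!: openin_cyl)
  moreover have "?U \<union> ?V = path_arrows k \<Lambda> - cyl k \<Lambda> F m"
  proof (intro equalityI subsetI)
    fix g assume "g \<in> ?U \<union> ?V"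
    then consider n where "n \<in> tuples k" "n \<noteq> m" "g \<in> cyl k \<Lambda> (same_src \<Lambda>) n" | "g \<in> ?V"
      unfolding s by blast
    then show "g \<in> path_arrows k \<Lambda> - cyl k \<Lambda> F m"
      using cyl_subset_arrows cyl_degree by cases blast+
  next
    fix g assume g: "g \<in> path_arrows k \<Lambda> - cyl k \<Lambda> F m"
    then obtain n where "n \<in> tuples k" "g \<in> cyl k \<Lambda> (same_src \<Lambda>) n" unfolding path_arrows_def by blast
    then show "g \<in> ?U \<union> ?V" unfolding s using g by (cases "n = m") blast+
  qed
  ultimately show ?thesis
    using cyl_subset_arrows[OF m] by (simp add: closedin_def topspace_arrows)
qed

section \<open>The topology of the path space\<close>

abbreviation paths_top :: "('o, 'a) kpath topology" where
  "paths_top \<equiv> pullback_topology X (\<lambda>x. (x, 0, x)) (path_arrow_topology k \<Lambda>)"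

lemma unit_arrow: "x \<in> X \<Longrightarrow> (x, 0, x) \<in> path_arrows k \<Lambda>"
  unfolding path_arrows_iff by (auto intro!: exI[of _ 0])

lemma topspace_paths: "topspace paths_top = X"
  using unit_arrow by (auto simp: topspace_pullback_topology topspace_arrows)

text \<open>With both components of \<open>F\<close> in degree \<open>m\<close>, the two prefix
  degrees in \<open>cyl_iff\<close> can only be \<open>m\<close>. This is how the pulled-back
  topology is read off from cylinders.\<close>

lemma unit_arrow_cyl_iff:
  assumes "F \<subseteq> {l \<in> mors \<Lambda>. deg \<Lambda> l = m} \<times> {l \<in> mors \<Lambda>. deg \<Lambda> l = m}"
  shows "(x, 0, x) \<in> cyl k \<Lambda> F 0 \<longleftrightarrow> x \<in> X \<and> below m (pdeg x) \<and> (init x m, init x m) \<in> F"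
proof
  assume "(x, 0, x) \<in> cyl k \<Lambda> F 0"
  then obtain p q where pq: "x \<in> X" "below p (pdeg x)" "below q (pdeg x)" "(init x p, init x q) \<in> F"
    unfolding cyl_iff by (elim exE conjE)
  moreover have "p = m" "q = m"
    using subsetD[OF assms pq(4)] unfolding mem_Sigma_iff mem_Collect_eq deg_init[OF pq(1,2)] deg_init[OF pq(1,3)]
    by blast+
  ultimately show "x \<in> X \<and> below m (pdeg x) \<and> (init x m, init x m) \<in> F" by simp
next
  assume "x \<in> X \<and> below m (pdeg x) \<and> (init x m, init x m) \<in> F"
  then show "(x, 0, x) \<in> cyl k \<Lambda> F 0"
    by (auto simp: cyl_iff fun_eq_iff intro!: exI[of _ m])
qed

lemma openin_paths:
  assumes m: "m \<in> tuples k" and U: "openin (mor_top \<Lambda>) U"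
  shows "openin paths_top {x \<in> X. below m (pdeg x) \<and> init x m \<in> U}"
proof -
  let ?U = "U \<inter> {l \<in> mors \<Lambda>. deg \<Lambda> l = m}"
  have "openin (mor_top \<Lambda>) ?U" using U openin_deg[of "\<lambda>n. n = m"] by blast
  then have "openin (path_arrow_topology k \<Lambda>) (cyl k \<Lambda> ((?U \<times> ?U) \<inter> same_src \<Lambda>) 0)"
    by (intro openin_cyl) auto
  moreover have "(\<lambda>x. (x, 0, x)) -` cyl k \<Lambda> ((?U \<times> ?U) \<inter> same_src \<Lambda>) 0 \<inter> X
      = {x \<in> X. below m (pdeg x) \<and> init x m \<in> U}"
  proof -
    have "(?U \<times> ?U) \<inter> same_src \<Lambda> \<subseteq> {l \<in> mors \<Lambda>. deg \<Lambda> l = m} \<times> {l \<in> mors \<Lambda>. deg \<Lambda> l = m}"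
      by blast
    from unit_arrow_cyl_iff[OF this] show ?thesis
      by (auto simp: same_src_def init_mor deg_init)
  qed
  ultimately show ?thesis unfolding openin_pullback_topology by blast
qed

text \<open>The basis allows compact sets of pairs to be removed; here these are the diagonal pairs
  over the elements of \<open>C\<close> of degree \<open>m\<close>.\<close>

lemma closedin_paths:
  assumes m: "m \<in> tuples k" and C: "compactin (mor_top \<Lambda>) C"
  shows "closedin paths_top {x \<in> X. below m (pdeg x) \<and> init x m \<in> C}"
proof -
  let ?F = "(\<lambda>l. (l, l)) ` ({l \<in> mors \<Lambda>. deg \<Lambda> l = m} \<inter> C)"
  have c: "continuous_map (mor_top \<Lambda>) (prod_topology (mor_top \<Lambda>) (mor_top \<Lambda>)) (\<lambda>l. (l, l))"
    by (intro continuous_map_pairedI continuous_map_id[unfolded id_def])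
  have "compactin (prod_topology (mor_top \<Lambda>) (mor_top \<Lambda>)) ?F"
    using closed_Int_compactin[OF closedin_deg[of "\<lambda>n. n = m"] C] image_compactin c by blast
  then have "closedin (path_arrow_topology k \<Lambda>) (cyl k \<Lambda> ?F 0)"
    by (intro closedin_cyl) (auto simp: same_src_def)
  then have "openin paths_top ((\<lambda>x. (x, 0, x)) -` (path_arrows k \<Lambda> - cyl k \<Lambda> ?F 0) \<inter> X)"
    unfolding openin_pullback_topology closedin_def topspace_arrows by blast
  moreover have "(\<lambda>x. (x, 0, x)) -` (path_arrows k \<Lambda> - cyl k \<Lambda> ?F 0) \<inter> X
      = X - {x \<in> X. below m (pdeg x) \<and> init x m \<in> C}"
  proof -
    have "?F \<subseteq> {l \<in> mors \<Lambda>. deg \<Lambda> l = m} \<times> {l \<in> mors \<Lambda>. deg \<Lambda> l = m}" by blast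
    from unit_arrow_cyl_iff[OF this] show ?thesis
      using unit_arrow by (auto simp: init_mor deg_init)
  qed
  ultimately show ?thesis unfolding closedin_def topspace_paths by auto
qed

section \<open>The arrows between a path and its shifts\<close>

definition arrow :: "('o, 'a) kpath \<Rightarrow> (nat \<Rightarrow> nat) \<Rightarrow> ('o, 'a) path_arrow" where
  "arrow x m = (x, int \<circ> m, shift k m x)"

text \<open>Since the middle coordinate is \<open>int \<circ> m\<close>, the prefix degrees satisfy
  \<open>p = m + q\<close>, so both prefixes can be read off from the single segment
  \<open>init x p\<close>. Continuity of \<open>arrow\<close> thus becomes a question about initial
  segments.\<close>

lemma arrow_cyl_iff:
  assumes x: "x \<in> X" and m: "below m (pdeg x)"
  shows "arrow x m \<in> cyl k \<Lambda> F (int \<circ> m) \<longleftrightarrow>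
     (\<exists>n. below n (pdeg x) \<and> m \<le> n \<and> (init x n, tail (init x n) m) \<in> F)"
proof -
  have mk: "m \<in> tuples k" using m by simp
  have sm: "shift k m x \<in> X" using x m shift_path by blast
  show ?thesis
  proof
    assume "arrow x m \<in> cyl k \<Lambda> F (int \<circ> m)"
    then obtain p q where pq: "below p (pdeg x)" "below q (pdeg (shift k m x))"
      "(init x p, init (shift k m x) q) \<in> F" "(int \<circ> p) - (int \<circ> q) = int \<circ> m"
      by (auto simp: cyl_iff arrow_def)
    have p: "p = m + q"
    proof
      fix i show "p i = (m + q) i" using fun_cong[OF pq(4), of i] by simp
    qed
    then show "\<exists>n. below n (pdeg x) \<and> m \<le> n \<and> (init x n, tail (init x n) m) \<in> F"
      using pq init_shift_tail[OF x _ mk, of q] by (intro exI[of _ p]) auto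
  next
    assume "\<exists>n. below n (pdeg x) \<and> m \<le> n \<and> (init x n, tail (init x n) m) \<in> F"
    then obtain n where n: "below n (pdeg x)" "m \<le> n" "(init x n, tail (init x n) m) \<in> F" by blast
    let ?q = "n - m"
    have q: "m + ?q = n" "?q \<in> tuples k" using n by (auto simp: tuple_add_diff)
    have "below ?q (pdeg (shift k m x))" using below_shift[OF x m q(2)] q n by simp
    moreover have "(init x n, init (shift k m x) ?q) \<in> F" using init_shift_tail[OF x _ mk q(2)] q n by simp
    moreover have "shift k n x = shift k ?q (shift k m x)" using shift_shift[OF x _ mk q(2)] q n by simp
    moreover have "(int \<circ> n) - (int \<circ> ?q) = int \<circ> m" using n(2) by (auto simp: fun_eq_iff le_fun_def of_nat_diff)
    ultimately show "arrow x m \<in> cyl k \<Lambda> F (int \<circ> m)"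
      unfolding arrow_def cyl_iff using x sm n(1) by blast
  qed
qed

lemma arrow_path_arrow: "x \<in> X \<Longrightarrow> below m (pdeg x) \<Longrightarrow> arrow x m \<in> path_arrows k \<Lambda>"
  unfolding arrow_def path_arrows_iff
  using shift_path[of x m] shift_shift[of x m 0]
  by (intro conjI exI[of _ m] exI[of _ 0]) (auto simp: fun_eq_iff)

lemma continuous_arrow:
  assumes m: "m \<in> tuples k"
  shows "continuous_map (subtopology paths_top {x. below m (pdeg x)}) (path_arrow_topology k \<Lambda>) (\<lambda>x. arrow x m)"
proof -
  let ?S = "subtopology paths_top {x. below m (pdeg x)}"
  have "continuous_map ?S (topology_generated_by (path_arrow_basis k \<Lambda>)) (\<lambda>x. arrow x m)"
  proof (rule continuous_on_generated_topo)
    have tS: "topspace ?S = {x \<in> X. below m (pdeg x)}" by (auto simp: topspace_paths)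
    show "(\<lambda>x. arrow x m) ` topspace ?S \<subseteq> \<Union> (path_arrow_basis k \<Lambda>)"
      unfolding tS Union_basis using arrow_path_arrow by auto
    fix W assume "W \<in> path_arrow_basis k \<Lambda>"
    from this[unfolded path_arrow_basis_def mem_Collect_eq]
    obtain n U V F where W: "W = cyl k \<Lambda> ((U \<times> V) \<inter> same_src \<Lambda>) n \<inter> (path_arrows k \<Lambda> - cyl k \<Lambda> F n)"
      and UV: "openin (mor_top \<Lambda>) U" "openin (mor_top \<Lambda>) V"
      and F: "F \<subseteq> same_src \<Lambda>" "compactin (prod_topology (mor_top \<Lambda>) (mor_top \<Lambda>)) F"
      by (elim exE conjE)
    show "openin ?S ((\<lambda>x. arrow x m) -` W \<inter> topspace ?S)"
    proof (cases "n = int \<circ> m")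
      case False
      then have "(\<lambda>x. arrow x m) -` W = {}" using W by (auto simp: arrow_def cyl_iff)
      then show ?thesis by simp
    next
      case True
      let ?C = "{l \<in> mors \<Lambda>. m \<le> deg \<Lambda> l \<and> (l, tail l m) \<in> F}"
      let ?U = "U \<inter> {l \<in> mors \<Lambda>. m \<le> deg \<Lambda> l \<and> head l m \<in> mors \<Lambda> \<and> tail l m \<in> V}"
      have U: "openin (mor_top \<Lambda>) ?U" using UV openin_factors[OF m openin_topspace UV(2)] by blast
      have C: "compactin (mor_top \<Lambda>) ?C" using compactin_tail_graph[OF m F(2)] .
      \<comment> \<open>Membership in a cylinder is a condition on an initial segment of unspecified
        degree. The open part is a union over all degrees, but the removed part is a union over the
        finitely many degrees in the compact set \<open>?C\<close>, so \<open>?K\<close> is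
        closed.\<close>
      let ?O = "\<Union>p\<in>tuples k. {x \<in> X. below p (pdeg x) \<and> init x p \<in> ?U}"
      let ?K = "\<Union>p\<in>deg \<Lambda> ` ?C. {x \<in> X. below p (pdeg x) \<and> init x p \<in> ?C}"
      have "openin paths_top ?O" using openin_paths[OF _ U] by blast
      moreover have "closedin paths_top ?K"
        using finite_deg_image[OF C] closedin_paths[OF _ C] by (intro closedin_Union) auto
      ultimately have "openin ?S ({x. below m (pdeg x)} \<inter> (?O - ?K))"
        by (intro openin_subtopology_Int2 openin_diff)
      moreover have "(\<lambda>x. arrow x m) -` W \<inter> topspace ?S = {x. below m (pdeg x)} \<inter> (?O - ?K)"
      proof -
        have "arrow x m \<in> W \<longleftrightarrow> x \<in> ?O - ?K" if x: "x \<in> X" "below m (pdeg x)" for x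
        proof -
          have s: "(init x p, tail (init x p) m) \<in> same_src \<Lambda>" if "below p (pdeg x)" "m \<le> p" for p
            using x that m init_mor[of x p] deg_init[of x p] tail_mor[of "init x p" m] src_tail[of "init x p" m]
            by (simp add: same_src_def)
          have 1: "arrow x m \<in> cyl k \<Lambda> ((U \<times> V) \<inter> same_src \<Lambda>) n \<longleftrightarrow> x \<in> ?O"
            unfolding True arrow_cyl_iff[OF x]
            using s x m by (auto simp: init_mor deg_init head_mor)
          have 2: "arrow x m \<in> cyl k \<Lambda> F n \<longleftrightarrow> x \<in> ?K"
            unfolding True arrow_cyl_iff[OF x]
          proof
            assume "\<exists>n. below n (pdeg x) \<and> m \<le> n \<and> (init x n, tail (init x n) m) \<in> F"
            then obtain n where n: "below n (pdeg x)" "m \<le> n" "(init x n, tail (init x n) m) \<in> F" by blast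
            then have "init x n \<in> ?C" "deg \<Lambda> (init x n) = n" using x by (auto simp: init_mor deg_init)
            then show "x \<in> ?K" using n(1) x(1) by force
          next
            assume "x \<in> ?K"
            then show "\<exists>n. below n (pdeg x) \<and> m \<le> n \<and> (init x n, tail (init x n) m) \<in> F"
              using x by (auto simp: deg_init)
          qed
          show ?thesis unfolding W using 1 2 arrow_path_arrow[OF x] by blast
        qed
        then show ?thesis unfolding tS by blast
      qed
      ultimately show ?thesis by simp
    qed
  qed
  then show ?thesis by (simp add: path_arrow_topology_def)
qed

end

section \<open>The boundary path groupoid\<close>

context topological_kgraph
begin

abbreviation bd :: "('o, 'a) kpath set" where "bd \<equiv> boundary_paths k \<Lambda>"
abbreviation G :: "(('o, 'a) kpath, ('o, 'a) path_arrow) top_groupoid" where "G \<equiv> boundary_path_groupoid k \<Lambda>"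

lemma bd_path: "x \<in> bd \<Longrightarrow> x \<in> X"
  by (simp add: boundary_paths_def)

lemma
  shows obj_top_G: "obj_top G = subtopology paths_top bd"
    and mor_top_G: "mor_top G = subtopology (path_arrow_topology k \<Lambda>) {g. fst g \<in> bd \<and> snd (snd g) \<in> bd}"
    and rng_G [simp]: "rng G g = fst g" and src_G [simp]: "src G g = snd (snd g)"
    and cmp_G [simp]: "cmp G (x, m, y) (y', n, z) = (x, m + n, z)"
  by (simp_all add: boundary_path_groupoid_def reduction_def path_groupoid_def split_beta)

lemma mors_G: "mors G = {g \<in> path_arrows k \<Lambda>. fst g \<in> bd \<and> snd (snd g) \<in> bd}"
  by (auto simp: mor_top_G topspace_arrows)

lemma objs_G: "objs G = bd"
  using bd_path by (auto simp: obj_top_G topspace_paths)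

text \<open>The boundary condition for the shift at \<open>n\<close> is the condition for
  \<open>x\<close> at \<open>m + n\<close>, because both paths have the same object and the same
  segments there.\<close>

lemma shift_bd:
  assumes x: "x \<in> bd" and m: "below m (pdeg x)"
  shows "shift k m x \<in> bd"
proof -
  have xX: "x \<in> X" using x bd_path by blast
  have mk: "m \<in> tuples k" using m by simp
  have "\<exists>l\<in>E. enat \<circ> (n + deg \<Lambda> l) \<le> pdeg (shift k m x) \<and> pmor (shift k m x) (n, n + deg \<Lambda> l) = l"
    if n: "n \<in> tuples k" "enat \<circ> n \<le> pdeg (shift k m x)"
      and E: "E \<in> compact_exhaustive \<Lambda> (pobj (shift k m x) n)" for n E
  proof -
    have bn: "below (m + n) (pdeg x)"
      using below_shift[OF xX m n(1)] n by (simp add: below_def)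
    then have "E \<in> compact_exhaustive \<Lambda> (pobj x (m + n))" using E pobj_shift[OF xX m bn n(1)] by simp
    then obtain l where l: "l \<in> E" "enat \<circ> (m + n + deg \<Lambda> l) \<le> pdeg x" "pmor x (m + n, m + n + deg \<Lambda> l) = l"
      using x bn unfolding boundary_paths_def below_def by blast
    have "l \<in> mors \<Lambda>"
      using E l(1) compactin_subset_topspace unfolding compact_exhaustive_def by blast
    then have d: "n + deg \<Lambda> l \<in> tuples k" using n(1) by simp
    have b: "below (m + (n + deg \<Lambda> l)) (pdeg x)"
      using l(2) d mk unfolding below_def by (simp add: add.assoc)
    have "below (n + deg \<Lambda> l) (pdeg (shift k m x))" using below_shift[OF xX m d] b by simp
    moreover have "pmor (shift k m x) (n, n + deg \<Lambda> l) = l"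
      using pmor_shift[OF xX m b d n(1)] l(3) by (simp add: add.assoc)
    ultimately show ?thesis using l(1) unfolding below_def by blast
  qed
  then show ?thesis using shift_path[OF xX m] unfolding boundary_paths_def by blast
qed

lemma arrow_mor: "x \<in> bd \<Longrightarrow> below m (pdeg x) \<Longrightarrow> arrow x m \<in> mors G"
  using arrow_path_arrow bd_path shift_bd by (simp add: mors_G arrow_def)

lemma continuous_arrow_G:
  assumes "m \<in> tuples k"
  shows "continuous_map (subtopology (obj_top G) {x. below m (pdeg x)}) (mor_top G) (\<lambda>x. arrow x m)"
  unfolding mor_top_G
proof (rule continuous_map_into_subtopology)
  have "subtopology (obj_top G) {x. below m (pdeg x)} = subtopology (subtopology paths_top {x. below m (pdeg x)}) bd"
    by (simp add: obj_top_G subtopology_subtopology Int_commute)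
  then show "continuous_map (subtopology (obj_top G) {x. below m (pdeg x)}) (path_arrow_topology k \<Lambda>) (\<lambda>x. arrow x m)"
    using continuous_map_from_subtopology[OF continuous_arrow[OF assms]] by simp
  show "(\<lambda>x. arrow x m) \<in> topspace (subtopology (obj_top G) {x. below m (pdeg x)}) \<rightarrow>
      {g. fst g \<in> bd \<and> snd (snd g) \<in> bd}"
    using shift_bd by (auto simp: arrow_def objs_G)
qed

lemma pdeg_eqI:
  assumes "M \<in> tuples k" "N \<in> tuples k" "\<And>j. j \<in> tuples k \<Longrightarrow> below j M \<longleftrightarrow> below j N"
  shows "M = N"
proof
  fix i show "M i = N i"
  proof (cases "i < k")
    case True
    have "enat n \<le> M i \<longleftrightarrow> enat n \<le> N i" for n
    proof -
      \<comment> \<open>The tuple with entry \<open>n\<close> at \<open>i\<close> and zeros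
        elsewhere tests the coordinate \<open>i\<close> alone; an infinite entry is recognised by
        passing all the tests.\<close>
      have "(0 :: nat \<Rightarrow> nat)(i := n) \<in> tuples k" using True by (simp add: tuples_def)
      moreover have "enat \<circ> (0 :: nat \<Rightarrow> nat)(i := n) \<le> M' \<longleftrightarrow> enat n \<le> M' i" for M'
        by (auto simp: le_fun_def zero_enat_def[symmetric])
      ultimately show ?thesis using assms(3)[of "0(i := n)"] by (simp add: below_def)
    qed
    moreover have "a \<le> b" if "\<And>n. enat n \<le> a \<Longrightarrow> enat n \<le> b" for a b
    proof (cases a)
      case infinity
      have n: "enat n \<le> b" for n by (rule that) (simp add: infinity)
      have "b = \<infinity>"
      proof (cases b)
        case (enat c)
        then show ?thesis using n[of "Suc c"] by simp
      qed
      then show ?thesis by simp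
    qed (use that in auto)
    ultimately show ?thesis by (intro antisym) blast+
  qed (use assms in \<open>auto simp: tuples_def\<close>)
qed

text \<open>An arrow is determined by the initial segments of its two paths, and by the degrees that are too large for them.\<close>

lemma closedin_arrow:
  assumes "g \<in> path_arrows k \<Lambda>"
  shows "closedin (path_arrow_topology k \<Lambda>) {g}"
proof -
  obtain x m y where g: "g = (x, m, y)" by (cases g)
  from assms[unfolded g path_arrows_iff]
  obtain p q where xy: "x \<in> X" "y \<in> X" and p: "below p (pdeg x)" and q: "below q (pdeg y)"
    and pq: "shift k p x = shift k q y" and m: "m = (int \<circ> p) - (int \<circ> q)" by (elim exE conjE)
  have pk: "p \<in> tuples k" and qk: "q \<in> tuples k" using p q by simp_all
  have mk: "m \<in> tuples k" using pk qk m by simp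
  let ?z = "shift k p x"
  let ?L = "\<lambda>n. {l \<in> mors \<Lambda>. deg \<Lambda> l = n}"
  \<comment> \<open>\<open>?C j\<close> is closed and fixes the segments of degrees
    \<open>p + j\<close> and \<open>q + j\<close>. For \<open>j\<close> outside \<open>?J\<close>,
    the open set \<open>?D j\<close> contains the arrows for which such segments exist and leave
    equal shifts; removing it keeps the degrees from growing.\<close>
  let ?C = "\<lambda>j. cyl k \<Lambda> {(init x (p + j), init y (q + j))} m"
  let ?D = "\<lambda>j. cyl k \<Lambda> ((?L (p + j) \<times> ?L (q + j)) \<inter> same_src \<Lambda>) m"
  let ?J = "{j. below j (pdeg ?z)}"
  let ?D' = "\<Union>j\<in>tuples k - ?J. ?D j"
  have z: "?z \<in> X" "shift k q y \<in> X" using shift_path xy p q by auto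
  have bj: "below (p + j) (pdeg x)" "below (q + j) (pdeg y)" "shift k (p + j) x = shift k (q + j) y"
    if j: "j \<in> ?J" for j
  proof -
    have jk: "j \<in> tuples k" using j by auto
    show 1: "below (p + j) (pdeg x)" using below_shift[OF xy(1) p jk] j by simp
    show 2: "below (q + j) (pdeg y)" using below_shift[OF xy(2) q jk] j pq by simp
    show "shift k (p + j) x = shift k (q + j) y"
      using shift_shift[OF xy(1) 1 pk jk] shift_shift[OF xy(2) 2 qk jk] pq by simp
  qed
  have dm: "(int \<circ> (p + j)) - (int \<circ> (q + j)) = m" for j
    unfolding m by (auto simp: fun_eq_iff)
  have "closedin (path_arrow_topology k \<Lambda>) (?C j)" if j: "j \<in> ?J" for j
  proof (rule closedin_cyl[OF mk])
    show "{(init x (p + j), init y (q + j))} \<subseteq> same_src \<Lambda>"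
      using init_pair_same_src[OF xy bj[OF j]] by simp
    then show "compactin (prod_topology (mor_top \<Lambda>) (mor_top \<Lambda>)) {(init x (p + j), init y (q + j))}"
      using same_src_subset by auto
  qed
  then have "closedin (path_arrow_topology k \<Lambda>) (\<Inter>j\<in>?J. ?C j)"
    by (intro closedin_Inter) (auto intro!: exI[of _ 0])
  moreover have "openin (path_arrow_topology k \<Lambda>) ?D'"
  proof -
    have "openin (path_arrow_topology k \<Lambda>) (?D j)" for j
      using openin_cyl[OF mk openin_deg[of "\<lambda>n. n = p + j"] openin_deg[of "\<lambda>n. n = q + j"]] .
    then show ?thesis by (intro openin_Union) blast
  qed
  ultimately have "closedin (path_arrow_topology k \<Lambda>) ((\<Inter>j\<in>?J. ?C j) - ?D')"
    by (rule closedin_diff)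
  moreover have "(\<Inter>j\<in>?J. ?C j) - ?D' = {g}"
  proof (intro equalityI subsetI)
    fix h assume "h \<in> {g}"
    then have h: "h = (x, m, y)" using g by simp
    have "h \<in> ?C j" if j: "j \<in> ?J" for j
      unfolding h cyl_iff using xy bj[OF j] dm by blast
    moreover have "h \<notin> ?D j" if j: "j \<in> tuples k - ?J" for j
    proof
      assume "h \<in> ?D j"
      from this[unfolded h cyl_iff] obtain p' where p': "below p' (pdeg x)" "init x p' \<in> ?L (p + j)" by blast
      then have "p' = p + j" using deg_init[OF xy(1) p'(1)] by simp
      then show False using p'(1) below_shift[OF xy(1) p, of j] j by blast
    qed
    ultimately show "h \<in> (\<Inter>j\<in>?J. ?C j) - ?D'" by blast
  next
    fix h assume h: "h \<in> (\<Inter>j\<in>?J. ?C j) - ?D'"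
    obtain x' m' y' where h': "h = (x', m', y')" by (cases h)
    have C: "m' = m \<and> x' \<in> X \<and> y' \<in> X \<and> below (p + j) (pdeg x') \<and> below (q + j) (pdeg y') \<and>
        init x' (p + j) = init x (p + j) \<and> init y' (q + j) = init y (q + j) \<and>
        shift k (p + j) x' = shift k (q + j) y'" if j: "j \<in> ?J" for j
    proof -
      have "h \<in> ?C j" using h j by blast
      from this[unfolded h' cyl_iff] obtain p' q' where *: "m' = m" "x' \<in> X" "y' \<in> X"
        "below p' (pdeg x')" "below q' (pdeg y')" "init x' p' = init x (p + j)"
        "init y' q' = init y (q + j)" "shift k p' x' = shift k q' y'" by blast
      have "p' = p + j" using deg_init[OF *(2,4)] deg_init[OF xy(1) bj(1)[OF j]] *(6) by simp
      moreover have "q' = q + j" using deg_init[OF *(3,5)] deg_init[OF xy(2) bj(2)[OF j]] *(7) by simp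
      ultimately show ?thesis using * by simp
    qed
    have "(0 :: nat \<Rightarrow> nat) \<in> ?J" by simp
    from C[OF this] have x': "m' = m" "x' \<in> X" "y' \<in> X" "below p (pdeg x')" "below q (pdeg y')"
        "init x' p = init x p" "init y' q = init y q" "shift k p x' = shift k q y'" by simp_all
    let ?z' = "shift k p x'"
    have z': "?z' \<in> X" using shift_path x' by blast
    \<comment> \<open>The sets \<open>?C j\<close> bound the degree of the common shift from below
      and fix its segments; the removed sets \<open>?D j\<close> bound its degree from
      above.\<close>
    have "?z' = ?z"
    proof (rule path_eqI[OF z' z(1)])
      show "pdeg ?z' = pdeg ?z"
      proof (rule pdeg_eqI)
        fix j :: "nat \<Rightarrow> nat" assume j: "j \<in> tuples k"
        show "below j (pdeg ?z') \<longleftrightarrow> below j (pdeg ?z)"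
        proof
          assume "below j (pdeg ?z)"
          then show "below j (pdeg ?z')" using C[of j] below_shift[OF x'(2,4) j] by simp
        next
          assume bz': "below j (pdeg ?z')"
          have b1: "below (p + j) (pdeg x')" using bz' below_shift[OF x'(2,4) j] by simp
          have b2: "below (q + j) (pdeg y')" using bz' below_shift[OF x'(3,5) j] x'(8) by simp
          have s: "shift k (p + j) x' = shift k (q + j) y'"
            using shift_shift[OF x'(2) b1 pk j] shift_shift[OF x'(3) b2 qk j] x'(8) by simp
          have "(init x' (p + j), init y' (q + j)) \<in> (?L (p + j) \<times> ?L (q + j)) \<inter> same_src \<Lambda>"
            using init_pair_same_src[OF x'(2,3) b1 b2 s] init_mor[OF x'(2) b1] init_mor[OF x'(3) b2]
              deg_init[OF x'(2) b1] deg_init[OF x'(3) b2] by simp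
          then have "h \<in> ?D j" unfolding h' cyl_iff using x' b1 b2 s dm by blast
          then show "below j (pdeg ?z)" using h j by blast
        qed
      qed (use z z' pdeg_tuples in auto)
      fix j assume "below j (pdeg ?z')"
      moreover from this have jk: "j \<in> tuples k" by simp
      ultimately have j: "j \<in> ?J" using \<open>pdeg ?z' = pdeg ?z\<close> by simp
      show "init ?z' j = init ?z j"
        using init_shift_tail[OF x'(2) _ pk jk] init_shift_tail[OF xy(1) bj(1)[OF j] pk jk] C[OF j] by simp
    qed
    then have zz: "shift k p x' = shift k p x" "shift k q y' = shift k q y"
      unfolding x'(8)[symmetric] pq[symmetric] by simp_all
    have "x' = x"
      using prepend_init_shift[OF x'(2,4)] prepend_init_shift[OF xy(1) p] unfolding x'(6) zz by (simp only:)
    moreover have "y' = y"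
      using prepend_init_shift[OF x'(3,5)] prepend_init_shift[OF xy(2) q] unfolding x'(7) zz by (simp only:)
    ultimately have "x' = x" "y' = y" by simp_all
    then show "h \<in> {g}" using h' g x'(1) by simp
  qed
  ultimately show ?thesis by simp
qed

lemma countable_tuples: "countable (tuples k :: (nat \<Rightarrow> nat) set)"
proof -
  have "inj_on (\<lambda>m :: nat \<Rightarrow> nat. map m [0..<k]) (tuples k)"
  proof (rule inj_onI)
    fix m n :: "nat \<Rightarrow> nat" assume mn: "m \<in> tuples k" "n \<in> tuples k" "map m [0..<k] = map n [0..<k]"
    show "m = n"
    proof
      fix i show "m i = n i" using mn by (cases "i < k") (auto simp: tuples_def)
    qed
  qed
  then show ?thesis by (rule countable_image_inj_on[rotated]) simp
qed

text \<open>An arrow with range \<open>x\<close> is recovered from a degree \<open>p\<close> and the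
  prefix \<open>init y q\<close> of its source \<open>y\<close>, since the rest of \<open>y\<close>
  is \<open>shift k p x\<close>. There are countably many \<open>p\<close>, and the prefixes lie in
  a source fibre, which is countable by \<open>countable_src_fibre\<close>.\<close>

lemma countable_fibre: "countable {g \<in> path_arrows k \<Lambda>. fst g = x}"
proof -
  let ?S = "\<lambda>p. {f \<in> mors \<Lambda>. src \<Lambda> f = pobj x p}"
  let ?h = "\<lambda>p l. (x, (int \<circ> p) - (int \<circ> deg \<Lambda> l), prepend k \<Lambda> l (shift k p x))"
  have "{g \<in> path_arrows k \<Lambda>. fst g = x} \<subseteq> (\<Union>p\<in>tuples k. ?h p ` ?S p)"
  proof
    fix g assume g: "g \<in> {g \<in> path_arrows k \<Lambda>. fst g = x}"
    then obtain m y where g': "g = (x, m, y)" by (cases g) auto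
    have "(x, m, y) \<in> path_arrows k \<Lambda>" using g g' by simp
    from this[unfolded path_arrows_iff]
    obtain p q where xy: "x \<in> X" "y \<in> X" and p: "below p (pdeg x)" and q: "below q (pdeg y)"
      and pq: "shift k p x = shift k q y" and m: "m = (int \<circ> p) - (int \<circ> q)" by (elim exE conjE)
    have "src \<Lambda> (init y q) = src \<Lambda> (init x p)"
      using init_pair_same_src[OF xy p q pq] by (simp add: same_src_def)
    then have "init y q \<in> ?S p" using init_mor[OF xy(2) q] src_init[OF xy(1) p] by simp
    moreover have "g = ?h p (init y q)"
      unfolding g' m pq prepend_init_shift[OF xy(2) q] deg_init[OF xy(2) q] ..
    ultimately have "g \<in> ?h p ` ?S p" by (rule rev_image_eqI)
    then show "g \<in> (\<Union>p\<in>tuples k. ?h p ` ?S p)" using below_tuples[OF p] by (rule UN_I[rotated])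
  qed
  moreover have "countable (\<Union>p\<in>tuples k. ?h p ` ?S p)"
    by (intro countable_UN countable_tuples countable_image countable_src_fibre)
  ultimately show ?thesis by (rule countable_subset)
qed

lemma sets_borel_on: "sets (borel_on T) = sigma_sets (topspace T) {U. openin T U}"
  and space_borel_on [simp]: "space (borel_on T) = topspace T"
  unfolding borel_on_def using openin_subset
  by (auto intro!: sets_measure_of space_measure_of)

text \<open>A range fibre is countable and its points are closed, so all its subsets are Borel. This
  settles the measurability questions for measures carried by a fibre.\<close>

lemma fibre_subset_sets:
  assumes "S \<subseteq> mors G" "\<And>g. g \<in> S \<Longrightarrow> fst g = x"
  shows "S \<in> sets (borel_on (mor_top G))"
proof (rule sets.countable)
  have "S \<subseteq> {g \<in> path_arrows k \<Lambda>. fst g = x}" using assms by (auto simp: mors_G)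
  then show "countable S" using countable_fibre countable_subset by blast
  fix g assume g: "g \<in> S"
  then have gm: "g \<in> mors G" using assms by blast
  then have "closedin (path_arrow_topology k \<Lambda>) {g}" using closedin_arrow by (simp add: mors_G)
  moreover have "g \<in> {g. fst g \<in> bd \<and> snd (snd g) \<in> bd}" using gm by (simp add: mors_G)
  ultimately have "closedin (mor_top G) {g}"
    unfolding mor_top_G closedin_subtopology by blast
  then have "openin (mor_top G) (mors G - {g})" by blast
  then have "mors G - {g} \<in> sets (borel_on (mor_top G))"
    unfolding sets_borel_on by (intro sigma_sets.Basic) simp
  then have "space (borel_on (mor_top G)) - (mors G - {g}) \<in> sets (borel_on (mor_top G))"
    by (rule sets.compl_sets)
  moreover have "space (borel_on (mor_top G)) - (mors G - {g}) = {g}" using gm by auto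
  ultimately show "{g} \<in> sets (borel_on (mor_top G))" by simp
qed

text \<open>Local compactness of \<Lambda> puts each arrow of \<open>K\<close> into an open cylinder
  whose prefixes lie in a compact set, and finitely many of these cylinders cover \<open>K\<close>.
  The resulting \<open>C\<close> is the compact set from which the levels are built.\<close>

lemma compact_arrows_segments:
  assumes K: "compactin (mor_top G) K"
  obtains C where "compactin (mor_top \<Lambda>) C"
    "\<And>x m y. (x, m, y) \<in> K \<Longrightarrow> x \<in> bd \<and> y \<in> bd \<and> (\<exists>p q. below p (pdeg x) \<and> below q (pdeg y) \<and>
       init x p \<in> C \<and> init y q \<in> C \<and> shift k p x = shift k q y \<and> m = (int \<circ> p) - (int \<circ> q))"
proof -
  have K': "compactin (path_arrow_topology k \<Lambda>) K" "K \<subseteq> mors G"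
    using K compactin_subset_topspace[OF K] by (auto simp: mor_top_G compactin_subtopology)
  let ?good = "\<lambda>W C. compactin (mor_top \<Lambda>) C \<and> (\<exists>m. W \<subseteq> cyl k \<Lambda> (C \<times> C) m)"
  let ?\<W> = "{W. openin (path_arrow_topology k \<Lambda>) W \<and> (\<exists>C. ?good W C)}"
  have "K \<subseteq> \<Union> ?\<W>"
  proof
    fix g assume "g \<in> K"
    then have "g \<in> path_arrows k \<Lambda>" using K' by (auto simp: mors_G)
    then obtain x m y where g: "g = (x, m, y)" "(x, m, y) \<in> path_arrows k \<Lambda>" by (cases g) auto
    from g(2)[unfolded path_arrows_iff]
    obtain p q where xy: "x \<in> X" "y \<in> X" and p: "below p (pdeg x)" and q: "below q (pdeg y)"
      and pq: "shift k p x = shift k q y" and m: "m = (int \<circ> p) - (int \<circ> q)" by (elim exE conjE)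
    have mk: "m \<in> tuples k" using m p q by simp
    have lc: "\<exists>U C. openin (mor_top \<Lambda>) U \<and> compactin (mor_top \<Lambda>) C \<and> l \<in> U \<and> U \<subseteq> C" if "l \<in> mors \<Lambda>" for l
      using locally_compact_mor that unfolding locally_compact_space_def by blast
    obtain U C where U: "openin (mor_top \<Lambda>) U" "compactin (mor_top \<Lambda>) C" "init x p \<in> U" "U \<subseteq> C"
      using lc[OF init_mor[OF xy(1) p]] by blast
    obtain V D where V: "openin (mor_top \<Lambda>) V" "compactin (mor_top \<Lambda>) D" "init y q \<in> V" "V \<subseteq> D"
      using lc[OF init_mor[OF xy(2) q]] by blast
    let ?W = "cyl k \<Lambda> ((U \<times> V) \<inter> same_src \<Lambda>) m"
    have "g \<in> ?W"
      unfolding g(1) cyl_iff using xy p q pq m U(3) V(3) init_pair_same_src[OF xy p q pq] by blast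
    moreover have "openin (path_arrow_topology k \<Lambda>) ?W" using openin_cyl[OF mk U(1) V(1)] .
    moreover have "?good ?W (C \<union> D)"
      using compactin_Un[OF U(2) V(2)] U(4) V(4) by (auto simp: cyl_def intro!: exI[of _ m]) blast
    ultimately show "g \<in> \<Union> ?\<W>" by blast
  qed
  then obtain \<F> where F: "finite \<F>" "\<F> \<subseteq> ?\<W>" "K \<subseteq> \<Union> \<F>"
    using K'(1) unfolding compactin_def by (metis (no_types, lifting) mem_Collect_eq)
  then have "\<forall>W\<in>\<F>. \<exists>C. ?good W C" by blast
  from bchoice[OF this] obtain c where c: "\<And>W. W \<in> \<F> \<Longrightarrow> ?good W (c W)" by blast
  show thesis
  proof
    show "compactin (mor_top \<Lambda>) (\<Union>W\<in>\<F>. c W)" using F(1) c by (intro compactin_Union) auto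
    fix x m y assume xmy: "(x, m, y) \<in> K"
    then obtain W where W: "W \<in> \<F>" "(x, m, y) \<in> W" using F(3) by blast
    then obtain n where "(x, m, y) \<in> cyl k \<Lambda> (c W \<times> c W) n" using c by blast
    from this[unfolded cyl_iff] obtain p q where "below p (pdeg x)" "below q (pdeg y)"
       "(init x p, init y q) \<in> c W \<times> c W" "shift k p x = shift k q y" "m = (int \<circ> p) - (int \<circ> q)" by blast
    moreover have "x \<in> bd" "y \<in> bd" using xmy K'(2) by (auto simp: mors_G)
    ultimately show "x \<in> bd \<and> y \<in> bd \<and> (\<exists>p q. below p (pdeg x) \<and> below q (pdeg y) \<and>
       init x p \<in> (\<Union>W\<in>\<F>. c W) \<and> init y q \<in> (\<Union>W\<in>\<F>. c W) \<and> shift k p x = shift k q y \<and> m = (int \<circ> p) - (int \<circ> q))"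
      using W(1) by blast
  qed
qed

end

section \<open>Reachable initial segments\<close>

lemma finite_tuples_le: "i \<in> tuples k \<Longrightarrow> finite {m. m \<le> i}" for i :: "nat \<Rightarrow> nat"
proof -
  assume i: "i \<in> tuples k"
  have "{m. m \<le> i} \<subseteq> PiE_dflt {..<k} 0 (\<lambda>j. {..i j})"
    using i by (auto simp: PiE_dflt_def tuples_def le_fun_def) (metis le_zero_eq not_le)
  moreover have "finite (PiE_dflt {..<k} 0 (\<lambda>j. {..i j}))" by (intro finite_PiE_dflt) auto
  ultimately show ?thesis by (rule finite_subset)
qed

text \<open>The supremum of \<open>q\<close> and a random subset of the list, to which \<open>m\<close> belongs with probability \<open>v m\<close>.\<close>

primrec random_sup :: "((nat \<Rightarrow> nat) \<Rightarrow> real) \<Rightarrow> (nat \<Rightarrow> nat) list \<Rightarrow> (nat \<Rightarrow> nat) \<Rightarrow> (nat \<Rightarrow> nat) pmf" where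
  "random_sup v [] q = return_pmf q"
| "random_sup v (m # ms) q = bernoulli_pmf (v m) \<bind> (\<lambda>b. random_sup v ms (if b then sup q m else q))"

lemma set_pmf_bernoulli_iff:
  assumes "0 \<le> p" "p \<le> 1"
  shows "b \<in> set_pmf (bernoulli_pmf p) \<longleftrightarrow> (if b then p \<noteq> 0 else p \<noteq> 1)"
  using assms by (cases b) (auto simp: set_pmf_iff)

text \<open>Only entries of nonzero probability are ever joined. It is applied to invariants
  preserved by suprema, namely upper bounds and \<open>below\<close>.\<close>

lemma random_sup_induct:
  assumes "r \<in> set_pmf (random_sup v ms q)" "\<And>m. m \<in> set ms \<Longrightarrow> 0 \<le> v m \<and> v m \<le> 1"
    "P q" "\<And>a m. P a \<Longrightarrow> m \<in> set ms \<Longrightarrow> v m \<noteq> 0 \<Longrightarrow> P (sup a m)"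
  shows "P r"
  using assms
proof (induction ms arbitrary: q)
  case (Cons m ms)
  obtain b where b: "b \<in> set_pmf (bernoulli_pmf (v m))"
    "r \<in> set_pmf (random_sup v ms (if b then sup q m else q))" using Cons.prems(1) by auto
  have v: "0 \<le> v m" "v m \<le> 1" using Cons.prems(2)[of m] by auto
  have "P (if b then sup q m else q)"
  proof (cases b)
    case True
    then have "v m \<noteq> 0" using b(1) set_pmf_bernoulli_iff[OF v, of b] by simp
    then have "P (sup q m)" by (intro Cons.prems(3,4)) auto
    then show ?thesis using True by (simp only: if_True)
  qed (use Cons.prems(3) in simp)
  from Cons.IH[OF b(2) _ this] show ?case using Cons.prems(2,4) by simp
qed simp

text \<open>An entry of probability one is always selected, and the accumulated supremum never
  decreases.\<close>

lemma random_sup_ge: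
  assumes "r \<in> set_pmf (random_sup v ms q)" "\<And>m. m \<in> set ms \<Longrightarrow> 0 \<le> v m \<and> v m \<le> 1"
  shows "q \<le> r" "\<And>m. m \<in> set ms \<Longrightarrow> v m = 1 \<Longrightarrow> m \<le> r"
proof -
  have "q \<le> r \<and> (\<forall>m\<in>set ms. v m = 1 \<longrightarrow> m \<le> r)"
    using assms
  proof (induction ms arbitrary: q)
    case (Cons m ms)
    obtain b where b: "b \<in> set_pmf (bernoulli_pmf (v m))"
      "r \<in> set_pmf (random_sup v ms (if b then sup q m else q))" using Cons.prems(1) by auto
    have v: "0 \<le> v m" "v m \<le> 1" using Cons.prems(2)[of m] by auto
    have "(if b then sup q m else q) \<le> r \<and> (\<forall>m\<in>set ms. v m = 1 \<longrightarrow> m \<le> r)"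
      using Cons.IH[OF b(2)] Cons.prems(2) by simp
    moreover have "b" if "v m = 1" using b(1) set_pmf_bernoulli_iff[OF v] that by (cases b) auto
    ultimately show ?case by (cases b) auto
  qed simp
  then show "q \<le> r" "\<And>m. m \<in> set ms \<Longrightarrow> v m = 1 \<Longrightarrow> m \<le> r" by auto
qed

lemma pmf_random_sup_Cons:
  assumes "0 \<le> v m" "v m \<le> 1"
  shows "pmf (random_sup v (m # ms) q) r =
     v m * pmf (random_sup v ms (sup q m)) r + (1 - v m) * pmf (random_sup v ms q) r"
  using assms by (simp add: pmf_bind mult.commute)

text \<open>Conditioning on the first entry, as in \<open>pmf_random_sup_Cons\<close>, shows by
  induction that each probability is a polynomial in the finitely many values
  \<open>v x m\<close>.\<close>

lemma continuous_map_pmf_random_sup: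
  assumes "\<And>m. m \<in> set ms \<Longrightarrow> continuous_map T euclideanreal (\<lambda>x. v x m)"
    "\<And>x m. m \<in> set ms \<Longrightarrow> 0 \<le> v x m \<and> v x m \<le> 1"
  shows "continuous_map T euclideanreal (\<lambda>x. pmf (random_sup (v x) ms q) r)"
  using assms
proof (induction ms arbitrary: q)
  case (Cons m ms)
  have "(\<lambda>x. pmf (random_sup (v x) (m # ms) q) r) = (\<lambda>x. v x m * pmf (random_sup (v x) ms (sup q m)) r +
      (1 - v x m) * pmf (random_sup (v x) ms q) r)"
    using Cons.prems(2) by (intro ext pmf_random_sup_Cons) auto
  moreover have "continuous_map T euclideanreal \<dots>"
    using Cons by (intro continuous_map_add continuous_map_real_mult continuous_map_diff) auto
  ultimately show ?case by simp
qed (simp only: random_sup.simps continuous_map_const, simp)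

text \<open>Passing from \<open>L\<close> to \<open>L + 1\<close> raises
  \<open>f L + f (L + 1) + f (L + 2)\<close> by \<open>f (L + 3) - f L\<close>. So this sum bounds
  the number of jumps, and it is at most \<open>3 * B\<close>. The step 3 is the number of levels
  spent in \<open>stop_eq_return\<close>.\<close>

lemma card_jumps_le:
  fixes f :: "nat \<Rightarrow> nat"
  assumes "mono f" "\<And>n. f n \<le> B"
  shows "card {n. n < L \<and> f n \<noteq> f (n + 3)} \<le> 3 * B"
proof -
  have "card {n. n < L \<and> f n \<noteq> f (n + 3)} \<le> f L + f (L + 1) + f (L + 2)"
  proof (induction L)
    case (Suc L)
    let ?S = "\<lambda>L. {n. n < L \<and> f n \<noteq> f (n + 3)}"
    show ?case
    proof (cases "f L = f (L + 3)")
      case True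
      then have "?S (Suc L) = ?S L" by (auto simp: less_Suc_eq)
      then show ?thesis using Suc True by (simp add: eval_nat_numeral)
    next
      case False
      have "?S (Suc L) \<subseteq> insert L (?S L)" by (auto simp: less_Suc_eq)
      then have "card (?S (Suc L)) \<le> card (insert L (?S L))" by (intro card_mono) auto
      also have "\<dots> \<le> Suc (card (?S L))" by (rule card_insert_le_m1) auto
      finally have "card (?S (Suc L)) \<le> Suc (card (?S L))" .
      moreover have "f L < f (L + 3)" using False monoD[OF assms(1), of L "L + 3"] by simp
      ultimately show ?thesis using Suc by (simp add: eval_nat_numeral)
    qed
  qed simp
  then show ?thesis using assms(2)[of L] assms(2)[of "L + 1"] assms(2)[of "L + 2"] by linarith
qed

section \<open>Suprema of the degrees reached within a given set\<close>

context topological_kgraph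
begin

text \<open>For the level \<open>C\<^sub>n\<close> this is \<open>q\<^sub>n(x, i)\<close> of the
  overview. Inserting \<open>0\<close>, the least degree, makes the set nonempty, as
  \<open>Sup_fin\<close> requires.\<close>

definition reach :: "'a set \<Rightarrow> ('o, 'a) kpath \<Rightarrow> (nat \<Rightarrow> nat) \<Rightarrow> nat \<Rightarrow> nat" where
  "reach C x i = Sup_fin (insert 0 {m. m \<le> i \<and> below m (pdeg x) \<and> init x m \<in> C})"

lemma finite_reach_set: "i \<in> tuples k \<Longrightarrow> finite (insert 0 {m. m \<le> i \<and> below m (pdeg x) \<and> init x m \<in> C})"
  using finite_subset[OF _ finite_tuples_le[of i k]] by (simp add: Collect_conj_eq)

lemma reach_upper:
  assumes "i \<in> tuples k" "m \<le> i" "below m (pdeg x)" "init x m \<in> C"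
  shows "m \<le> reach C x i"
  unfolding reach_def using assms by (intro Sup_fin.coboundedI finite_reach_set) auto

lemma reach_least:
  assumes "i \<in> tuples k" "\<And>m. m \<le> i \<Longrightarrow> below m (pdeg x) \<Longrightarrow> init x m \<in> C \<Longrightarrow> m \<le> b"
  shows "reach C x i \<le> b"
  unfolding reach_def using assms by (intro Sup_fin.boundedI finite_reach_set) auto

lemma reach_le: "i \<in> tuples k \<Longrightarrow> reach C x i \<le> i"
  by (rule reach_least) auto

lemma reach_mono: "i \<in> tuples k \<Longrightarrow> C \<subseteq> D \<Longrightarrow> reach C x i \<le> reach D x i"
  by (rule reach_least) (auto intro: reach_upper)

text \<open>If the segment of the shift of degree \<open>m\<close> lies in \<open>C\<close>, then
  the segment of \<open>x\<close> of degree \<open>p + m\<close> is its product with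
  \<open>init x p\<close> and lies in \<open>D\<close>.\<close>

lemma add_reach_le:
  assumes x: "x \<in> X" and p: "below p (pdeg x)" and i: "i \<in> tuples k"
    and D: "init x p \<in> D" "\<And>g. g \<in> C \<Longrightarrow> (init x p, g) \<in> composable \<Lambda> \<Longrightarrow> init x p \<cdot> g \<in> D"
  shows "p + reach C (shift k p x) i \<le> reach D x (p + i)"
proof -
  have pk: "p \<in> tuples k" using p by simp
  have pi: "p + i \<in> tuples k" using pk i by simp
  \<comment> \<open>\<open>p\<close> itself is reached within \<open>D\<close>; this makes the
    subtraction of \<open>p\<close> below exact.\<close>
  have pR: "p \<le> reach D x (p + i)" by (rule reach_upper[OF pi]) (use p D in auto)
  have "reach C (shift k p x) i \<le> reach D x (p + i) - p"
  proof (rule reach_least[OF i])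
    fix m assume m: "m \<le> i" "below m (pdeg (shift k p x))" "init (shift k p x) m \<in> C"
    have mk: "m \<in> tuples k" using m by simp
    have b: "below (p + m) (pdeg x)" using m below_shift[OF x p mk] by simp
    have "head (init x (p + m)) p = init x p" "tail (init x (p + m)) p = init (shift k p x) m"
      using head_init[OF x b pk] init_shift_tail[OF x b pk mk] by auto
    then have "(init x p, init (shift k p x) m) \<in> composable \<Lambda>"
      "init x p \<cdot> init (shift k p x) m = init x (p + m)"
      using head_tail_composable[of "init x (p + m)" p] head_cmp_tail[of "init x (p + m)" p]
        init_mor[OF x b] deg_init[OF x b] pk by auto
    then have "init x (p + m) \<in> D" using D(2)[OF m(3)] by simp
    then have "p + m \<le> reach D x (p + i)" by (intro reach_upper[OF pi _ b]) (use m in auto)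
    then show "m \<le> reach D x (p + i) - p" unfolding le_fun_def by (auto simp: le_diff_conv2 add.commute)
       (metis add.commute le_diff_conv2 le_add1 order_trans add_leD1)
  qed
  then show ?thesis using pR unfolding le_fun_def by (simp add: le_diff_conv2 add.commute)
qed

text \<open>Suppose \<open>x\<close> reaches \<open>m\<close> within \<open>C\<close>. Its segment
  of degree \<open>sup m p\<close> is a minimal common extension of \<open>init x p\<close> and
  \<open>init x m\<close>, so the tail of that segment at \<open>p\<close>, which is a segment of
  the shift, lies in \<open>D\<close>. Hence even \<open>sup m p\<close> obeys the bound.\<close>

lemma reach_le_add:
  assumes x: "x \<in> X" and p: "below p (pdeg x)" and i: "i \<in> tuples k"
    and D: "\<And>\<mu>. \<mu> \<in> C \<Longrightarrow> fst ` min_ext \<Lambda> (init x p) \<mu> \<subseteq> D"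
  shows "reach C x (p + i) \<le> p + reach D (shift k p x) i"
proof -
  have pk: "p \<in> tuples k" using p by simp
  show ?thesis
  proof (rule reach_least)
    fix m assume m: "m \<le> p + i" "below m (pdeg x)" "init x m \<in> C"
    have mk: "m \<in> tuples k" using m by simp
    let ?s = "sup m p" let ?t = "sup m p - p"
    have s: "below ?s (pdeg x)" using below_sup[OF m(2) p] .
    have t: "p + ?t = ?s" "?t \<in> tuples k" using mk pk by (auto simp: tuple_add_diff)
    have ti: "?t \<le> i" using m(1) by (auto simp: le_fun_def sup_max max_def le_diff_conv add.commute)
    note S = init_mor[OF x s] deg_init[OF x s]
    have "(tail (init x ?s) p, tail (init x ?s) m) \<in> min_ext \<Lambda> (init x p) (init x m)"
      using head_tail_composable[of "init x ?s" p] head_tail_composable[of "init x ?s" m]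
        head_cmp_tail[of "init x ?s" p] head_cmp_tail[of "init x ?s" m] head_init[OF x s pk] head_init[OF x s mk]
        S pk mk deg_init[OF x p] deg_init[OF x m(2)]
      by (simp add: min_ext_def sup_commute)
    then have "tail (init x ?s) p \<in> D" using D[OF m(3)] by force
    then have "init (shift k p x) ?t \<in> D" using init_shift_tail[OF x _ pk t(2)] t(1) s by simp
    moreover have "below ?t (pdeg (shift k p x))" using below_shift[OF x p t(2)] t(1) s by simp
    ultimately have "?t \<le> reach D (shift k p x) i" by (intro reach_upper[OF i ti])
    then have "p + ?t \<le> p + reach D (shift k p x) i" by simp
    then show "m \<le> p + reach D (shift k p x) i" unfolding t(1) by simp
  qed (use pk i in simp)
qed

end

context compactly_aligned_kgraph
begin

text \<open>One construction is iterated: adjoin to \<open>C n\<close> its products with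
  \<open>K\<close> and the complements provided by \<open>aligned\<close>, which keeps it compact,
  and enlarge the result so that a bump function fits in between.\<close>

lemma levels:
  assumes K: "compactin (mor_top \<Lambda>) K"
  obtains C :: "nat \<Rightarrow> 'a set" and \<phi> :: "nat \<Rightarrow> 'a \<Rightarrow> real" where
    "\<And>n. compactin (mor_top \<Lambda>) (C n)" "\<And>n. K \<subseteq> C n" "\<And>n. C n \<subseteq> C (Suc n)"
    "\<And>n. continuous_map (mor_top \<Lambda>) euclideanreal (\<phi> n)"
    "\<And>n f. f \<in> mors \<Lambda> \<Longrightarrow> 0 \<le> \<phi> n f \<and> \<phi> n f \<le> 1"
    "\<And>n f. f \<in> C n \<Longrightarrow> \<phi> n f = 1" "\<And>n f. f \<in> mors \<Lambda> \<Longrightarrow> f \<notin> C (Suc n) \<Longrightarrow> \<phi> n f = 0"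
    "\<And>n f g. f \<in> K \<Longrightarrow> g \<in> C n \<Longrightarrow> (f, g) \<in> composable \<Lambda> \<Longrightarrow> f \<cdot> g \<in> C (Suc n)"
    "\<And>n l \<mu>. l \<in> K \<Longrightarrow> \<mu> \<in> C n \<Longrightarrow> fst ` min_ext \<Lambda> l \<mu> \<subseteq> C (Suc n)"
proof -
  let ?P = "\<lambda>C D \<phi>. compactin (mor_top \<Lambda>) D \<and> C \<subseteq> D \<and> continuous_map (mor_top \<Lambda>) euclideanreal \<phi> \<and>
     (\<forall>f\<in>mors \<Lambda>. 0 \<le> \<phi> f \<and> \<phi> f \<le> (1::real)) \<and> (\<forall>f\<in>C. \<phi> f = 1) \<and> (\<forall>f\<in>mors \<Lambda> - D. \<phi> f = 0) \<and>
     (\<forall>f\<in>K. \<forall>g\<in>C. (f, g) \<in> composable \<Lambda> \<longrightarrow> f \<cdot> g \<in> D) \<and> (\<forall>l\<in>K. \<forall>\<mu>\<in>C. fst ` min_ext \<Lambda> l \<mu> \<subseteq> D)"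
  have step: "\<exists>p. ?P C (fst p) (snd p)" if C: "compactin (mor_top \<Lambda>) C" for C
  proof -
    obtain E where E: "compactin (mor_top \<Lambda>) E" "\<forall>l\<in>K. \<forall>\<mu>\<in>C. fst ` min_ext \<Lambda> l \<mu> \<subseteq> E"
      using aligned[OF K C] by blast
    let ?C = "C \<union> (\<lambda>(f, g). f \<cdot> g) ` (composable \<Lambda> \<inter> K \<times> C) \<union> E"
    have "compactin (mor_top \<Lambda>) ?C"
      by (intro compactin_Un C E(1) compactin_cmp K)
    from compactin_bump[OF this] obtain \<phi> D where
      D: "continuous_map (mor_top \<Lambda>) euclideanreal \<phi>" "\<And>f. f \<in> mors \<Lambda> \<Longrightarrow> 0 \<le> \<phi> f \<and> \<phi> f \<le> 1"
      "\<And>f. f \<in> ?C \<Longrightarrow> \<phi> f = 1" "compactin (mor_top \<Lambda>) D" "?C \<subseteq> D"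
      "\<And>f. f \<in> mors \<Lambda> \<Longrightarrow> f \<notin> D \<Longrightarrow> \<phi> f = 0" by blast
    have "f \<cdot> g \<in> D" if "f \<in> K" "g \<in> C" "(f, g) \<in> composable \<Lambda>" for f g
      using that D(5) by auto
    moreover have "fst ` min_ext \<Lambda> l \<mu> \<subseteq> D" if "l \<in> K" "\<mu> \<in> C" for l \<mu>
      using that E(2) D(5) by blast
    ultimately have "?P C D \<phi>" using D by auto
    then show ?thesis by (intro exI[of _ "(D, \<phi>)"]) simp
  qed
  \<comment> \<open>The choice function is defined on all sets and constrained only on compact ones,
    so that it can be iterated; compactness of the iterates follows by induction.\<close>
  have "\<forall>C. \<exists>p. compactin (mor_top \<Lambda>) C \<longrightarrow> ?P C (fst p) (snd p)"
  proof
    fix C show "\<exists>p. compactin (mor_top \<Lambda>) C \<longrightarrow> ?P C (fst p) (snd p)"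
    proof (cases "compactin (mor_top \<Lambda>) C")
      case True
      from step[OF this] show ?thesis by (elim exE) (intro exI impI, assumption)
    qed (intro exI impI, erule notE)
  qed
  from choice[OF this] obtain s where
    "\<forall>C. compactin (mor_top \<Lambda>) C \<longrightarrow> ?P C (fst (s C)) (snd (s C))" by (elim exE)
  then have s: "?P C (fst (s C)) (snd (s C))" if "compactin (mor_top \<Lambda>) C" for C
    using that by (elim allE[of _ C] impE)
  define C where "C = rec_nat K (\<lambda>_ C. fst (s C))"
  have C0: "C 0 = K" and CS: "C (Suc n) = fst (s (C n))" for n by (simp_all add: C_def)
  have cC: "compactin (mor_top \<Lambda>) (C n)" for n
    by (induction n) (use K s C0 CS in auto)
  note sC = s[OF cC, folded CS]
  have sub: "C n \<subseteq> C (Suc n)" for n using sC[of n] by blast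
  have KC: "K \<subseteq> C n" for n
    by (induction n) (use C0 sub in auto)
  show thesis
  proof (rule that[of C "\<lambda>n. snd (s (C n))"])
    fix n
    show "compactin (mor_top \<Lambda>) (C n)" by (rule cC)
    show "K \<subseteq> C n" by (rule KC)
    show "C n \<subseteq> C (Suc n)" by (rule sub)
    note S = sC[of n]
    show "continuous_map (mor_top \<Lambda>) euclideanreal (snd (s (C n)))" using S by (elim conjE)
    show "0 \<le> snd (s (C n)) f \<and> snd (s (C n)) f \<le> 1" if "f \<in> mors \<Lambda>" for f using S that by blast
    show "snd (s (C n)) f = 1" if "f \<in> C n" for f using S that by blast
    show "snd (s (C n)) f = 0" if "f \<in> mors \<Lambda>" "f \<notin> C (Suc n)" for f using S that by blast
    show "f \<cdot> g \<in> C (Suc n)" if "f \<in> K" "g \<in> C n" "(f, g) \<in> composable \<Lambda>" for f g using S that by blast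
    show "fst ` min_ext \<Lambda> l \<mu> \<subseteq> C (Suc n)" if "l \<in> K" "\<mu> \<in> C n" for l \<mu> using S that by blast
  qed
qed

end

section \<open>Finitely supported measures\<close>

text \<open>A \<open>pmf\<close> measures all subsets of the type, whereas
  \<open>continuous_mean\<close> asks for a Borel measure on \<open>topspace T\<close>; so both the
  space and the \<sigma>-algebra are cut down.\<close>

definition pmf_measure :: "'g topology \<Rightarrow> 'g pmf \<Rightarrow> 'g measure" where
  "pmf_measure T p = distr (restrict_space (measure_pmf p) (topspace T)) (borel_on T) (\<lambda>g. g)"

lemma
  shows space_pmf_measure [simp]: "space (pmf_measure T p) = topspace T"
    and sets_pmf_measure [simp]: "sets (pmf_measure T p) = sets (borel_on T)"
  by (simp_all add: pmf_measure_def borel_on_def space_measure_of_conv)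

lemma measurable_restrict_pmf:
  "f ` topspace T \<subseteq> space N \<Longrightarrow> f \<in> measurable (restrict_space (measure_pmf p) (topspace T)) N"
  by (intro measurableI) (auto simp: space_restrict_space sets_restrict_space)

lemma sets_borel_on_subset: "A \<in> sets (borel_on T) \<Longrightarrow> A \<subseteq> topspace T"
  using sets.sets_into_space[of A "borel_on T"] by (simp add: borel_on_def space_measure_of_conv)

lemma emeasure_pmf_measure:
  assumes A: "A \<in> sets (borel_on T)"
  shows "emeasure (pmf_measure T p) A = emeasure (measure_pmf p) A"
proof -
  have "A \<subseteq> topspace T" using A by (rule sets_borel_on_subset)
  moreover have "(\<lambda>g. g) \<in> measurable (restrict_space (measure_pmf p) (topspace T)) (borel_on T)"
    by (rule measurable_restrict_pmf) (simp add: borel_on_def space_measure_of_conv)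
  ultimately show ?thesis
    unfolding pmf_measure_def using A
    by (simp add: emeasure_distr emeasure_restrict_space space_restrict_space Int_absorb2)
qed

lemma measure_pmf_measure: "A \<in> sets (borel_on T) \<Longrightarrow> measure (pmf_measure T p) A = measure (measure_pmf p) A"
  by (simp add: measure_def emeasure_pmf_measure)

lemma prob_space_pmf_measure:
  assumes "set_pmf p \<subseteq> topspace T" shows "prob_space (pmf_measure T p)"
proof
  have "topspace T \<in> sets (borel_on T)"
    using sets.top[of "pmf_measure T p"] by simp
  then have "emeasure (pmf_measure T p) (topspace T) = emeasure (measure_pmf p) (topspace T)"
    by (rule emeasure_pmf_measure)
  also have "\<dots> = emeasure (measure_pmf p) (set_pmf p)"
    using assms by (intro emeasure_eq_AE) (auto simp: AE_measure_pmf_iff)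
  finally show "emeasure (pmf_measure T p) (space (pmf_measure T p)) = 1"
    by (simp add: emeasure_pmf)
qed

lemma AE_pmf_measure:
  assumes A: "A \<in> sets (borel_on T)" "set_pmf p \<subseteq> A" "\<And>g. g \<in> A \<Longrightarrow> P g"
  shows "AE g in pmf_measure T p. P g"
proof (rule AE_I)
  let ?N = "topspace T - A"
  have N: "?N \<in> sets (borel_on T)" using sets.compl_sets[of A "pmf_measure T p"] A by simp
  then show "?N \<in> sets (pmf_measure T p)" by simp
  have "set_pmf p \<inter> ?N = {}" using A by auto
  then have "measure (measure_pmf p) ?N = 0" by (simp add: measure_pmf_zero_iff)
  then show "emeasure (pmf_measure T p) ?N = 0"
    by (simp add: emeasure_pmf_measure[OF N] measure_pmf.emeasure_eq_measure)
  show "{x \<in> space (pmf_measure T p). \<not> P x} \<subseteq> ?N" using A(3) by auto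
qed

lemma continuous_map_borel_measurable:
  fixes f :: "'g \<Rightarrow> 'b::topological_space"
  assumes "continuous_map T euclidean f"
  shows "f \<in> borel_measurable (borel_on T)"
proof (rule borel_measurableI)
  fix S :: "'b set" assume "open S"
  then have "openin T {x \<in> topspace T. f x \<in> S}"
    using assms by (auto simp: continuous_map_def)
  moreover have "f -` S \<inter> space (borel_on T) = {x \<in> topspace T. f x \<in> S}"
    by (auto simp: borel_on_def space_measure_of_conv)
  ultimately show "f -` S \<inter> space (borel_on T) \<in> sets (borel_on T)"
    using openin_subset by (auto simp: borel_on_def sets_measure_of_conv)
qed

lemma integral_pmf_measure:
  fixes f :: "'g \<Rightarrow> complex"
  assumes f: "continuous_map T euclidean f" and p: "set_pmf p \<subseteq> topspace T"
  shows "(\<integral>g. f g \<partial>pmf_measure T p) = (\<integral>g. f g \<partial>measure_pmf p)"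
proof -
  have id: "(\<lambda>g. g) \<in> measurable (restrict_space (measure_pmf p) (topspace T)) (borel_on T)"
    by (rule measurable_restrict_pmf) (simp add: borel_on_def space_measure_of_conv)
  have "(\<integral>g. f g \<partial>pmf_measure T p) = (\<integral>g. f g \<partial>restrict_space (measure_pmf p) (topspace T))"
    unfolding pmf_measure_def using integral_distr[OF id continuous_map_borel_measurable[OF f]] by simp
  also have "\<dots> = (\<integral>g. indicator (topspace T) g *\<^sub>R f g \<partial>measure_pmf p)"
    by (intro integral_restrict_space) simp
  also have "\<dots> = (\<integral>g. f g \<partial>measure_pmf p)"
    using p by (intro integral_cong_AE) (auto simp: AE_measure_pmf_iff)
  finally show ?thesis .
qed

lemma prob_bind_pmf_of_set:
  assumes J: "finite J" "J \<noteq> {}"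
  shows "measure_pmf.prob (pmf_of_set J \<bind> F) A = (\<Sum>j\<in>J. measure_pmf.prob (F j) A) / card J"
proof -
  have "ennreal (measure_pmf.prob (pmf_of_set J \<bind> F) A) = (\<Sum>j\<in>J. emeasure (F j) A) / card J"
    using J by (simp add: measure_pmf.emeasure_eq_measure[symmetric] nn_integral_pmf_of_set)
  also have "\<dots> = ennreal ((\<Sum>j\<in>J. measure_pmf.prob (F j) A) / card J)"
    using J by (simp add: measure_pmf.emeasure_eq_measure sum_ennreal divide_ennreal sum_nonneg
        card_gt_0_iff ennreal_of_nat_eq_real_of_nat)
  finally show ?thesis by (simp add: sum_nonneg)
qed

text \<open>For \<open>s\<close> in \<open>S\<close> the component \<open>u s\<close> of the first
  mixture cancels against \<open>v s\<close> of the second. What is left over has weight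
  \<open>1 - card S / card J\<close> in each mixture, whence the factor 2.\<close>

lemma tv_dist_mixture_le:
  assumes J: "finite J" "J \<noteq> {}" and u: "inj_on u S" "u ` S \<subseteq> J" and v: "inj_on v S" "v ` S \<subseteq> J"
    and eq: "\<And>s. s \<in> S \<Longrightarrow> F (u s) = F' (v s)"
  shows "tv_dist (pmf_measure T (pmf_of_set J \<bind> F)) (pmf_measure T (pmf_of_set J \<bind> F'))
      \<le> 2 * (1 - card S / card J)"
proof -
  let ?\<mu> = "pmf_measure T (pmf_of_set J \<bind> F)" and ?\<nu> = "pmf_measure T (pmf_of_set J \<bind> F')"
  have fin: "finite (J - u ` S)" "finite (J - v ` S)" using J by auto
  have card: "real (card (J - u ` S)) = card J - real (card S)" "real (card (J - v ` S)) = card J - real (card S)"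
    using J u v card_mono[of J "u ` S"] card_mono[of J "v ` S"]
    by (simp_all add: card_Diff_subset finite_subset card_image of_nat_diff)
  have J0: "real (card J) > 0" using J by (simp add: card_gt_0_iff)
  have split: "(\<Sum>j\<in>J. g j) = (\<Sum>s\<in>S. g (w s)) + (\<Sum>j\<in>J - w ` S. g j)"
    if "inj_on w S" "w ` S \<subseteq> J" for w and g :: "_ \<Rightarrow> real"
    using sum.subset_diff[OF that(2) J(1), of g] sum.reindex[OF that(1), of g] by simp
  have le: "(\<Sum>A\<in>P. \<bar>measure ?\<mu> A - measure ?\<nu> A\<bar>) \<le> 2 * (1 - card S / card J)"
    if P: "finite P" "disjoint P" "P \<subseteq> sets ?\<mu>" for P
  proof -
    let ?f = "\<lambda>A j. measure_pmf.prob (F j) A" and ?f' = "\<lambda>A j. measure_pmf.prob (F' j) A"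
    have "\<bar>measure ?\<mu> A - measure ?\<nu> A\<bar> \<le> ((\<Sum>j\<in>J - u ` S. ?f A j) + (\<Sum>j\<in>J - v ` S. ?f' A j)) / card J"
      if "A \<in> P" for A
    proof -
      have A: "A \<in> sets (borel_on T)" using that P(3) by auto
      have "(\<Sum>s\<in>S. ?f A (u s)) = (\<Sum>s\<in>S. ?f' A (v s))" using eq by (intro sum.cong) auto
      then have "measure ?\<mu> A - measure ?\<nu> A = ((\<Sum>j\<in>J - u ` S. ?f A j) - (\<Sum>j\<in>J - v ` S. ?f' A j)) / card J"
        unfolding measure_pmf_measure[OF A] prob_bind_pmf_of_set[OF J] split[OF u, of "?f A"] split[OF v, of "?f' A"]
        by (simp add: diff_divide_distrib add_divide_distrib)
      moreover have "0 \<le> (\<Sum>j\<in>J - u ` S. ?f A j)" "0 \<le> (\<Sum>j\<in>J - v ` S. ?f' A j)" by (intro sum_nonneg; simp)+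
      ultimately show ?thesis using J0 by (simp add: abs_divide divide_right_mono)
    qed
    then have "(\<Sum>A\<in>P. \<bar>measure ?\<mu> A - measure ?\<nu> A\<bar>) \<le>
        (\<Sum>A\<in>P. ((\<Sum>j\<in>J - u ` S. ?f A j) + (\<Sum>j\<in>J - v ` S. ?f' A j)) / card J)"
      by (rule sum_mono)
    also have "\<dots> = ((\<Sum>j\<in>J - u ` S. \<Sum>A\<in>P. ?f A j) + (\<Sum>j\<in>J - v ` S. \<Sum>A\<in>P. ?f' A j)) / card J"
      by (simp add: sum_divide_distrib[symmetric] sum.distrib sum.swap[of _ P])
    also have "\<dots> \<le> (real (card (J - u ` S)) + real (card (J - v ` S))) / card J"
    proof -
      \<comment> \<open>Disjoint sets have total probability at most one, so each unmatched
        component contributes at most \<open>1 / card J\<close>, however fine the partition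
        is.\<close>
      have 1: "(\<Sum>A\<in>P. measure_pmf.prob p A) \<le> 1" for p
        using measure_pmf.finite_measure_finite_Union[of P "\<lambda>A. A" p] P(1,2)
          measure_pmf.prob_le_1[of p "\<Union>P"] by (simp add: disjoint_family_on_disjoint_image disjoint_image_disjoint_family_on)
      have "(\<Sum>j\<in>J - u ` S. \<Sum>A\<in>P. ?f A j) \<le> real (card (J - u ` S))"
        using sum_bounded_above[of "J - u ` S" "\<lambda>j. \<Sum>A\<in>P. ?f A j" 1] 1 by simp
      moreover have "(\<Sum>j\<in>J - v ` S. \<Sum>A\<in>P. ?f' A j) \<le> real (card (J - v ` S))"
        using sum_bounded_above[of "J - v ` S" "\<lambda>j. \<Sum>A\<in>P. ?f' A j" 1] 1 by simp
      ultimately show ?thesis using J0 by (intro divide_right_mono add_mono) auto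
    qed
    also have "\<dots> = 2 * (1 - card S / card J)" unfolding card using J0 by (simp add: field_simps)
    finally show ?thesis .
  qed
  show ?thesis
    unfolding tv_dist_def
  proof (rule cSUP_least)
    \<comment> \<open>The trivial partition makes the family of the supremum nonempty.\<close>
    have "{space ?\<mu>} \<in> {P. finite P \<and> disjoint P \<and> P \<subseteq> sets ?\<mu> \<and> \<Union> P = space ?\<mu>}"
      using sets.top[of ?\<mu>] by (simp add: disjoint_def)
    then show "{P. finite P \<and> disjoint P \<and> P \<subseteq> sets ?\<mu> \<and> \<Union> P = space ?\<mu>} \<noteq> {}"
      by (rule ex_in_conv[THEN iffD1, OF exI])
    show "(\<Sum>A\<in>P. \<bar>measure ?\<mu> A - measure ?\<nu> A\<bar>) \<le> 2 * (1 - card S / card J)"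
      if "P \<in> {P. finite P \<and> disjoint P \<and> P \<subseteq> sets ?\<mu> \<and> \<Union> P = space ?\<mu>}" for P
      by (rule le) (use that in \<open>simp_all only: mem_Collect_eq\<close>)
  qed
qed

section \<open>Left translation in the groupoid\<close>

context topological_kgraph
begin

text \<open>The middle path \<open>y\<close> occurs with prefixes of degrees \<open>q\<close> and
  \<open>p'\<close>. Extending both to degree \<open>sup q p'\<close>, and the prefixes of
  \<open>x\<close> and \<open>z\<close> accordingly, makes the two equations meet in one shift of
  \<open>y\<close>.\<close>

lemma groupoid_cmp_mor:
  assumes g: "(x, m, y) \<in> mors G" and h: "(y, n, z) \<in> mors G"
  shows "(x, m + n, z) \<in> mors G"
proof -
  have "(x, m, y) \<in> path_arrows k \<Lambda>" "(y, n, z) \<in> path_arrows k \<Lambda>" and b: "x \<in> bd" "z \<in> bd"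
    using g h by (auto simp: mors_G)
  from this(1,2)[unfolded path_arrows_iff] obtain p q p' q' where
    X: "x \<in> X" "y \<in> X" "z \<in> X" and p: "below p (pdeg x)" and q: "below q (pdeg y)"
    and pq: "shift k p x = shift k q y" and m: "m = (int \<circ> p) - (int \<circ> q)"
    and p': "below p' (pdeg y)" and q': "below q' (pdeg z)"
    and pq': "shift k p' y = shift k q' z" and n: "n = (int \<circ> p') - (int \<circ> q')" by (elim exE conjE)
  have kk: "p \<in> tuples k" "q \<in> tuples k" "p' \<in> tuples k" "q' \<in> tuples k" using p q p' q' by simp_all
  let ?t = "sup q p'"
  have t: "below ?t (pdeg y)" using below_sup[OF q p'] .
  let ?a = "?t - q" and ?b = "?t - p'"
  have a: "q + ?a = ?t" "?a \<in> tuples k" and b': "p' + ?b = ?t" "?b \<in> tuples k"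
    using kk by (auto simp: tuple_add_diff)
  have xa: "below (p + ?a) (pdeg x)"
    using below_shift[OF X(1) p a(2)] below_shift[OF X(2) q a(2)] pq a(1) t by simp
  have zb: "below (q' + ?b) (pdeg z)"
    using below_shift[OF X(3) q' b'(2)] below_shift[OF X(2) p' b'(2)] pq' b'(1) t by simp
  have "shift k (p + ?a) x = shift k ?t y"
    using shift_shift[OF X(1) xa kk(1) a(2)] shift_shift[OF X(2) _ kk(2) a(2)] a(1) t pq by simp
  moreover have "shift k (q' + ?b) z = shift k ?t y"
    using shift_shift[OF X(3) zb kk(4) b'(2)] shift_shift[OF X(2) _ kk(3) b'(2)] b'(1) t pq' by simp
  moreover have "m + n = (int \<circ> (p + ?a)) - (int \<circ> (q' + ?b))"
  proof
    fix i
    show "(m + n) i = ((int \<circ> (p + ?a)) - (int \<circ> (q' + ?b))) i"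
      unfolding m n by (auto simp: sup_max max_def)
  qed
  ultimately have "(x, m + n, z) \<in> path_arrows k \<Lambda>"
    unfolding path_arrows_iff using X xa zb by (intro conjI exI[of _ "p + ?a"] exI[of _ "q' + ?b"]) simp_all
  then show ?thesis using b by (simp add: mors_G)
qed

text \<open>The restriction in \<open>translate\<close> loses nothing because \<open>p\<close> is
  supported in the fibre, and left multiplication is measurable there because every subset of the
  fibre is Borel.\<close>

lemma translate_pmf_measure:
  assumes g: "(x, m, y) \<in> mors G" and p: "set_pmf p \<subseteq> {h \<in> mors G. fst h = y}"
  shows "translate G (x, m, y) (pmf_measure (mor_top G) p) =
    pmf_measure (mor_top G) (map_pmf (cmp G (x, m, y)) p)"
proof (rule measure_eqI)
  let ?M = "pmf_measure (mor_top G) p" and ?F = "{h \<in> mors G. fst h = y}" and ?c = "cmp G (x, m, y)"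
  let ?B = "borel_on (mor_top G)"
  show "sets (translate G (x, m, y) ?M) = sets (pmf_measure (mor_top G) (map_pmf ?c p))"
    by (simp add: translate_def)
  have F: "?F \<in> sets ?B" by (rule fibre_subset_sets) auto
  have sub: "S \<in> sets ?B" if "S \<subseteq> ?F" for S
    by (rule fibre_subset_sets[of _ y]) (use that in auto)
  have sp: "space (restrict_space ?M ?F) = ?F"
    by (auto simp: space_restrict_space)
  have c: "?c \<in> measurable (restrict_space ?M ?F) ?B"
  proof (rule measurableI)
    fix h assume "h \<in> space (restrict_space ?M ?F)"
    then have hF: "h \<in> ?F" unfolding sp .
    obtain y' n z where h': "h = (y', n, z)" by (cases h)
    have "y' = y" using hF unfolding h' by simp
    then have h: "h = (y, n, z)" "(y, n, z) \<in> mors G" using hF h' by simp_all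
    show "?c h \<in> space ?B" unfolding h(1) cmp_G space_borel_on by (rule groupoid_cmp_mor[OF g h(2)])
  next
    fix A
    have "?c -` A \<inter> ?F \<in> sets ?B" by (rule sub) auto
    moreover have "(?c -` A \<inter> ?F) \<inter> ?F = ?c -` A \<inter> ?F" by auto
    ultimately show "?c -` A \<inter> space (restrict_space ?M ?F) \<in> sets (restrict_space ?M ?F)"
      unfolding sp sets_restrict_space by (metis (no_types, lifting) imageI inf_commute sets_pmf_measure)
  qed
  fix A assume "A \<in> sets (translate G (x, m, y) ?M)"
  then have A: "A \<in> sets ?B" by (simp add: translate_def)
  have tr: "translate G (x, m, y) ?M = distr (restrict_space ?M ?F) ?B ?c"
    by (simp add: translate_def)
  have "emeasure (translate G (x, m, y) ?M) A = emeasure (restrict_space ?M ?F) (?c -` A \<inter> ?F)"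
    unfolding tr using emeasure_distr[OF c A] unfolding sp .
  also have "\<dots> = emeasure ?M (?c -` A \<inter> ?F)"
    by (rule emeasure_restrict_space) (use F in \<open>auto simp: Int_absorb2\<close>)
  also have "\<dots> = emeasure (measure_pmf p) (?c -` A \<inter> ?F)"
    by (rule emeasure_pmf_measure) (rule sub, auto)
  also have "\<dots> = emeasure (measure_pmf p) (?c -` A)"
    using p by (intro emeasure_eq_AE) (auto simp: AE_measure_pmf_iff)
  also have "\<dots> = emeasure (pmf_measure (mor_top G) (map_pmf ?c p)) A"
    by (simp add: emeasure_pmf_measure[OF A])
  finally show "emeasure (translate G (x, m, y) ?M) A = emeasure (pmf_measure (mor_top G) (map_pmf ?c p)) A" .
qed

end

section \<open>Continuous means\<close>

definition cube :: "nat \<Rightarrow> nat \<Rightarrow> (nat \<Rightarrow> nat) set" where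
  "cube k N = {i \<in> tuples k. \<forall>j. i j \<le> N}"

lemma cube_eq_PiE_dflt: "cube k N = PiE_dflt {..<k} 0 (\<lambda>_. {..N})"
proof (intro equalityI subsetI)
  fix i :: "nat \<Rightarrow> nat" assume i: "i \<in> PiE_dflt {..<k} 0 (\<lambda>_. {..N})"
  have "i j \<le> N" for j using i by (cases "j < k") (auto simp: PiE_dflt_def)
  then show "i \<in> cube k N" using i by (auto simp: cube_def PiE_dflt_def tuples_def)
qed (auto simp: cube_def PiE_dflt_def tuples_def)

lemma finite_cube: "finite (cube k N)"
  unfolding cube_eq_PiE_dflt by (intro finite_PiE_dflt) auto

lemma card_cube: "card (cube k N) = (N + 1) ^ k"
  unfolding cube_eq_PiE_dflt by (subst card_PiE_dflt) auto

text \<open>Shrinking the side of the cube by \<open>M\<close> leaves room for a translation by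
  \<open>p\<close>.\<close>

lemma cube_add:
  assumes "p \<in> tuples k" "\<And>j. p j \<le> M" "M \<le> N" "i \<in> cube k (N - M)"
  shows "p + i \<in> cube k N"
proof -
  have "p j + i j \<le> N" for j
  proof -
    have "i j \<le> N - M" using assms(4) by (simp add: cube_def)
    then show ?thesis using assms(2)[of j] assms(3) by linarith
  qed
  then show ?thesis using assms(1,4) by (simp add: cube_def)
qed

lemma atin_within_openin:
  assumes S: "openin T S" "a \<in> S"
  shows "atin_within T a S = atin T a"
proof (rule filter_eqI)
  fix P
  have "(\<exists>U. openin T U \<and> a \<in> U \<and> (\<forall>x\<in>U. x \<in> S \<and> x \<noteq> a \<longrightarrow> P x)) \<longleftrightarrow>
      (\<exists>U. openin T U \<and> a \<in> U \<and> (\<forall>x\<in>U. x \<noteq> a \<longrightarrow> P x))" (is "?L \<longleftrightarrow> ?R")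
  proof
    assume ?L
    then obtain U where U: "openin T U" "a \<in> U" "\<forall>x\<in>U. x \<in> S \<and> x \<noteq> a \<longrightarrow> P x" by (elim exE conjE)
    then show ?R using S by (intro exI[of _ "U \<inter> S"]) auto
  qed blast
  then show "eventually P (atin_within T a S) = eventually P (atin T a)"
    by (simp add: eventually_atin_within)
qed

lemma bounded_Cc:
  assumes "f \<in> Cc T"
  shows "\<exists>B. \<forall>g\<in>topspace T. norm (f g) \<le> B"
proof -
  let ?S = "{g \<in> topspace T. f g \<noteq> 0}"
  have "compact (f ` (T closure_of ?S))"
    using assms image_compactin[of T _ euclidean f] by (simp add: Cc_def)
  from compact_imp_bounded[OF this] obtain B where "\<forall>z\<in>f ` (T closure_of ?S). norm z \<le> B"
    unfolding bounded_iff by (elim exE)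
  then have B: "norm (f g) \<le> B" if "g \<in> T closure_of ?S" for g using that by blast
  have "norm (f g) \<le> max B 0" if "g \<in> topspace T" for g
  proof (cases "f g = 0")
    case False
    then have "g \<in> T closure_of ?S" using that closure_of_subset[of ?S T] by blast
    then show ?thesis using B[of g] by simp
  qed simp
  then show ?thesis by blast
qed

section \<open>Random stopping degrees and their continuity\<close>

context topological_kgraph
begin

text \<open>With a bump function for \<phi>, this is a continuous substitute for the indicator of
  \<open>init x m\<close> existing and lying in a compact set.\<close>

definition hit :: "('a \<Rightarrow> real) \<Rightarrow> ('o, 'a) kpath \<Rightarrow> (nat \<Rightarrow> nat) \<Rightarrow> real" where
  "hit \<phi> x m = (if below m (pdeg x) then \<phi> (init x m) else 0)"

text \<open>An arbitrary enumeration, possibly with repetitions, because \<open>random_sup\<close>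
  recurses over a list.\<close>

definition downset :: "(nat \<Rightarrow> nat) \<Rightarrow> (nat \<Rightarrow> nat) list" where
  "downset i = (SOME ms. set ms = {m. m \<le> i})"

lemma set_downset: "i \<in> tuples k \<Longrightarrow> set (downset i) = {m. m \<le> i}"
  unfolding downset_def by (rule someI_ex) (rule finite_list[OF finite_tuples_le])

lemma le_tuples: "m \<le> i \<Longrightarrow> i \<in> tuples k \<Longrightarrow> m \<in> tuples k" for m i :: "nat \<Rightarrow> nat"
proof -
  assume "m \<le> i" "i \<in> tuples k"
  then have "m j = 0" if "k \<le> j" for j
    using that le_funD[of m i j] by (simp add: tuples_def)
  then show ?thesis by (simp add: tuples_def)
qed

definition stop :: "('a \<Rightarrow> real) \<Rightarrow> ('o, 'a) kpath \<Rightarrow> (nat \<Rightarrow> nat) \<Rightarrow> (nat \<Rightarrow> nat) pmf" where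
  "stop \<phi> x i = random_sup (hit \<phi> x) (downset i) 0"

definition cutoff :: "('a \<Rightarrow> real) \<Rightarrow> bool" where
  "cutoff \<phi> \<longleftrightarrow> continuous_map (mor_top \<Lambda>) euclideanreal \<phi> \<and> (\<forall>f\<in>mors \<Lambda>. 0 \<le> \<phi> f \<and> \<phi> f \<le> 1) \<and>
     (\<exists>D. compactin (mor_top \<Lambda>) D \<and> (\<forall>f\<in>mors \<Lambda> - D. \<phi> f = 0))"

lemma hit_bounds: "cutoff \<phi> \<Longrightarrow> x \<in> X \<Longrightarrow> 0 \<le> hit \<phi> x m \<and> hit \<phi> x m \<le> 1"
  by (simp add: hit_def cutoff_def init_mor)

text \<open>Degrees whose segment lies in \<open>C\<close> are selected with certainty and those
  whose segment lies outside \<open>D\<close> never, which puts the random degree between two values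
  of \<open>reach\<close>.\<close>

lemma
  assumes r: "r \<in> set_pmf (stop \<phi> x i)" and \<phi>: "cutoff \<phi>" and x: "x \<in> X" and i: "i \<in> tuples k"
  shows stop_le: "r \<le> i" and stop_below: "below r (pdeg x)"
    and reach_le_stop: "(\<And>f. f \<in> C \<Longrightarrow> \<phi> f = 1) \<Longrightarrow> reach C x i \<le> r"
    and stop_le_reach: "(\<And>f. f \<in> mors \<Lambda> \<Longrightarrow> f \<notin> D \<Longrightarrow> \<phi> f = 0) \<Longrightarrow> r \<le> reach D x i"
proof -
  note r' = r[unfolded stop_def] and b = hit_bounds[OF \<phi> x] and d = set_downset[OF i]
  show "r \<le> i"
  proof (rule random_sup_induct[where P = "\<lambda>r. r \<le> i", OF r' b])
    show "sup a m \<le> i" if "a \<le> i" "m \<in> set (downset i)" for a m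
      using that d by (intro sup_least) simp_all
  qed (rule tuple_zero_le)
  show "below r (pdeg x)"
  proof (rule random_sup_induct[where P = "\<lambda>r. below r (pdeg x)", OF r' b])
    show "below (sup a m) (pdeg x)" if "below a (pdeg x)" "hit \<phi> x m \<noteq> 0" for a m
      by (rule below_sup[OF that(1)]) (use that(2) in \<open>simp add: hit_def split: if_splits\<close>)
  qed (rule below_zero)
  show "reach C x i \<le> r" if "\<And>f. f \<in> C \<Longrightarrow> \<phi> f = 1"
  proof (rule reach_least[OF i])
    show "m \<le> r" if "m \<le> i" "below m (pdeg x)" "init x m \<in> C" for m
      using random_sup_ge(2)[OF r' b] that \<open>\<And>f. f \<in> C \<Longrightarrow> \<phi> f = 1\<close> d by (simp add: hit_def)
  qed
  show "r \<le> reach D x i" if "\<And>f. f \<in> mors \<Lambda> \<Longrightarrow> f \<notin> D \<Longrightarrow> \<phi> f = 0"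
  proof (rule random_sup_induct[where P = "\<lambda>r. r \<le> reach D x i", OF r' b])
    fix a m assume am: "a \<le> reach D x i" "m \<in> set (downset i)" "hit \<phi> x m \<noteq> 0"
    then have m: "below m (pdeg x)" "\<phi> (init x m) \<noteq> 0" by (auto simp: hit_def split: if_splits)
    then have "init x m \<in> D" using that init_mor[OF x] by blast
    then have "m \<le> reach D x i" using am(2) m(1) d by (intro reach_upper[OF i]) auto
    then show "sup a m \<le> reach D x i" by (intro sup_least am(1))
  qed (rule tuple_zero_le)
qed

lemma openin_below: "m \<in> tuples k \<Longrightarrow> openin (obj_top G) {x \<in> bd. below m (pdeg x)}"
  and continuous_hit: "m \<in> tuples k \<Longrightarrow> cutoff \<phi> \<Longrightarrow> continuous_map (obj_top G) euclideanreal (\<lambda>x. hit \<phi> x m)"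
proof -
  assume m: "m \<in> tuples k"
  have op: "openin (obj_top G) {x \<in> bd. below m (pdeg x) \<and> init x m \<in> U}" if "openin (mor_top \<Lambda>) U" for U
  proof -
    have "{x \<in> bd. below m (pdeg x) \<and> init x m \<in> U} = bd \<inter> {x \<in> X. below m (pdeg x) \<and> init x m \<in> U}"
      using bd_path by auto
    then show ?thesis
      unfolding obj_top_G using openin_subtopology_Int2[OF openin_paths[OF m that]] by simp
  qed
  have "{x \<in> bd. below m (pdeg x)} = {x \<in> bd. below m (pdeg x) \<and> init x m \<in> mors \<Lambda>}"
    using bd_path init_mor by auto
  then show ob: "openin (obj_top G) {x \<in> bd. below m (pdeg x)}" using op[OF openin_topspace] by simp
  assume \<phi>: "cutoff \<phi>"
  then obtain D where D: "compactin (mor_top \<Lambda>) D" "\<forall>f\<in>mors \<Lambda> - D. \<phi> f = 0"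
    by (auto simp: cutoff_def)
  \<comment> \<open>Where \<open>init x m\<close> is missing or outside \<open>D\<close>,
    \<open>hit\<close> vanishes. The set of these paths is open since \<open>D\<close> is compact,
    and this gives continuity at the paths too short for \<open>m\<close>.\<close>
  have "closedin (obj_top G) (bd \<inter> {x \<in> X. below m (pdeg x) \<and> init x m \<in> D})"
    unfolding obj_top_G by (rule closedin_subtopology_Int_closed[OF closedin_paths[OF m D(1)]])
  then have oD: "openin (obj_top G) (bd - {x \<in> X. below m (pdeg x) \<and> init x m \<in> D})"
    by (auto simp: closedin_def objs_G Diff_Int)
  show "continuous_map (obj_top G) euclideanreal (\<lambda>x. hit \<phi> x m)"
    unfolding continuous_map_def
  proof (intro conjI allI impI)
    fix U :: "real set" assume U: "openin euclideanreal U"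
    let ?V = "{f \<in> mors \<Lambda>. \<phi> f \<in> U}"
    have V: "openin (mor_top \<Lambda>) ?V" using \<phi> U by (auto simp: cutoff_def continuous_map_def)
    show "openin (obj_top G) {x \<in> objs G. hit \<phi> x m \<in> U}"
    proof (cases "0 \<in> U")
      case True
      have "hit \<phi> x m \<in> U \<longleftrightarrow> below m (pdeg x) \<and> init x m \<in> ?V \<or> \<not> (below m (pdeg x) \<and> init x m \<in> D)"
        if "x \<in> bd" for x
        using True D(2) init_mor[OF bd_path[OF that]]
        by (cases "below m (pdeg x)"; cases "init x m \<in> D") (simp_all add: hit_def)
      then have "{x \<in> objs G. hit \<phi> x m \<in> U} = {x \<in> bd. below m (pdeg x) \<and> init x m \<in> ?V} \<union>
          (bd - {x \<in> X. below m (pdeg x) \<and> init x m \<in> D})"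
        unfolding objs_G using bd_path by blast
      then show ?thesis using op[OF V] oD by auto
    next
      case False
      have "{x \<in> objs G. hit \<phi> x m \<in> U} = {x \<in> bd. below m (pdeg x) \<and> init x m \<in> ?V}"
        using False bd_path by (auto simp: hit_def objs_G init_mor)
      then show ?thesis using op[OF V] by simp
    qed
  qed simp
qed

lemma continuous_pmf_stop:
  assumes i: "i \<in> tuples k" and \<phi>: "cutoff \<phi>"
  shows "continuous_map (obj_top G) euclideanreal (\<lambda>x. pmf (stop \<phi> x i) r)"
proof -
  \<comment> \<open>\<open>continuous_map_pmf_random_sup\<close> wants weights between
    \<open>0\<close> and \<open>1\<close> at every argument, so \<open>hit\<close> is replaced by
    \<open>0\<close> off \<open>X\<close>.\<close>
  have "continuous_map (obj_top G) euclideanreal (\<lambda>x. pmf (random_sup (\<lambda>m. if x \<in> X then hit \<phi> x m else 0) (downset i) 0) r)"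
  proof (rule continuous_map_pmf_random_sup)
    fix m assume "m \<in> set (downset i)"
    then have m: "m \<in> tuples k" using le_tuples[OF _ i] set_downset[OF i] by auto
    show "continuous_map (obj_top G) euclideanreal (\<lambda>x. if x \<in> X then hit \<phi> x m else 0)"
      by (rule continuous_map_eq[OF continuous_hit[OF m \<phi>]]) (use bd_path in \<open>auto simp: objs_G\<close>)
  qed (use hit_bounds[OF \<phi>] in auto)
  then show ?thesis
    by (rule continuous_map_eq) (use bd_path in \<open>auto simp: objs_G stop_def\<close>)
qed

text \<open>
  The map \<open>x \<mapsto> arrow x m\<close> has no continuous extension to the paths of degree not above \<open>m\<close>; there
  the weight vanishes, and \<open>f\<close> is bounded.
\<close>

lemma continuous_weighted_arrow:
  fixes f :: "('o, 'a) path_arrow \<Rightarrow> complex"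
  assumes i: "i \<in> tuples k" and m: "m \<in> tuples k" and \<phi>: "cutoff \<phi>" and f: "f \<in> Cc (mor_top G)"
  shows "continuous_map (obj_top G) euclidean (\<lambda>x. pmf (stop \<phi> x i) m *\<^sub>R f (arrow x m))"
  unfolding continuous_map_atin limitin_canonical_iff
proof
  fix x0 assume "x0 \<in> objs G"
  then have x0: "x0 \<in> bd" by (simp add: objs_G)
  let ?F = "atin (obj_top G) x0" and ?w = "\<lambda>x. pmf (stop \<phi> x i) m"
  have w: "(?w \<longlongrightarrow> ?w x0) ?F"
    using continuous_pmf_stop[OF i \<phi>, of m] x0 by (auto simp: continuous_map_atin objs_G)
  have cf: "continuous_map (mor_top G) euclidean f" using f by (simp add: Cc_def)
  show "((\<lambda>x. ?w x *\<^sub>R f (arrow x m)) \<longlongrightarrow> ?w x0 *\<^sub>R f (arrow x0 m)) ?F"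
  proof (cases "below m (pdeg x0)")
    case True
    \<comment> \<open>Having a segment of degree \<open>m\<close> is an open condition, so the limit
      at \<open>x0\<close> may be taken within \<open>?S\<close>, where \<open>arrow x m\<close> is
      continuous.\<close>
    let ?S = "{x \<in> bd. below m (pdeg x)}"
    have "?S = objs G \<inter> {x. below m (pdeg x)}" by (auto simp: objs_G)
    then have "subtopology (obj_top G) {x. below m (pdeg x)} = subtopology (obj_top G) ?S"
      by (simp only: subtopology_restrict)
    then have "continuous_map (subtopology (obj_top G) ?S) euclidean (\<lambda>x. f (arrow x m))"
      using continuous_map_compose[OF continuous_arrow_G[OF m] cf] by (simp add: o_def)
    then have "limitin euclidean (\<lambda>x. f (arrow x m)) (f (arrow x0 m)) (atin_within (obj_top G) x0 ?S)"
      by (rule limit_continuous_map_within) (use x0 True in \<open>auto simp: objs_G\<close>)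
    moreover have "atin_within (obj_top G) x0 ?S = ?F"
      by (rule atin_within_openin[OF openin_below[OF m]]) (use x0 True in simp)
    ultimately have "((\<lambda>x. f (arrow x m)) \<longlongrightarrow> f (arrow x0 m)) ?F" by simp
    with w show ?thesis by (rule tendsto_scaleR)
  next
    case False
    obtain B where B: "\<And>g. g \<in> mors G \<Longrightarrow> norm (f g) \<le> B" using bounded_Cc[OF f] by blast
    have w0: "?w x0 = 0" using stop_below[OF _ \<phi> bd_path[OF x0] i, of m] False by (auto simp: set_pmf_iff)
    have "eventually (\<lambda>x. norm (?w x *\<^sub>R f (arrow x m)) \<le> ?w x * B) ?F"
    proof -
      have "norm (?w x *\<^sub>R f (arrow x m)) \<le> ?w x * B" if x: "x \<in> bd" for x
      proof (cases "below m (pdeg x)")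
        case True
        then show ?thesis using B(1)[OF arrow_mor[OF x True]] by (simp add: mult_left_mono)
      next
        case False
        then have "?w x = 0" using stop_below[OF _ \<phi> bd_path[OF x] i, of m] by (auto simp: set_pmf_iff)
        then show ?thesis by simp
      qed
      then show ?thesis using openin_topspace[of "obj_top G"] x0
        unfolding eventually_atin by (auto simp: objs_G intro!: exI[of _ bd])
    qed
    moreover have "((\<lambda>x. ?w x * B) \<longlongrightarrow> 0) ?F" using tendsto_mult_right[OF w, of B] w0 by simp
    ultimately have "((\<lambda>x. ?w x *\<^sub>R f (arrow x m)) \<longlongrightarrow> 0) ?F"
      by (rule Lim_null_comparison)
    then show ?thesis using w0 by simp
  qed
qed

section \<open>The averaged measures and their continuity\<close>

definition mean_pmf :: "(nat \<Rightarrow> 'a \<Rightarrow> real) \<Rightarrow> (nat \<times> (nat \<Rightarrow> nat)) set \<Rightarrow> ('o, 'a) kpath \<Rightarrow> ('o, 'a) path_arrow pmf" where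
  "mean_pmf \<Phi> J x = pmf_of_set J \<bind> (\<lambda>(n, i). map_pmf (arrow x) (stop (\<Phi> n) x i))"

lemma set_mean_pmf:
  assumes J: "finite J" "J \<noteq> {}" "\<And>n i. (n, i) \<in> J \<Longrightarrow> i \<in> tuples k" and \<Phi>: "\<And>n. cutoff (\<Phi> n)" and x: "x \<in> bd"
  shows "set_pmf (mean_pmf \<Phi> J x) \<subseteq> {h \<in> mors G. fst h = x}"
proof
  fix h assume "h \<in> set_pmf (mean_pmf \<Phi> J x)"
  then obtain j where "j \<in> J" "h \<in> set_pmf (case j of (n, i) \<Rightarrow> map_pmf (arrow x) (stop (\<Phi> n) x i))"
    unfolding mean_pmf_def set_bind_pmf set_pmf_of_set[OF J(2,1)] by blast
  then obtain n i r where "(n, i) \<in> J" "r \<in> set_pmf (stop (\<Phi> n) x i)" "h = arrow x r"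
    by (cases j) auto
  then show "h \<in> {h \<in> mors G. fst h = x}"
    using stop_below[OF _ \<Phi> bd_path[OF x] J(3)] arrow_mor[OF x] by (auto simp: arrow_def)
qed

text \<open>The stopping degree for \<open>(n, i)\<close> is at most \<open>i\<close> for every
  \<open>x\<close>. Hence the integral of \<open>f\<close> is a sum, over a finite index set
  independent of \<open>x\<close>, of the functions treated in
  \<open>continuous_weighted_arrow\<close>.\<close>

lemma continuous_mean_mean_pmf:
  assumes J: "finite J" "J \<noteq> {}" "\<And>n i. (n, i) \<in> J \<Longrightarrow> i \<in> tuples k" and \<Phi>: "\<And>n. cutoff (\<Phi> n)"
  shows "continuous_mean G (\<lambda>x. pmf_measure (mor_top G) (mean_pmf \<Phi> J x))"
  unfolding continuous_mean_def
proof (intro conjI ballI)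
  fix x assume "x \<in> objs G"
  then have x: "x \<in> bd" by (simp add: objs_G)
  let ?p = "mean_pmf \<Phi> J x" and ?F = "{h \<in> mors G. fst h = x}"
  have s: "set_pmf ?p \<subseteq> ?F" using set_mean_pmf[OF J \<Phi> x] .
  then have "set_pmf ?p \<subseteq> mors G" by blast
  then show "prob_space (pmf_measure (mor_top G) ?p)" by (rule prob_space_pmf_measure)
  show "AE \<gamma> in pmf_measure (mor_top G) ?p. rng G \<gamma> = x"
    by (rule AE_pmf_measure[OF _ s]) (auto intro!: fibre_subset_sets)
  show "space (pmf_measure (mor_top G) ?p) = mors G"
    "sets (pmf_measure (mor_top G) ?p) = sets (borel_on (mor_top G))" by simp_all
next
  fix f :: "('o, 'a) path_arrow \<Rightarrow> complex" assume f: "f \<in> Cc (mor_top G)"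
  let ?t = "\<lambda>x n i m. pmf (stop (\<Phi> n) x i) m *\<^sub>R f (arrow x m)"
  have eq: "(\<integral>\<gamma>. f \<gamma> \<partial>pmf_measure (mor_top G) (mean_pmf \<Phi> J x)) = (\<Sum>(n, i)\<in>J. (\<Sum>m | m \<le> i. ?t x n i m) /\<^sub>R real (card J))"
    if x: "x \<in> bd" for x
  proof -
    have fin: "set_pmf (stop (\<Phi> n) x i) \<subseteq> {m. m \<le> i}" "finite {m. m \<le> i}" if "(n, i) \<in> J" for n i
      using stop_le[OF _ \<Phi> bd_path[OF x] J(3)[OF that]] finite_tuples_le[OF J(3)[OF that]] by auto
    have "(\<integral>\<gamma>. f \<gamma> \<partial>pmf_measure (mor_top G) (mean_pmf \<Phi> J x)) = (\<integral>\<gamma>. f \<gamma> \<partial>measure_pmf (mean_pmf \<Phi> J x))"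
    proof (rule integral_pmf_measure)
      show "continuous_map (mor_top G) euclidean f" using f by (simp add: Cc_def)
      have "set_pmf (mean_pmf \<Phi> J x) \<subseteq> {h \<in> mors G. fst h = x}" by (rule set_mean_pmf[OF J \<Phi> x])
      then show "set_pmf (mean_pmf \<Phi> J x) \<subseteq> mors G" by blast
    qed
    also have "\<dots> = (\<Sum>j\<in>J. measure_pmf.expectation (case j of (n, i) \<Rightarrow> map_pmf (arrow x) (stop (\<Phi> n) x i)) f /\<^sub>R real (card J))"
      unfolding mean_pmf_def
    proof (rule pmf_expectation_bind_pmf_of_set[OF J(2,1)])
      fix j assume "j \<in> J"
      then obtain n i where "j = (n, i)" "(n, i) \<in> J" by (cases j) auto
      then show "finite (set_pmf (case j of (n, i) \<Rightarrow> map_pmf (arrow x) (stop (\<Phi> n) x i)))"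
        using finite_subset[OF fin] by simp
    qed
    also have "\<dots> = (\<Sum>(n, i)\<in>J. (\<Sum>m | m \<le> i. ?t x n i m) /\<^sub>R real (card J))"
    proof (rule sum.cong[OF refl], clarify)
      fix n i assume ni: "(n, i) \<in> J"
      have "measure_pmf.expectation (stop (\<Phi> n) x i) (\<lambda>m. f (arrow x m)) = (\<Sum>m | m \<le> i. ?t x n i m)"
        using fin[OF ni] by (intro integral_measure_pmf) auto
      then show "measure_pmf.expectation (map_pmf (arrow x) (stop (\<Phi> n) x i)) f /\<^sub>R real (card J) =
          (\<Sum>m | m \<le> i. ?t x n i m) /\<^sub>R real (card J)" by simp
    qed
    finally show ?thesis .
  qed
  have "continuous_map (obj_top G) euclidean (\<lambda>x. \<Sum>(n, i)\<in>J. (\<Sum>m | m \<le> i. ?t x n i m) /\<^sub>R real (card J))"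
  proof -
    have "((\<lambda>x. \<Sum>(n, i)\<in>J. (\<Sum>m | m \<le> i. ?t x n i m) /\<^sub>R real (card J)) \<longlongrightarrow>
        (\<Sum>(n, i)\<in>J. (\<Sum>m | m \<le> i. ?t x0 n i m) /\<^sub>R real (card J))) (atin (obj_top G) x0)"
      if x0: "x0 \<in> objs G" for x0
    proof (intro tendsto_sum)
      fix j assume "j \<in> J"
      then obtain n i where j: "j = (n, i)" "(n, i) \<in> J" by (cases j) auto
      have "((\<lambda>x. ?t x n i m) \<longlongrightarrow> ?t x0 n i m) (atin (obj_top G) x0)" if "m \<le> i" for m
        using continuous_weighted_arrow[OF J(3)[OF j(2)] le_tuples[OF that J(3)[OF j(2)]] \<Phi> f, of n] x0
        by (auto simp: continuous_map_atin)
      then show "((\<lambda>x. case j of (n, i) \<Rightarrow> (\<Sum>m | m \<le> i. ?t x n i m) /\<^sub>R real (card J)) \<longlongrightarrow>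
          (case j of (n, i) \<Rightarrow> (\<Sum>m | m \<le> i. ?t x0 n i m) /\<^sub>R real (card J))) (atin (obj_top G) x0)"
        unfolding j(1) prod.case
        by (rule tendsto_scaleR[OF tendsto_const tendsto_sum]) simp
    qed
    then show ?thesis unfolding continuous_map_atin limitin_canonical_iff by blast
  qed
  then show "continuous_map (obj_top G) euclidean (\<lambda>x. \<integral>\<gamma>. f \<gamma> \<partial>pmf_measure (mor_top G) (mean_pmf \<Phi> J x))"
    by (rule continuous_map_eq) (simp add: objs_G eq)
qed

end

section \<open>Approximate invariance\<close>

context compactly_aligned_kgraph
begin

text \<open>With \<open>z = shift k p x\<close>, every possible stopping degree \<open>r\<close>
  satisfies \<open>p + reach (C n) z i \<le> reach (C (n + 1)) x (p + i) \<le> r \<le> reach (C (n +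
  2)) x (p + i) \<le> p + reach (C (n + 3)) z i\<close>. Each outer inequality costs one level and
  the cutoff a third; by \<open>eq\<close> the two ends agree.\<close>

lemma stop_eq_return:
  assumes C1: "\<And>n f. f \<in> C n \<Longrightarrow> \<phi> n f = 1"
    and C2: "\<And>n f. f \<in> mors \<Lambda> \<Longrightarrow> f \<notin> C (Suc n) \<Longrightarrow> \<phi> n f = 0"
    and cmpC: "\<And>n f g. f \<in> K \<Longrightarrow> g \<in> C n \<Longrightarrow> (f, g) \<in> composable \<Lambda> \<Longrightarrow> f \<cdot> g \<in> C (Suc n)"
    and minC: "\<And>n l \<mu>. l \<in> K \<Longrightarrow> \<mu> \<in> C n \<Longrightarrow> fst ` min_ext \<Lambda> l \<mu> \<subseteq> C (Suc n)"
    and KC: "\<And>n. K \<subseteq> C n" and cut: "cutoff (\<phi> (Suc n))"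
    and x: "x \<in> X" and p: "below p (pdeg x)" and px: "init x p \<in> K" and i: "i \<in> tuples k"
    and eq: "reach (C n) (shift k p x) i = reach (C (n + 3)) (shift k p x) i"
  shows "stop (\<phi> (Suc n)) x (p + i) = return_pmf (p + reach (C n) (shift k p x) i)"
proof -
  let ?a = "p + reach (C n) (shift k p x) i"
  have pi: "p + i \<in> tuples k" using p i by simp
  have "r = ?a" if r: "r \<in> set_pmf (stop (\<phi> (Suc n)) x (p + i))" for r
  proof (rule antisym)
    have "?a \<le> reach (C (Suc n)) x (p + i)"
      by (rule add_reach_le[OF x p i]) (use px KC cmpC[OF px] in auto)
    also have "\<dots> \<le> r" by (rule reach_le_stop[OF r cut x pi]) (rule C1)
    finally show "?a \<le> r" .
    have "r \<le> reach (C (Suc (Suc n))) x (p + i)" by (rule stop_le_reach[OF r cut x pi]) (rule C2)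
    also have "\<dots> \<le> p + reach (C (Suc (Suc (Suc n)))) (shift k p x) i"
      by (rule reach_le_add[OF x p i minC[OF px]])
    also have "\<dots> = ?a" using eq by (simp add: eval_nat_numeral)
    finally show "r \<le> ?a" .
  qed
  then show ?thesis by (simp add: set_pmf_subset_singleton[symmetric] subset_iff)
qed

text \<open>The coordinate sum of \<open>reach (C n) z i\<close> is a monotone integer sequence in
  \<open>n\<close> bounded by \<open>k * N\<close>, so \<open>card_jumps_le\<close> applies. As each
  coordinate is monotone in \<open>n\<close>, equality of the sums gives equality of the
  tuples.\<close>

lemma card_good_levels:
  assumes i: "i \<in> cube k N" and C: "\<And>n. C n \<subseteq> C (Suc n)"
  shows "L \<le> card {n. n < L \<and> reach (C n) z i = reach (C (n + 3)) z i} + 3 * (k * N)"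
proof -
  have ik: "i \<in> tuples k" and iN: "i j \<le> N" for j using i by (auto simp: cube_def)
  have CC: "C n \<subseteq> C m" if "n \<le> m" for n m using lift_Suc_mono_le[of C] C that by blast
  define f where "f n = (\<Sum>j<k. reach (C n) z i j)" for n
  have mono: "mono f"
    unfolding f_def using reach_mono[OF ik CC] by (intro monoI sum_mono) (simp add: le_fun_def)
  have "f n \<le> k * N" for n
  proof -
    have "reach (C n) z i j \<le> N" for j using le_funD[OF reach_le[OF ik]] iN le_trans by blast
    then show ?thesis using sum_bounded_above[of "{..<k}" "\<lambda>j. reach (C n) z i j" N] by (simp add: f_def)
  qed
  then have jumps: "card {n. n < L \<and> f n \<noteq> f (n + 3)} \<le> 3 * (k * N)"
    using card_jumps_le[OF mono] by blast
  have inj: "reach (C n) z i = reach (C (n + 3)) z i" if "f n = f (n + 3)" for n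
  proof
    fix j
    have le: "reach (C n) z i j \<le> reach (C (n + 3)) z i j" for j
      using reach_mono[OF ik CC[of n "n + 3"]] by (simp add: le_fun_def)
    show "reach (C n) z i j = reach (C (n + 3)) z i j"
    proof (cases "j < k")
      case True
      show ?thesis
      proof (rule ccontr)
        assume "reach (C n) z i j \<noteq> reach (C (n + 3)) z i j"
        then have "reach (C n) z i j < reach (C (n + 3)) z i j" using le[of j] by simp
        then have "f n < f (n + 3)" unfolding f_def using le True by (intro sum_strict_mono_ex1) auto
        then show False using that by simp
      qed
    next
      case False
      then have "i j = 0" using ik by (simp add: tuples_def)
      then show ?thesis using le_funD[OF reach_le[OF ik], of "C n" z j] le_funD[OF reach_le[OF ik], of "C (n + 3)" z j]
        by simp
    qed
  qed
  let ?S = "{n. n < L \<and> reach (C n) z i = reach (C (n + 3)) z i}"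
  have "{..<L} \<subseteq> ?S \<union> {n. n < L \<and> f n \<noteq> f (n + 3)}" using inj by auto
  then have "card {..<L} \<le> card (?S \<union> {n. n < L \<and> f n \<noteq> f (n + 3)})" by (intro card_mono) auto
  also have "\<dots> \<le> card ?S + card {n. n < L \<and> f n \<noteq> f (n + 3)}" by (rule card_Un_le)
  finally show ?thesis using jumps by simp
qed

lemma approximately_invariant_mean:
  assumes K: "compactin (mor_top G) K" and \<epsilon>: "\<epsilon> > 0"
  shows "\<exists>m. continuous_mean G m \<and> (\<forall>\<gamma>\<in>K. tv_dist (translate G \<gamma> (m (src G \<gamma>))) (m (rng G \<gamma>)) < \<epsilon>)"
proof -
  obtain C0 where C0: "compactin (mor_top \<Lambda>) C0"
    and KC0: "\<And>x m y. (x, m, y) \<in> K \<Longrightarrow> x \<in> bd \<and> y \<in> bd \<and> (\<exists>p q. below p (pdeg x) \<and> below q (pdeg y) \<and>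
       init x p \<in> C0 \<and> init y q \<in> C0 \<and> shift k p x = shift k q y \<and> m = (int \<circ> p) - (int \<circ> q))"
    using compact_arrows_segments[OF K] by blast
  obtain C \<phi> where cC: "\<And>n. compactin (mor_top \<Lambda>) (C n)" and sub: "\<And>n. C0 \<subseteq> C n" "\<And>n. C n \<subseteq> C (Suc n)"
    and \<phi>: "\<And>n. continuous_map (mor_top \<Lambda>) euclideanreal (\<phi> n)"
    "\<And>n f. f \<in> mors \<Lambda> \<Longrightarrow> 0 \<le> \<phi> n f \<and> \<phi> n f \<le> 1"
    and C1: "\<And>n f. f \<in> C n \<Longrightarrow> \<phi> n f = 1" and C2: "\<And>n f. f \<in> mors \<Lambda> \<Longrightarrow> f \<notin> C (Suc n) \<Longrightarrow> \<phi> n f = 0"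
    and cmpC: "\<And>n f g. f \<in> C0 \<Longrightarrow> g \<in> C n \<Longrightarrow> (f, g) \<in> composable \<Lambda> \<Longrightarrow> f \<cdot> g \<in> C (Suc n)"
    and minC: "\<And>n l \<mu>. l \<in> C0 \<Longrightarrow> \<mu> \<in> C n \<Longrightarrow> fst ` min_ext \<Lambda> l \<mu> \<subseteq> C (Suc n)"
    using levels[OF C0] by blast
  have cut: "cutoff (\<phi> n)" for n
    unfolding cutoff_def using \<phi> C2[of _ n] cC by blast
  have "finite (deg \<Lambda> ` C0)" using finite_deg_image[OF C0] .
  \<comment> \<open>\<open>M\<close> bounds all entries of the prefix degrees, as a compact set has
    only finitely many degrees.\<close>
  obtain M where M: "\<And>f j. f \<in> C0 \<Longrightarrow> deg \<Lambda> f j \<le> M"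
  proof -
    have "finite (\<Union>m\<in>deg \<Lambda> ` C0. m ` {..<k})"
      using \<open>finite (deg \<Lambda> ` C0)\<close> by (rule finite_UN_I) simp
    then obtain M where M: "\<forall>a\<in>(\<Union>m\<in>deg \<Lambda> ` C0. m ` {..<k}). a \<le> M"
      unfolding finite_nat_set_iff_bounded_le by (elim exE)
    have "deg \<Lambda> f j \<le> M" if f: "f \<in> C0" for f j
    proof (cases "j < k")
      case True
      show ?thesis by (rule bspec[OF M]) (use f True in blast)
    next
      case False
      have "f \<in> mors \<Lambda>" using f C0 compactin_subset_topspace by blast
      then show ?thesis using deg_tuples[of f] False by (simp add: tuples_def)
    qed
    then show thesis using that by blast
  qed
  \<comment> \<open>The cube is so large that shrinking its side by \<open>M\<close> loses at most
    the fraction \<open>\<epsilon> / 8\<close>; the last summand ensures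
    \<open>M \<le> N\<close>.\<close>
  obtain N :: nat where N: "real N > 8 * real k * real M / \<epsilon> + real M" using reals_Archimedean2 by blast
  have MN: "M \<le> N"
  proof -
    have "0 \<le> 8 * real k * real M / \<epsilon>" using \<epsilon> by simp
    then show ?thesis using N by linarith
  qed
  \<comment> \<open>\<open>L\<close> is chosen after \<open>N\<close>: by
    \<open>card_good_levels\<close> at most \<open>3 * (k * N)\<close> levels are bad for a given
    \<open>i\<close>, and these are to be at most the fraction \<open>\<epsilon> / 8\<close> of all
    \<open>L\<close> levels.\<close>
  obtain L :: nat where L: "real L > 24 * real k * real N / \<epsilon>" using reals_Archimedean2 by blast
  have L0: "0 < real L"
  proof -
    have "0 \<le> 24 * real k * real N / \<epsilon>" using \<epsilon> by simp
    then show ?thesis using L by linarith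
  qed
  define J where "J = {..<L} \<times> cube k N"
  have "(0, 0) \<in> J" using L0 by (simp add: J_def cube_def)
  then have "J \<noteq> {}" by blast
  moreover have "finite J" "\<And>n i. (n, i) \<in> J \<Longrightarrow> i \<in> tuples k"
    using finite_cube[of k N] by (simp_all add: J_def, simp add: cube_def)
  ultimately have J: "finite J" "J \<noteq> {}" "\<And>n i. (n, i) \<in> J \<Longrightarrow> i \<in> tuples k" by blast+
  \<comment> \<open>The index \<open>Suc n\<close> leaves the level \<open>C n\<close> below the
    cutoff, which \<open>stop_eq_return\<close> needs.\<close>
  let ?P = "mean_pmf (\<lambda>n. \<phi> (Suc n)) J"
  let ?m = "\<lambda>x. pmf_measure (mor_top G) (?P x)"
  have "continuous_mean G ?m" by (rule continuous_mean_mean_pmf[OF J cut])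
  moreover have "tv_dist (translate G \<gamma> (?m (src G \<gamma>))) (?m (rng G \<gamma>)) < \<epsilon>" if \<gamma>: "\<gamma> \<in> K" for \<gamma>
  proof -
    obtain x m y where g: "\<gamma> = (x, m, y)" by (cases \<gamma>)
    obtain p q where x: "x \<in> bd" and y: "y \<in> bd" and p: "below p (pdeg x)" and q: "below q (pdeg y)"
      and px: "init x p \<in> C0" and qy: "init y q \<in> C0" and pq: "shift k p x = shift k q y"
      and m: "m = (int \<circ> p) - (int \<circ> q)" using KC0 \<gamma> unfolding g by blast
    have xX: "x \<in> X" and yX: "y \<in> X" using x y bd_path by auto
    have pM: "p j \<le> M" and qM: "q j \<le> M" for j
      using M[OF px] M[OF qy] deg_init[OF xX p] deg_init[OF yX q] by auto
    let ?z = "shift k p x"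
    \<comment> \<open>On these pairs stopping is deterministic along both \<open>x\<close> and
      \<open>y\<close>. The component \<open>(n, q + i)\<close> of the translated mean at
      \<open>y\<close> is matched with the component \<open>(n, p + i)\<close> of the mean at
      \<open>x\<close>; the smaller cube keeps both indices in \<open>J\<close>.\<close>
    let ?S = "SIGMA i:cube k (N - M). {n. n < L \<and> reach (C n) ?z i = reach (C (n + 3)) ?z i}"
    let ?u = "\<lambda>(i, n). (n, q + i)" and ?v = "\<lambda>(i, n). (n, p + i)"
    let ?c = "cmp G (x, m, y)"
    let ?F = "\<lambda>(n, i). map_pmf ?c (map_pmf (arrow y) (stop (\<phi> (Suc n)) y i))"
    let ?F' = "\<lambda>(n, i). map_pmf (arrow x) (stop (\<phi> (Suc n)) x i)"
    have gm: "(x, m, y) \<in> mors G" using \<gamma> g compactin_subset_topspace[OF K] by blast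
    have "translate G \<gamma> (?m (src G \<gamma>)) = pmf_measure (mor_top G) (map_pmf ?c (?P y))"
      unfolding g src_G snd_conv by (rule translate_pmf_measure[OF gm]) (rule set_mean_pmf[OF J cut y])
    also have "map_pmf ?c (?P y) = pmf_of_set J \<bind> ?F"
      unfolding mean_pmf_def map_bind_pmf by (rule bind_pmf_cong) (auto simp: split_beta)
    finally have tr: "translate G \<gamma> (?m (src G \<gamma>)) = pmf_measure (mor_top G) (pmf_of_set J \<bind> ?F)" .
    have FF: "?F (?u s) = ?F' (?v s)" if s: "s \<in> ?S" for s
    proof -
      obtain i n where s': "s = (i, n)" "i \<in> cube k (N - M)" and eq: "reach (C n) ?z i = reach (C (n + 3)) ?z i"
        using s by auto
      have i: "i \<in> tuples k" using s' by (simp add: cube_def)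
      let ?a = "reach (C n) ?z i"
      have sx: "stop (\<phi> (Suc n)) x (p + i) = return_pmf (p + ?a)"
        by (rule stop_eq_return[OF C1 C2 cmpC minC sub(1) cut xX p px i eq])
      have sy: "stop (\<phi> (Suc n)) y (q + i) = return_pmf (q + ?a)"
        unfolding pq by (rule stop_eq_return[OF C1 C2 cmpC minC sub(1) cut yX q qy i eq[unfolded pq]])
      have bx: "below (p + ?a) (pdeg x)"
        using stop_below[of "p + ?a" "\<phi> (Suc n)" x "p + i"] sx cut xX p i by simp
      have by': "below (q + ?a) (pdeg y)"
        using stop_below[of "q + ?a" "\<phi> (Suc n)" y "q + i"] sy cut yX q i by simp
      have ak: "?a \<in> tuples k" using le_tuples[OF reach_le[OF i] i] .
      \<comment> \<open>Both sides are the shift of \<open>?z\<close> by \<open>?a\<close>, so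
        multiplication by \<open>\<gamma>\<close> carries one arrow to the other.\<close>
      have "shift k (p + ?a) x = shift k (q + ?a) y"
        using shift_shift[OF xX bx _ ak] shift_shift[OF yX by' _ ak] p q pq by simp
      moreover have "m + (int \<circ> (q + ?a)) = int \<circ> (p + ?a)" unfolding m by (auto simp: fun_eq_iff)
      ultimately have "?c (arrow y (q + ?a)) = arrow x (p + ?a)" unfolding arrow_def cmp_G by simp
      then show ?thesis by (simp add: s'(1) sx sy)
    qed
    have "tv_dist (translate G \<gamma> (?m (src G \<gamma>))) (?m (rng G \<gamma>)) \<le> 2 * (1 - card ?S / card J)"
      unfolding tr unfolding g rng_G fst_conv mean_pmf_def
    proof (rule tv_dist_mixture_le[where u = ?u and v = ?v and S = ?S, OF J(1,2)])
      show "?F (?u s) = ?F' (?v s)" if "s \<in> ?S" for s by (rule FF[OF that])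
      show "inj_on ?u ?S" "inj_on ?v ?S" by (auto simp: inj_on_def)
      show "?u ` ?S \<subseteq> J" "?v ` ?S \<subseteq> J"
        using cube_add[OF below_tuples[OF q] qM MN] cube_add[OF below_tuples[OF p] pM MN] by (auto simp: J_def)
    qed
    also have "\<dots> < \<epsilon>"
    proof -
      have fin: "finite (cube k (N - M))" by (rule finite_cube)
      have "card ?S = (\<Sum>i\<in>cube k (N - M). card {n. n < L \<and> reach (C n) ?z i = reach (C (n + 3)) ?z i})"
        using fin by (intro card_SigmaI) auto
      also have "real \<dots> \<ge> (\<Sum>i\<in>cube k (N - M). real L - 3 * real k * real N)"
        unfolding of_nat_sum
      proof (rule sum_mono)
        fix i assume "i \<in> cube k (N - M)"
        then have "i \<in> cube k N" unfolding cube_def by (auto intro: le_trans[OF _ diff_le_self])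
        from card_good_levels[of i N C L ?z, OF this sub(2)]
        have "real L \<le> real (card {n. n < L \<and> reach (C n) ?z i = reach (C (n + 3)) ?z i} + 3 * (k * N))"
          by (simp only: of_nat_le_iff)
        then show "real L - 3 * real k * real N \<le> real (card {n. n < L \<and> reach (C n) ?z i = reach (C (n + 3)) ?z i})"
          by simp
      qed
      finally have S: "(real (N - M) + 1) ^ k * (real L - 3 * real k * real N) \<le> card ?S"
        by (simp add: card_cube add.commute)
      have cJ: "real (card J) = real L * (real N + 1) ^ k"
        by (simp add: J_def card_cartesian_product card_cube add.commute)
      let ?\<delta> = "real M / (real N + 1)" and ?\<eta> = "3 * real k * real N / real L"
      have \<eta>: "?\<eta> \<le> \<epsilon> / 8" using L L0 \<epsilon> by (simp add: field_simps)
      have \<delta>: "real k * ?\<delta> \<le> \<epsilon> / 8"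
      proof -
        have "8 * real k * real M / \<epsilon> \<le> real N + 1" using N by linarith
        then show ?thesis using \<epsilon> by (simp add: field_simps)
      qed
      have pos: "0 \<le> ?\<eta>" "0 \<le> real k * ?\<delta>" by simp_all
      have "(real (N - M) + 1) / (real N + 1) = 1 + (- ?\<delta>)"
        using MN by (simp add: of_nat_diff field_simps)
      moreover have "-1 \<le> - ?\<delta>" using MN by (simp add: field_simps)
      \<comment> \<open>Bernoulli's inequality bounds the proportion of the smaller cube from
        below.\<close>
      ultimately have B: "1 - real k * ?\<delta> \<le> ((real (N - M) + 1) / (real N + 1)) ^ k"
        using Bernoulli_inequality[of "- ?\<delta>" k] by simp
      have B1: "((real (N - M) + 1) / (real N + 1)) ^ k \<le> 1"
        by (intro power_le_one) (use MN in \<open>auto simp: field_simps\<close>)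
      let ?b = "((real (N - M) + 1) / (real N + 1)) ^ k"
      have "?b * (1 - ?\<eta>) = (real (N - M) + 1) ^ k * (real L - 3 * real k * real N) / card J"
        using L0 by (simp add: cJ power_divide field_simps)
      also have "\<dots> \<le> card ?S / card J" using S by (rule divide_right_mono) simp
      finally have "?b * (1 - ?\<eta>) \<le> card ?S / card J" .
      \<comment> \<open>The losses from the cube and from the bad levels are at most
        \<open>\<epsilon> / 8\<close> each; after the factor 2 the distance is at most
        \<open>\<epsilon> / 2\<close>.\<close>
      moreover have "?b * (1 - ?\<eta>) \<ge> 1 - \<epsilon> / 4"
      proof -
        have "?b * ?\<eta> \<le> ?\<eta>" using B1 pos(1) by (rule mult_left_le_one_le[rotated 2]) simp
        then have "?b * (1 - ?\<eta>) \<ge> ?b - ?\<eta>" by (simp add: algebra_simps)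
        then show ?thesis using B \<delta> \<eta> by linarith
      qed
      ultimately have "1 - \<epsilon> / 4 \<le> card ?S / card J" by (rule order_trans[rotated])
      moreover have "2 * (1 - r) < \<epsilon>" if "1 - \<epsilon> / 4 \<le> r" for r :: real
        using that \<epsilon> by (simp add: field_simps)
      ultimately show ?thesis by blast
    qed
    finally show ?thesis .
  qed
  ultimately show ?thesis by blast
qed

theorem amenable_boundary: "amenable G"
proof -
  let ?I = "{(K, \<epsilon>). compactin (mor_top G) K \<and> 0 < (\<epsilon> :: real)}"
  \<comment> \<open>Larger compact sets and smaller tolerances come later. The clauses on
    compactness and positivity keep the relation inside \<open>?I\<close>, as
    \<open>preorder_on\<close> requires.\<close>
  let ?R = "{((K, \<epsilon>), (K', \<epsilon>')). compactin (mor_top G) K \<and> compactin (mor_top G) K' \<and> 0 < \<epsilon>' \<and> K \<subseteq> K' \<and> \<epsilon>' \<le> (\<epsilon> :: real)}"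
  have "\<forall>j\<in>?I. \<exists>m. continuous_mean G m \<and>
      (\<forall>\<gamma>\<in>fst j. tv_dist (translate G \<gamma> (m (src G \<gamma>))) (m (rng G \<gamma>)) < snd j)"
  proof
    fix j :: "('o, 'a) path_arrow set \<times> real" assume "j \<in> ?I"
    then have "compactin (mor_top G) (fst j)" "snd j > 0" by auto
    from approximately_invariant_mean[OF this]
    show "\<exists>m. continuous_mean G m \<and>
      (\<forall>\<gamma>\<in>fst j. tv_dist (translate G \<gamma> (m (src G \<gamma>))) (m (rng G \<gamma>)) < snd j)" .
  qed
  from bchoice[OF this] obtain m where m: "\<forall>j\<in>?I. continuous_mean G (m j) \<and>
      (\<forall>\<gamma>\<in>fst j. tv_dist (translate G \<gamma> (m j (src G \<gamma>))) (m j (rng G \<gamma>)) < snd j)" by (elim exE)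
  have "directed_set ?I ?R"
    unfolding directed_set_def
  proof (intro conjI ballI)
    have "({}, 1) \<in> ?I" by simp
    then show "?I \<noteq> {}" by blast
    show "preorder_on ?I ?R" by (auto simp: preorder_on_def refl_on_def trans_def)
    fix i j assume "i \<in> ?I" "j \<in> ?I"
    then show "\<exists>l\<in>?I. (i, l) \<in> ?R \<and> (j, l) \<in> ?R"
      by (intro bexI[of _ "(fst i \<union> fst j, min (snd i) (snd j))"]) (auto intro: compactin_Un)
  qed
  moreover have "\<forall>i\<in>?I. continuous_mean G (m i)" using m by blast
  moreover have "\<exists>i0\<in>?I. \<forall>i\<in>?I. (i0, i) \<in> ?R \<longrightarrow>
      (\<forall>\<gamma>\<in>K. tv_dist (translate G \<gamma> (m i (src G \<gamma>))) (m i (rng G \<gamma>)) < \<epsilon>)"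
    if "compactin (mor_top G) K" "\<epsilon> > 0" for K and \<epsilon> :: real
  proof (intro bexI[of _ "(K, \<epsilon>)"] ballI impI)
    fix i \<gamma> assume i: "i \<in> ?I" "((K, \<epsilon>), i) \<in> ?R" and g: "\<gamma> \<in> K"
    then have "\<gamma> \<in> fst i" "snd i \<le> \<epsilon>" by auto
    moreover have "tv_dist (translate G \<gamma> (m i (src G \<gamma>))) (m i (rng G \<gamma>)) < snd i"
      using bspec[OF m i(1)] \<open>\<gamma> \<in> fst i\<close> by blast
    ultimately show "tv_dist (translate G \<gamma> (m i (src G \<gamma>))) (m i (rng G \<gamma>)) < \<epsilon>" by linarith
  qed (use that in simp)
  ultimately show ?thesis unfolding amenable_def by (intro exI[of _ ?I] exI[of _ ?R] exI[of _ m]) blast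
qed

end

text \<open>Each of the two alternatives enters through compact alignment alone.\<close>

theorem proposition6p2:
  fixes k :: nat and \<Lambda> :: "('o, 'a) kgraph"
  assumes "topological_k_graph k \<Lambda>"
    and "k = 1 \<or> (discrete_k_graph k \<Lambda> \<and> finitely_aligned \<Lambda>)"
  shows "amenable (boundary_path_groupoid k \<Lambda>)"
proof -
  interpret topological_kgraph k \<Lambda> by unfold_locales (rule assms(1))
  have "compactly_aligned_kgraph k \<Lambda>"
    using assms(2) compactly_aligned_one compactly_aligned_discrete by blast
  then show ?thesis by (rule compactly_aligned_kgraph.amenable_boundary)
qed

end
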